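(* The conjugation action of $\mathrm{Aut}(\mathbb{P})$ on $I(\mathbb{P})$, given by $(g,h)\mapsto ghg^{-1}$ for $g\in \mathrm{Aut}(\mathbb{P})$ and $h\in I(\mathbb{P})$, has a comeager orbit (that is, some orbit is a comeager subset of $I(\mathbb{P})$).
   Context: Let $r$ be a binary relation symbol. A topological $\{r\}$-structure is a compact zero-dimensional second-countable space $A$ with a closed binary relation $r^A$. An epimorphism $\phi\colon B\to A$ of topological $\{r\}$-structures is a continuous surjection such that for all $x_1,x_2\in A$: $r^A(x_1,x_2)$ holds if and only if there are $y_1,y_2\in B$ with $\phi(y_1)=x_1$, $\phi(y_2)=x_2$ and $r^B(y_1,y_2)$. An isomorphism is a bijective epimorphism. For $n\ge 1$ let $[n]=\{1,\dots,n\}$. $\mathcal{G}$ is the family of finite reflexive linear graphs, i.e. (discrete) structures $A=([n],r^A)$ with $r^A(x,y)$ iff $|x-y|\le 1$. $\mathbb{P}$ is the projective Fraïssé limit of $\mathcal{G}$: the topological $\{r\}$-structure (it exists and is unique up to isomorphism) such that (L1) for every $A\in\mathcal{G}$ there is an epimorphism $\mathbb{P}\to A$; (L2) for every finite discrete space $X$ and continuous $f\colon\mathbb{P}\to X$ there are $A\in\mathcal{G}$, an epimorphism $\phi\colon\mathbb{P}\to A$ and a function $f_0\colon A\to X$ with $f=f_0\circ\phi$; (L3) for every $A\in\mathcal{G}$ and epimorphisms $\phi_1,\phi_2\colon\mathbb{P}\to A$ there is an isomorphism $\psi\colon\mathbb{P}\to\mathbb{P}$ with $\phi_2=\phi_1\circ\psi$.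 $\mathrm{Aut}(\mathbb{P})$ is the group of homeomorphisms $f\colon\mathbb{P}\to\mathbb{P}$ such that $r^{\mathbb{P}}(x,y)\iff r^{\mathbb{P}}(f(x),f(y))$ for all $x,y$, with the topology inherited from the compact-open topology on the homeomorphism group of $\mathbb{P}$. $I(\mathbb{P})=\{f\in\mathrm{Aut}(\mathbb{P})\colon f^2=\mathrm{id}\}$ with the subspace topology. *)

theory Defs
  imports "HOL-Analysis.Analysis" "HOL-Algebra.Group_Action"
begin

(* A topological structure is a pair (X, r) of a topology and a set of pairs. As closedness of r
   is taken in the product topology, r is contained in topspace X \<times> topspace X. Compact
   zero-dimensional spaces are Hausdorff by convention; the library's dim_le 0 (every point has
   arbitrarily small neighbourhoods with empty frontier) does not imply it. *)
definition topological_structure :: "'a topology \<Rightarrow> ('a \<times> 'a) set \<Rightarrow> bool" where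
  "topological_structure X r \<longleftrightarrow>
     compact_space X \<and> Hausdorff_space X \<and> X dim_le 0 \<and> second_countable X \<and>
     closedin (prod_topology X X) r"

definition epimorphism ::
  "'b topology \<Rightarrow> ('b \<times> 'b) set \<Rightarrow> 'a topology \<Rightarrow> ('a \<times> 'a) set \<Rightarrow> ('b \<Rightarrow> 'a) \<Rightarrow> bool" where
  "epimorphism Y s X r \<phi> \<longleftrightarrow>
     continuous_map Y X \<phi> \<and> \<phi> ` topspace Y = topspace X \<and>
     (\<forall>x1 \<in> topspace X. \<forall>x2 \<in> topspace X.
        (x1, x2) \<in> r \<longleftrightarrow>
        (\<exists>y1 \<in> topspace Y. \<exists>y2 \<in> topspace Y. \<phi> y1 = x1 \<and> \<phi> y2 = x2 \<and> (y1, y2) \<in> s))"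

definition isomorphism ::
  "'b topology \<Rightarrow> ('b \<times> 'b) set \<Rightarrow> 'a topology \<Rightarrow> ('a \<times> 'a) set \<Rightarrow> ('b \<Rightarrow> 'a) \<Rightarrow> bool" where
  "isomorphism Y s X r \<phi> \<longleftrightarrow> epimorphism Y s X r \<phi> \<and> bij_betw \<phi> (topspace Y) (topspace X)"

(* The family of finite reflexive linear graphs consists of the structures
   (path_top n, path_rel n) with n \<ge> 1. *)
definition path_top :: "nat \<Rightarrow> nat topology" where
  "path_top n = discrete_topology {1..n}"

definition path_rel :: "nat \<Rightarrow> (nat \<times> nat) set" where
  "path_rel n = {(x, y). x \<in> {1..n} \<and> y \<in> {1..n} \<and> \<bar>int x - int y\<bar> \<le> 1}"

(* (X, r) is the projective Fraisse limit of the finite reflexive linear graphs. In the second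
   condition the finite discrete spaces range over finite sets Z of natural numbers, which
   represent all of them up to homeomorphism. *)
definition projective_Fraisse_limit :: "'a topology \<Rightarrow> ('a \<times> 'a) set \<Rightarrow> bool" where
  "projective_Fraisse_limit X r \<longleftrightarrow>
     topological_structure X r \<and>
     (\<forall>n\<ge>1. \<exists>\<phi>. epimorphism X r (path_top n) (path_rel n) \<phi>) \<and>
     (\<forall>(Z :: nat set) f. finite Z \<and> continuous_map X (discrete_topology Z) f \<longrightarrow>
        (\<exists>n\<ge>1. \<exists>\<phi> f0. epimorphism X r (path_top n) (path_rel n) \<phi> \<and>
           f0 \<in> {1..n} \<rightarrow> Z \<and> (\<forall>x \<in> topspace X. f x = f0 (\<phi> x)))) \<and>
     (\<forall>n\<ge>1. \<forall>\<phi>1 \<phi>2.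
        epimorphism X r (path_top n) (path_rel n) \<phi>1 \<and>
        epimorphism X r (path_top n) (path_rel n) \<phi>2 \<longrightarrow>
        (\<exists>\<psi>. isomorphism X r X r \<psi> \<and> (\<forall>x \<in> topspace X. \<phi>2 x = \<phi>1 (\<psi> x))))"

(* Self-homeomorphisms are taken extensional (undefined outside topspace X), so that each
   homeomorphism of the space is represented by exactly one function. *)
definition homeos :: "'a topology \<Rightarrow> ('a \<Rightarrow> 'a) set" where
  "homeos X = {f \<in> extensional (topspace X). homeomorphic_map X X f}"

definition compact_open_topology :: "'a topology \<Rightarrow> ('a \<Rightarrow> 'a) topology" where
  "compact_open_topology X =
     topology_generated_by {{f \<in> homeos X. f ` K \<subseteq> U} | K U. compactin X K \<and> openin X U}"

definition Aut :: "'a topology \<Rightarrow> ('a \<times> 'a) set \<Rightarrow> ('a \<Rightarrow> 'a) set" where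
  "Aut X r = {f \<in> homeos X. \<forall>x \<in> topspace X. \<forall>y \<in> topspace X. (x, y) \<in> r \<longleftrightarrow> (f x, f y) \<in> r}"

definition Aut_group :: "'a topology \<Rightarrow> ('a \<times> 'a) set \<Rightarrow> ('a \<Rightarrow> 'a) monoid" where
  "Aut_group X r = BijGroup (topspace X) \<lparr>carrier := Aut X r\<rparr>"

definition Aut_topology :: "'a topology \<Rightarrow> ('a \<times> 'a) set \<Rightarrow> ('a \<Rightarrow> 'a) topology" where
  "Aut_topology X r = subtopology (compact_open_topology X) (Aut X r)"

definition involutions :: "'a topology \<Rightarrow> ('a \<times> 'a) set \<Rightarrow> ('a \<Rightarrow> 'a) set" where
  "involutions X r = {f \<in> Aut X r. f \<otimes>\<^bsub>Aut_group X r\<^esub> f = \<one>\<^bsub>Aut_group X r\<^esub>}"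

definition involutions_topology :: "'a topology \<Rightarrow> ('a \<times> 'a) set \<Rightarrow> ('a \<Rightarrow> 'a) topology" where
  "involutions_topology X r = subtopology (Aut_topology X r) (involutions X r)"

definition conj_action :: "'a topology \<Rightarrow> ('a \<times> 'a) set \<Rightarrow> ('a \<Rightarrow> 'a) \<Rightarrow> ('a \<Rightarrow> 'a) \<Rightarrow> ('a \<Rightarrow> 'a)" where
  "conj_action X r =
     (\<lambda>g. \<lambda>h \<in> involutions X r.
        g \<otimes>\<^bsub>Aut_group X r\<^esub> h \<otimes>\<^bsub>Aut_group X r\<^esub> inv\<^bsub>Aut_group X r\<^esub> g)"

definition nowhere_dense_in :: "'a topology \<Rightarrow> 'a set \<Rightarrow> bool" where
  "nowhere_dense_in T S \<longleftrightarrow> S \<subseteq> topspace T \<and> T interior_of (T closure_of S) = {}"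

definition meager_in :: "'a topology \<Rightarrow> 'a set \<Rightarrow> bool" where
  "meager_in T S \<longleftrightarrow> (\<exists>\<N>. countable \<N> \<and> (\<forall>N \<in> \<N>. nowhere_dense_in T N) \<and> S = \<Union>\<N>)"

definition comeager_in :: "'a topology \<Rightarrow> 'a set \<Rightarrow> bool" where
  "comeager_in T S \<longleftrightarrow> S \<subseteq> topspace T \<and> meager_in T (topspace T - S)"

end

theory Submission
  imports Defs
begin

text \<open>
  The generic involution of the limit is a limit of flips of paths of even length. The flips are dense:
  for an involution \<open>f\<close> and an epimorphism \<open>\<phi>\<close> onto a path, the relation formed by the pairs
  \<open>(\<phi> x, \<phi> (f x))\<close> is connected and symmetric under exchange of coordinates, so it comes close to the
  diagonal, and a walk from there through the whole relation, continued by its mirror image, exhibits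
  it as the image of the flip of an even path. Equivariant maps between flips amalgamate by a
  mountain climbing argument: if two maps to a path move by unit steps and take the extreme values
  at their ends, all vertices of their pullback have even degree except for the corners, and the
  handshake lemma, applied modulo the flip, joins a corner to an edge that the flip reverses; the walk
  between them and its mirror image form an equivariant amalgam. It follows that the involutions with
  the corresponding extension property form a dense countable intersection of open sets, and a
  back-and-forth argument shows that any two of them are conjugate.
\<close>

section \<open>Combinatorics of finite paths and their flips\<close>

subsection \<open>Walks and their mirror images\<close>

text \<open>The obstacle is that amalgams must respect the flips. The pullback of two maps between
  paths is in general disconnected, and the component of a corner might be exchanged with its mirror
  image instead of being preserved; parity rules this out. Even length is essential: the flip of a
  path with \<open>2 * p\<close> vertices fixes no vertex and reverses only the middle edge. After
  division by a free involution, the edges that it reverses become the loops, and a graph without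
  loops has an even number of odd vertices. Parity also needs maps that never pause; removing pauses
  by doubling the target values is the origin of the heights \<open>2 * n\<close> and
  \<open>4 * n\<close>. On the side of the limit, every nonempty open set of involutions contains
  all involutions equivariant for some epimorphism onto an even path, so density becomes a question
  about finite paths. This set need not contain the involution that one started from: the identity
  is equivariant for no such epimorphism, as a flip of an even path has no fixed vertex. Hence
  generic behaviour has to be reached by perturbation.\<close>

lemma exists_walk:
  assumes "E\<^sup>*\<^sup>* x y"
  shows "\<exists>xs. xs \<noteq> [] \<and> hd xs = x \<and> last xs = y \<and> successively E xs"
  using assms
proof (induction rule: rtranclp_induct)
  case base
  then show ?case by (intro exI[of _ "[x]"]) auto
next
  case (step y z)
  then obtain xs where "xs \<noteq> []" "hd xs = x" "last xs = y" "successively E xs" by blast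
  with step show ?case
    by (intro exI[of _ "xs @ [z]"]) (auto simp: successively_append_iff)
qed

text \<open>The points of \<open>F\<close> are visited one at a time: by symmetry the walk can go on
  from the last point visited to any other. The end \<open>w\<close> stays arbitrary in the
  induction, since the walk for the smaller set must end at the new point.\<close>

lemma exists_covering_walk:
  assumes "symp E" "finite F" "\<And>y. y \<in> F \<Longrightarrow> E\<^sup>*\<^sup>* x y" "E\<^sup>*\<^sup>* x w"
  shows "\<exists>xs. xs \<noteq> [] \<and> hd xs = x \<and> last xs = w \<and> successively E xs \<and> F \<subseteq> set xs"
  using assms(2-4)
proof (induction F arbitrary: w rule: finite_induct)
  case empty
  then show ?case using exists_walk by auto
next
  case (insert y F)
  obtain xs where xs: "xs \<noteq> []" "hd xs = x" "last xs = y" "successively E xs" "F \<subseteq> set xs"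
    using insert.IH[of y] insert.prems by auto
  have "E\<^sup>*\<^sup>* y x"
    using insert.prems(1)[of y] \<open>symp E\<close> by (meson insertI1 symp_rtranclp sympD)
  with insert.prems have "E\<^sup>*\<^sup>* y w" by auto
  then obtain ys where ys: "ys \<noteq> []" "hd ys = y" "last ys = w" "successively E ys"
    using exists_walk by metis
  show ?case
  \<comment> \<open>Both walks contain \<open>y\<close>, and \<open>E\<close> need not be reflexive,
    so the second is glued on without its head.\<close>
  proof (cases "tl ys = []")
    case True
    with ys have "w = y" by (cases ys) auto
    with xs show ?thesis by (intro exI[of _ xs]) auto
  next
    case False
    then obtain z zs where "ys = y # z # zs" using ys by (cases ys; cases "tl ys") auto
    with xs ys show ?thesis
      by (intro exI[of _ "xs @ tl ys"]) (auto simp: successively_append_iff)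
  qed
qed

definition flip :: "nat \<Rightarrow> nat \<Rightarrow> nat" where
  "flip n i = Suc n - i"

lemma flip_in: "i \<in> {1..n} \<Longrightarrow> flip n i \<in> {1..n}"
  by (auto simp: flip_def)

lemma flip_flip: "i \<in> {1..n} \<Longrightarrow> flip n (flip n i) = i"
  by (auto simp: flip_def)

text \<open>A walk ending in \<open>w\<close> crosses the edge from \<open>w\<close> to
  \<open>\<tau> w\<close> and returns along its own image in reverse. Reversing the indices of such
  a concatenation amounts to applying \<open>\<tau>\<close>; the length is even because the two
  halves are equally long.\<close>

lemma exists_mirror_walk:
  assumes sym: "symp E" and field: "\<And>x y. E x y \<Longrightarrow> x \<in> A \<and> y \<in> A"
    and inv: "\<And>x. x \<in> A \<Longrightarrow> \<tau> (\<tau> x) = x" and hom: "\<And>x y. E x y \<Longrightarrow> E (\<tau> x) (\<tau> y)"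
    and F: "finite F" "\<And>y. y \<in> F \<Longrightarrow> E\<^sup>*\<^sup>* x y"
    and w: "E\<^sup>*\<^sup>* x w" "E w (\<tau> w)"
  shows "\<exists>p \<omega>. p \<ge> 1 \<and> \<omega> 1 = x \<and> \<omega> ` {1..2*p} \<subseteq> A \<and> F \<subseteq> \<omega> ` {1..2*p} \<and>
    (\<forall>i. 1 \<le> i \<and> i < 2*p \<longrightarrow> E (\<omega> i) (\<omega> (Suc i))) \<and>
    (\<forall>i \<in> {1..2*p}. \<omega> (flip (2*p) i) = \<tau> (\<omega> i))"
proof -
  obtain xs where xs: "xs \<noteq> []" "hd xs = x" "last xs = w" "successively E xs" "F \<subseteq> set xs"
    using exists_covering_walk[OF sym F w(1)] by metis
  define ys where "ys = xs @ rev (map \<tau> xs)"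
  define p where "p = length xs"
  define \<omega> where "\<omega> i = ys ! (i - 1)" for i
  have len: "length ys = 2 * p" by (simp add: ys_def p_def)
  have p: "p \<ge> 1" using xs by (cases xs) (auto simp: p_def)
  have "successively (\<lambda>x y. E (\<tau> y) (\<tau> x)) xs"
    using xs(4) by (rule successively_mono) (use hom sym in \<open>auto dest: sympD\<close>)
  hence ys: "successively E ys"
    using xs w by (auto simp: ys_def successively_append_iff successively_rev successively_map
        hd_rev last_map)
  have step: "E (ys ! j) (ys ! Suc j)" if "Suc j < 2 * p" for j
    using ys that len by (auto simp: successively_conv_nth)
  have in_A: "ys ! j \<in> A" if "j < 2 * p" for j
  proof (cases "Suc j < 2 * p")
    case True
    then show ?thesis using step field by blast
  next
    \<comment> \<open>The last vertex starts no edge of the walk, so the edge that enters it is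
      used.\<close>
    case False
    with that p have "Suc (j - 1) < 2 * p" "Suc (j - 1) = j" by linarith+
    then show ?thesis using step[of "j - 1"] field by metis
  qed
  have set_xs: "set xs \<subseteq> A"
  proof
    fix y assume "y \<in> set xs"
    then obtain j where "j < length xs" "y = xs ! j" by (auto simp: in_set_conv_nth)
    with in_A[of j] show "y \<in> A" by (simp add: ys_def p_def nth_append)
  qed
  have "map \<tau> (map \<tau> xs) = xs"
    using set_xs inv by (auto intro!: map_idI)
  hence rev: "rev (map \<tau> ys) = ys" by (simp add: ys_def rev_map)
  have mirror: "ys ! (2 * p - Suc j) = \<tau> (ys ! j)" if "j < 2 * p" for j
  proof -
    have "ys ! (2 * p - Suc j) = rev (map \<tau> ys) ! (2 * p - Suc j)" by (simp add: rev)
    also have "\<dots> = \<tau> (ys ! j)" using that len by (subst rev_nth) (auto)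
    finally show ?thesis .
  qed
  have im: "\<omega> ` {1..2*p} = set ys"
  proof -
    have "{1..2*p} = Suc ` {..<2*p}" by (simp add: image_Suc_lessThan)
    then show ?thesis using len by (auto simp: \<omega>_def in_set_conv_nth image_iff)
  qed
  show ?thesis
  proof (intro exI[of _ p] exI[of _ \<omega>] conjI p allI impI ballI)
    show "\<omega> 1 = x" using xs by (cases xs) (auto simp: \<omega>_def ys_def)
    show "\<omega> ` {1..2*p} \<subseteq> A" using in_A len unfolding im by (auto simp: in_set_conv_nth)
    show "F \<subseteq> \<omega> ` {1..2*p}" using xs unfolding im by (auto simp: ys_def)
  next
    fix i assume "1 \<le> i \<and> i < 2*p"
    then show "E (\<omega> i) (\<omega> (Suc i))" using step[of "i - 1"] by (auto simp: \<omega>_def)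
  next
    fix i assume "i \<in> {1..2*p}"
    then show "\<omega> (flip (2*p) i) = \<tau> (\<omega> i)"
      using mirror[of "i - 1"] by (auto simp: \<omega>_def flip_def)
  qed
qed

subsection \<open>A handshake argument modulo a free involution\<close>

text \<open>Enlarging \<open>T\<close> by a point adds its row and its column, which have equal
  sums.\<close>

lemma even_sum_symmetric:
  fixes m :: "'b \<Rightarrow> 'b \<Rightarrow> nat"
  assumes "finite T" "\<And>x y. x \<in> T \<Longrightarrow> y \<in> T \<Longrightarrow> m x y = m y x" "\<And>x. x \<in> T \<Longrightarrow> m x x = 0"
  shows "even (\<Sum>x\<in>T. \<Sum>y\<in>T. m x y)"
  using assms
proof (induction T rule: finite_induct)
  case empty
  then show ?case by simp
next
  case (insert z T)
  have "(\<Sum>x\<in>T. m x z) = (\<Sum>y\<in>T. m z y)"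
    using insert.prems by (intro sum.cong) auto
  with insert show ?case by (simp add: sum.distrib)
qed

text \<open>The handshake lemma for the quotient by \<open>\<tau>\<close>. The predicate
  \<open>S\<close> selects one point of each orbit, and a class has the same degree in the quotient
  as its representative has for \<open>E\<close>. If no reachable edge were reversed by
  \<open>\<tau>\<close>, the reachable part of the quotient would have no loops and \<open>v\<close>
  as its only odd vertex, which is impossible.\<close>

lemma exists_edge_to_mirror:
  fixes E :: "'b \<Rightarrow> 'b \<Rightarrow> bool"
  assumes "finite W" and field: "\<And>x y. E x y \<Longrightarrow> x \<in> W \<and> y \<in> W"
    and "symp E" and irrefl: "\<And>x. \<not> E x x"
    and \<tau>: "\<And>x. x \<in> W \<Longrightarrow> \<tau> x \<in> W" "\<And>x. x \<in> W \<Longrightarrow> \<tau> (\<tau> x) = x"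
      "\<And>x y. E x y \<Longrightarrow> E (\<tau> x) (\<tau> y)"
    and S: "\<And>x. x \<in> W \<Longrightarrow> S (\<tau> x) \<longleftrightarrow> \<not> S x"
    and v: "v \<in> W" "S v" "odd (card {y. E v y})"
    and even: "\<And>x. x \<in> W \<Longrightarrow> S x \<Longrightarrow> x \<noteq> v \<Longrightarrow> even (card {y. E x y})"
  shows "\<exists>w. E\<^sup>*\<^sup>* v w \<and> E w (\<tau> w)"
proof (rule ccontr)
  assume neg: "\<not> ?thesis"
  \<comment> \<open>The component of \<open>v\<close> together with its mirror image, and then its
    representatives; \<open>m\<close> counts the edges between two classes.\<close>
  define D where "D = {x \<in> W. E\<^sup>*\<^sup>* v x \<or> E\<^sup>*\<^sup>* v (\<tau> x)}"
  define T where "T = {x \<in> D. S x}"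
  define m :: "'b \<Rightarrow> 'b \<Rightarrow> nat" where "m x y = of_bool (E x y) + of_bool (E x (\<tau> y))" for x y
  have fin: "finite T" using \<open>finite W\<close> by (auto simp: T_def D_def)
  have D_E: "y \<in> D" if "x \<in> D" "E x y" for x y
    using that field \<tau>(3)[of x y] unfolding D_def by (auto intro: rtranclp.rtrancl_into_rtrancl)
  have D_\<tau>: "\<tau> x \<in> D" if "x \<in> D" for x
    using that \<tau> unfolding D_def by auto
  \<comment> \<open>An edge from \<open>x\<close> to \<open>\<tau> x\<close> would be a loop of the
    quotient. Its mirror image joins the same two points, so it is reachable from \<open>v\<close>
    whichever of them is.\<close>
  have no_mirror: "\<not> E x (\<tau> x)" if "x \<in> D" for x
  proof
    assume E: "E x (\<tau> x)"
    hence "E (\<tau> x) (\<tau> (\<tau> x))" by (rule \<tau>(3))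
    with E that neg show False by (auto simp: D_def)
  qed
  have swap: "E y (\<tau> x)" if "E x (\<tau> y)" "y \<in> W" for x y
    using \<tau>(3)[OF that(1)] \<tau>(2)[OF that(2)] \<open>symp E\<close> by (auto dest: sympD)
  have "even (\<Sum>x\<in>T. \<Sum>y\<in>T. m x y)"
  proof (rule even_sum_symmetric[OF fin])
    fix x y assume "x \<in> T" "y \<in> T"
    hence "x \<in> W" "y \<in> W" by (auto simp: T_def D_def)
    hence "E x (\<tau> y) = E y (\<tau> x)" "E x y = E y x"
      using swap \<open>symp E\<close> by (auto dest: sympD)
    thus "m x y = m y x" by (simp add: m_def)
  next
    fix x assume "x \<in> T"
    thus "m x x = 0" using no_mirror irrefl by (auto simp: m_def T_def)
  qed
  \<comment> \<open>Each neighbour of \<open>x\<close> either is selected by \<open>S\<close> or has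
    a selected mirror image, never both.\<close>
  moreover have "(\<Sum>y\<in>T. m x y) = card {y. E x y}" if "x \<in> T" for x
  proof -
    have "{y. E x y} = {y \<in> T. E x y} \<union> \<tau> ` {y \<in> T. E x (\<tau> y)}"
    proof (intro equalityI subsetI)
      fix y assume "y \<in> {y. E x y}"
      hence y: "E x y" "y \<in> D" "y \<in> W" using that D_E field by (auto simp: T_def)
      show "y \<in> {y \<in> T. E x y} \<union> \<tau> ` {y \<in> T. E x (\<tau> y)}"
      proof (cases "S y")
        case True
        with y show ?thesis by (auto simp: T_def)
      next
        case False
        with y S D_\<tau> \<tau>(2) have "\<tau> y \<in> {y \<in> T. E x (\<tau> y)}" by (auto simp: T_def)
        moreover have "y = \<tau> (\<tau> y)" using \<tau>(2) y by simp
        ultimately show ?thesis by blast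
      qed
    qed auto
    moreover have "{y \<in> T. E x y} \<inter> \<tau> ` {y \<in> T. E x (\<tau> y)} = {}"
      using S by (auto simp: T_def D_def)
    moreover have "inj_on \<tau> {y \<in> T. E x (\<tau> y)}"
      using \<tau>(2) by (intro inj_on_inverseI[of _ \<tau>]) (auto simp: T_def D_def)
    ultimately have "card {y. E x y} = card {y \<in> T. E x y} + card {y \<in> T. E x (\<tau> y)}"
      using fin by (simp add: card_Un_disjoint card_image)
    also have "\<dots> = (\<Sum>y\<in>T. m x y)"
      using fin by (simp add: m_def sum.distrib flip: sum.inter_filter card_eq_sum)
        (simp add: Int_def)
    finally show ?thesis by simp
  qed
  ultimately have "even (\<Sum>x\<in>T. card {y. E x y})" by simp
  moreover have "v \<in> T" using v by (auto simp: T_def D_def)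
  ultimately have "even (card {y. E v y} + (\<Sum>x\<in>T - {v}. card {y. E x y}))"
    using fin by (simp add: sum.remove)
  moreover have "even (\<Sum>x\<in>T - {v}. card {y. E x y})"
    using even by (intro dvd_sum) (auto simp: T_def D_def)
  ultimately show False using v(3) by simp
qed

subsection \<open>Maps between paths\<close>

definition near :: "nat \<Rightarrow> nat \<Rightarrow> bool" where
  "near i j \<longleftrightarrow> i \<le> Suc j \<and> j \<le> Suc i"

definition unit_step :: "nat \<Rightarrow> nat \<Rightarrow> bool" where
  "unit_step i j \<longleftrightarrow> i = Suc j \<or> j = Suc i"

text \<open>These are the epimorphisms between paths: the lifting of edges follows from surjectivity
  by \<open>path_epi_lift\<close>.\<close>

definition path_epi :: "nat \<Rightarrow> nat \<Rightarrow> (nat \<Rightarrow> nat) \<Rightarrow> bool" where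
  "path_epi m n \<alpha> \<longleftrightarrow> \<alpha> ` {1..m} = {1..n} \<and> (\<forall>i. 1 \<le> i \<and> i < m \<longrightarrow> near (\<alpha> i) (\<alpha> (Suc i)))"

definition flip_equivariant :: "nat \<Rightarrow> nat \<Rightarrow> (nat \<Rightarrow> nat) \<Rightarrow> bool" where
  "flip_equivariant m n \<alpha> \<longleftrightarrow> (\<forall>i \<in> {1..m}. \<alpha> (flip m i) = flip n (\<alpha> i))"

lemma near_flip: "near i j \<Longrightarrow> near (flip n i) (flip n j)"
  by (auto simp: near_def flip_def)

lemma unit_step_flip:
  "unit_step i j \<Longrightarrow> i \<in> {1..n} \<Longrightarrow> j \<in> {1..n} \<Longrightarrow> unit_step (flip n i) (flip n j)"
  by (auto simp: unit_step_def flip_def)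

lemma near_sym: "near i j \<Longrightarrow> near j i"
  by (auto simp: near_def)

lemma unit_step_near: "unit_step i j \<Longrightarrow> near i j"
  by (auto simp: near_def unit_step_def)

lemma path_epi_in: "path_epi m n \<alpha> \<Longrightarrow> i \<in> {1..m} \<Longrightarrow> \<alpha> i \<in> {1..n}"
  by (auto simp: path_epi_def)

lemma path_epi_near:
  assumes "path_epi m n \<alpha>" "i \<in> {1..m}" "j \<in> {1..m}" "near i j"
  shows "near (\<alpha> i) (\<alpha> j)"
proof -
  consider "i = j" | "j = Suc i" | "i = Suc j" using assms(4) unfolding near_def by linarith
  then show ?thesis
    by cases (use assms in \<open>auto simp: path_epi_def near_def\<close>)
qed

lemma path_epi_comp:
  assumes "path_epi l m \<beta>" "path_epi m n \<alpha>"
  shows "path_epi l n (\<alpha> \<circ> \<beta>)"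
proof -
  have "near (\<alpha> (\<beta> i)) (\<alpha> (\<beta> (Suc i)))" if "1 \<le> i" "i < l" for i
    using that assms path_epi_in[OF assms(1)]
    by (intro path_epi_near[OF assms(2)]) (auto simp: path_epi_def)
  moreover have "(\<alpha> \<circ> \<beta>) ` {1..l} = {1..n}"
    using assms by (simp only: path_epi_def image_comp [symmetric])
  ultimately show ?thesis by (simp add: path_epi_def)
qed

lemma flip_equivariant_comp:
  assumes "\<beta> ` {1..l} \<subseteq> {1..m}" "flip_equivariant l m \<beta>" "flip_equivariant m n \<alpha>"
  shows "flip_equivariant l n (\<alpha> \<circ> \<beta>)"
  using assms by (fastforce simp: flip_equivariant_def)

lemma near_intermediate:
  assumes "\<And>i. p \<le> i \<Longrightarrow> i < q \<Longrightarrow> near (g i) (g (Suc i))" "p \<le> q" "g p \<le> v" "v \<le> g q"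
  shows "\<exists>i. p \<le> i \<and> i \<le> q \<and> g i = v"
proof -
  have "\<exists>i. p \<le> i \<and> i \<le> q \<and> int (g i) = int v"
  proof (rule nat_intermed_int_val)
    show "\<forall>i. p \<le> i \<and> i < q \<longrightarrow> \<bar>int (g (Suc i)) - int (g i)\<bar> \<le> 1"
    proof (intro allI impI)
      fix i assume "p \<le> i \<and> i < q"
      hence "near (g i) (g (Suc i))" using assms(1) by blast
      thus "\<bar>int (g (Suc i)) - int (g i)\<bar> \<le> 1" by (auto simp: near_def)
    qed
  qed (use assms in auto)
  then show ?thesis by auto
qed

text \<open>Surjectivity comes from the values at the two ends, by the discrete intermediate value
  property.\<close>

lemma path_epiI_ends:
  assumes "\<And>i. 1 \<le> i \<Longrightarrow> i < m \<Longrightarrow> near (g i) (g (Suc i))" "g ` {1..m} \<subseteq> {1..n}"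
    "m \<ge> 1" "g 1 = 1" "g m = n"
  shows "path_epi m n g"
proof -
  have "v \<in> g ` {1..m}" if "v \<in> {1..n}" for v
    using near_intermediate[of 1 m g v] that assms by force
  with assms show ?thesis by (auto simp: path_epi_def)
qed

subsection \<open>Pullbacks of maps with unit steps\<close>

text \<open>The extreme values may come in either order, because a walk will also be paired with its
  own reflection, which runs downwards. As \<open>h \<ge> 2\<close>, the two end values
  differ.\<close>

definition step_walk :: "nat \<Rightarrow> nat \<Rightarrow> (nat \<Rightarrow> nat) \<Rightarrow> bool" where
  "step_walk M h a \<longleftrightarrow> M \<ge> 2 \<and> h \<ge> 2 \<and> a ` {1..M} \<subseteq> {1..h} \<and> {a 1, a M} = {1, h} \<and>
     (\<forall>i. 1 \<le> i \<and> i < M \<longrightarrow> unit_step (a i) (a (Suc i)))"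

definition upper_nbrs :: "nat \<Rightarrow> (nat \<Rightarrow> nat) \<Rightarrow> nat \<Rightarrow> nat set" where
  "upper_nbrs M a i = {i' \<in> {1..M}. unit_step i i' \<and> a i' = Suc (a i)}"

definition lower_nbrs :: "nat \<Rightarrow> (nat \<Rightarrow> nat) \<Rightarrow> nat \<Rightarrow> nat set" where
  "lower_nbrs M a i = {i' \<in> {1..M}. unit_step i i' \<and> Suc (a i') = a i}"

lemma finite_nbrs [simp]: "finite (upper_nbrs M a i)" "finite (lower_nbrs M a i)"
  by (auto simp: upper_nbrs_def lower_nbrs_def)

lemma step_walk_unit_step:
  assumes "step_walk M h a" "i \<in> {1..M}" "j \<in> {1..M}" "unit_step i j"
  shows "unit_step (a i) (a j)"
proof -
  consider "j = Suc i" | "i = Suc j" using assms(4) by (auto simp: unit_step_def)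
  then show ?thesis using assms by cases (auto simp: step_walk_def unit_step_def)
qed

text \<open>A unit step leads up or down, so the neighbours of \<open>i\<close> in the path split
  into two kinds, of which an extreme value admits only one.\<close>

lemma card_nbrs:
  assumes a: "step_walk M h a" and i: "i \<in> {1..M}"
  shows "card (upper_nbrs M a i) + card (lower_nbrs M a i) = (if i = 1 \<or> i = M then 1 else 2)"
    and "a i = 1 \<Longrightarrow> lower_nbrs M a i = {}" and "a i = h \<Longrightarrow> upper_nbrs M a i = {}"
proof -
  have "upper_nbrs M a i \<union> lower_nbrs M a i = {i' \<in> {1..M}. unit_step i i'}"
    using step_walk_unit_step[OF a i]
    unfolding upper_nbrs_def lower_nbrs_def unit_step_def[of "a i"] by fastforce
  moreover have "upper_nbrs M a i \<inter> lower_nbrs M a i = {}"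
    by (auto simp: upper_nbrs_def lower_nbrs_def)
  ultimately have "card (upper_nbrs M a i) + card (lower_nbrs M a i)
      = card {i' \<in> {1..M}. unit_step i i'}"
    by (metis card_Un_disjoint finite_nbrs)
  moreover have "{i' \<in> {1..M}. unit_step i i'} =
      (if i = 1 then {2} else if i = M then {M - 1} else {i - 1, i + 1})"
    using i a by (auto simp: unit_step_def step_walk_def)
  ultimately show "card (upper_nbrs M a i) + card (lower_nbrs M a i)
      = (if i = 1 \<or> i = M then 1 else 2)"
    using i by auto
  show "lower_nbrs M a i = {}" if "a i = 1"
    using that a by (force simp: lower_nbrs_def step_walk_def)
  show "upper_nbrs M a i = {}" if "a i = h"
    using that a by (force simp: upper_nbrs_def step_walk_def)
qed

definition pullback :: "nat \<Rightarrow> (nat \<Rightarrow> nat) \<Rightarrow> nat \<Rightarrow> (nat \<Rightarrow> nat) \<Rightarrow> (nat \<times> nat) set" where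
  "pullback M a N b = {(i, j). i \<in> {1..M} \<and> j \<in> {1..N} \<and> a i = b j}"

definition pullback_adj ::
  "nat \<Rightarrow> (nat \<Rightarrow> nat) \<Rightarrow> nat \<Rightarrow> (nat \<Rightarrow> nat) \<Rightarrow> nat \<times> nat \<Rightarrow> nat \<times> nat \<Rightarrow> bool" where
  "pullback_adj M a N b x y \<longleftrightarrow> x \<in> pullback M a N b \<and> y \<in> pullback M a N b \<and>
     unit_step (fst x) (fst y) \<and> unit_step (snd x) (snd y)"

text \<open>Along an edge of the pullback both maps go up or both go down, so the degree is a sum of
  two products. At an extreme value one product vanishes and the other has factors 1 or 2, with 1
  exactly at the ends of the paths. At any other value both indices are interior, so in each path
  the numbers of upper and lower neighbours add up to 2 and have equal parity; the two products then
  have equal parity as well.\<close>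

lemma pullback_degree:
  assumes a: "step_walk M h a" and b: "step_walk N h b" and ij: "(i, j) \<in> pullback M a N b"
  shows "odd (card {y. pullback_adj M a N b (i, j) y}) \<longleftrightarrow> (i = 1 \<or> i = M) \<and> (j = 1 \<or> j = N)"
proof -
  let ?ua = "upper_nbrs M a i" and ?la = "lower_nbrs M a i"
  let ?ub = "upper_nbrs N b j" and ?lb = "lower_nbrs N b j"
  have i: "i \<in> {1..M}" and j: "j \<in> {1..N}" and v: "a i = b j"
    using ij by (auto simp: pullback_def)
  have "{y. pullback_adj M a N b (i, j) y} = ?ua \<times> ?ub \<union> ?la \<times> ?lb"
    using i j v step_walk_unit_step[OF a i] step_walk_unit_step[OF b j]
    by (fastforce simp: pullback_adj_def pullback_def upper_nbrs_def lower_nbrs_def unit_step_def)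
  moreover have "(?ua \<times> ?ub) \<inter> (?la \<times> ?lb) = {}"
    by (auto simp: upper_nbrs_def lower_nbrs_def)
  ultimately have deg: "card {y. pullback_adj M a N b (i, j) y}
      = card ?ua * card ?ub + card ?la * card ?lb"
    by (simp add: card_Un_disjoint card_cartesian_product)
  note ca = card_nbrs[OF a i] and cb = card_nbrs[OF b j]
  show ?thesis
  proof (cases "a i = 1 \<or> a i = h")
    case True
    then show ?thesis
    proof
      assume "a i = 1"
      with ca cb v have "?la = {}" "?lb = {}" by auto
      with ca(1) cb(1) deg show ?thesis by (auto split: if_splits)
    next
      assume "a i = h"
      with ca cb v have "?ua = {}" "?ub = {}" by auto
      with ca(1) cb(1) deg show ?thesis by (auto split: if_splits)
    qed
  next
    case False
    have "i \<noteq> 1" "i \<noteq> M" "j \<noteq> 1" "j \<noteq> N"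
      using False v a b by (auto simp: step_walk_def doubleton_eq_iff)
    hence "card ?ua + card ?la = 2" "card ?ub + card ?lb = 2" using ca(1) cb(1) by auto
    moreover have "even (x * y + x' * y')" if "x + x' = 2" "y + y' = 2" for x x' y y' :: nat
    proof -
      have "even x = even x'" "even y = even y'"
        using that by (metis even_add even_numeral)+
      thus ?thesis by auto
    qed
    ultimately show ?thesis using deg \<open>i \<noteq> 1\<close> \<open>i \<noteq> M\<close> by simp
  qed
qed

text \<open>Only corners have odd degree, and \<open>S\<close> keeps a single one of them, so the
  handshake argument leads from it to an edge that \<open>\<tau>\<close> reverses. The walk need not
  cover the pullback: where a projection has to be onto, its values at the ends of the walk ensure
  this.\<close>

lemma pullback_mirror_walk:
  assumes a: "step_walk M h a" and b: "step_walk N h b"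
    and \<tau>: "\<And>x. x \<in> pullback M a N b \<Longrightarrow> \<tau> (\<tau> x) = x"
      "\<And>x y. pullback_adj M a N b x y \<Longrightarrow> pullback_adj M a N b (\<tau> x) (\<tau> y)"
      "\<And>x. x \<in> pullback M a N b \<Longrightarrow> \<tau> x \<in> pullback M a N b"
    and S: "\<And>x. x \<in> pullback M a N b \<Longrightarrow> S (\<tau> x) \<longleftrightarrow> \<not> S x"
    and v: "v \<in> pullback M a N b" "S v" "fst v \<in> {1, M}" "snd v \<in> {1, N}"
    and corners: "\<And>x. x \<in> pullback M a N b \<Longrightarrow> fst x \<in> {1, M} \<Longrightarrow> snd x \<in> {1, N} \<Longrightarrow> S x \<Longrightarrow> x = v"
  shows "\<exists>p \<omega>. p \<ge> 1 \<and> \<omega> 1 = v \<and> \<omega> ` {1..2*p} \<subseteq> pullback M a N b \<and>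
    (\<forall>i. 1 \<le> i \<and> i < 2*p \<longrightarrow> pullback_adj M a N b (\<omega> i) (\<omega> (Suc i))) \<and>
    (\<forall>i \<in> {1..2*p}. \<omega> (flip (2*p) i) = \<tau> (\<omega> i))"
proof -
  let ?E = "pullback_adj M a N b" and ?W = "pullback M a N b"
  have sym: "symp ?E" by (auto simp: symp_def pullback_adj_def unit_step_def)
  have field: "?E x y \<Longrightarrow> x \<in> ?W \<and> y \<in> ?W" for x y by (auto simp: pullback_adj_def)
  have "\<exists>w. ?E\<^sup>*\<^sup>* v w \<and> ?E w (\<tau> w)"
  proof (rule exists_edge_to_mirror[where W = ?W and S = S])
    show "finite ?W"
      by (rule finite_subset[of _ "{1..M} \<times> {1..N}"]) (auto simp: pullback_def)
    show "odd (card {y. ?E v y})"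
      using pullback_degree[OF a b, of "fst v" "snd v"] v by auto
    show "even (card {y. ?E x y})" if "x \<in> ?W" "S x" "x \<noteq> v" for x
      using pullback_degree[OF a b, of "fst x" "snd x"] that corners[of x] by auto
    show "\<not> ?E x x" for x by (auto simp: pullback_adj_def unit_step_def)
  qed (use sym field \<tau> S v in auto)
  then obtain w where "?E\<^sup>*\<^sup>* v w" "?E w (\<tau> w)" by blast
  with exists_mirror_walk[OF sym field \<tau>(1,2), where F = "{}" and x = v and w = w]
  show ?thesis by simp
qed

subsection \<open>Doubling values to remove pauses\<close>

text \<open>A map that moves by at most one step may pause. Subdividing each value \<open>v\<close> of the target into
  \<open>2 v - 1\<close> and \<open>2 v\<close> gives room to replace every pause by a unit step.\<close>

definition half :: "nat \<Rightarrow> nat" where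
  "half u = Suc u div 2"

text \<open>A graph on the pullback of \<open>\<alpha>\<close> along the subdivision
  \<open>half\<close>. Only the second coordinate is forced to move; the first may pause.\<close>

definition double_adj :: "nat \<Rightarrow> (nat \<Rightarrow> nat) \<Rightarrow> nat \<times> nat \<Rightarrow> nat \<times> nat \<Rightarrow> bool" where
  "double_adj m \<alpha> x y \<longleftrightarrow> fst x \<in> {1..m} \<and> fst y \<in> {1..m} \<and>
     half (snd x) = \<alpha> (fst x) \<and> half (snd y) = \<alpha> (fst y) \<and>
     near (fst x) (fst y) \<and> unit_step (snd x) (snd y)"

lemma symp_double_adj: "symp (double_adj m \<alpha>)"
  by (auto simp: symp_def double_adj_def near_def unit_step_def)

lemma half_eqD: "half u = v \<Longrightarrow> v \<ge> 1 \<Longrightarrow> u = 2 * v - 1 \<or> u = 2 * v"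
  by (auto simp: half_def)

lemma half_double [simp]: "half (2 * v) = v" "v \<ge> 1 \<Longrightarrow> half (2 * v - 1) = v" "half (Suc (2 * v)) = Suc v"
  by (auto simp: half_def)

lemma half_flip: "half (flip (4 * n) u) = flip (2 * n) (half u)" if "u \<in> {1..4*n}"
  using that by (auto simp: half_def flip_def)

lemma half_in_iff: "half u \<in> {1..n} \<longleftrightarrow> u \<in> {1..2*n}"
  by (auto simp: half_def)

text \<open>The two values over a vertex differ by one and are joined by an edge. The fibres over
  \<open>x\<close> and \<open>Suc x\<close> are joined too: if \<open>\<alpha>\<close> pauses, by
  moving within the subdivided value, and otherwise by crossing from \<open>2 * v\<close> to
  \<open>2 * v + 1\<close> or back, where \<open>v\<close> is the smaller value.\<close>

lemma double_connected:
  assumes \<alpha>: "path_epi m n \<alpha>" and "x \<in> {1..m}" "half u = \<alpha> x" "y \<in> {1..m}" "half v = \<alpha> y"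
  shows "(double_adj m \<alpha>)\<^sup>*\<^sup>* (x, u) (y, v)"
proof -
  let ?E = "double_adj m \<alpha>"
  have pos: "\<alpha> x \<ge> 1" if "x \<in> {1..m}" for x using path_epi_in[OF \<alpha> that] by auto
  have fiber: "?E\<^sup>*\<^sup>* (x, u) (x, v)" if x: "x \<in> {1..m}" "half u = \<alpha> x" "half v = \<alpha> x" for x u v
  proof (cases "u = v")
    case False
    with half_eqD[OF x(2)] half_eqD[OF x(3)] pos[OF x(1)] have "unit_step u v"
      by (auto simp: unit_step_def)
    with x have "?E (x, u) (x, v)" by (simp add: double_adj_def near_def)
    then show ?thesis by blast
  qed auto
  have Suc: "?E\<^sup>*\<^sup>* (x, u) (Suc x, v)"
    if x: "1 \<le> x" "x < m" "half u = \<alpha> x" "half v = \<alpha> (Suc x)" for x u v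
  proof -
    have "near (\<alpha> x) (\<alpha> (Suc x))" using \<alpha> x by (auto simp: path_epi_def)
    then consider "\<alpha> (Suc x) = \<alpha> x" | "\<alpha> (Suc x) = Suc (\<alpha> x)" | "\<alpha> x = Suc (\<alpha> (Suc x))"
      by (fastforce simp: near_def)
    then obtain u' v' where u': "half u' = \<alpha> x" "half v' = \<alpha> (Suc x)" "unit_step u' v'"
    proof cases
      case 1
      with pos[of x] x show ?thesis
        by (intro that[of "2 * \<alpha> x - 1" "2 * \<alpha> x"]) (auto simp: unit_step_def half_def)
    next
      case 2
      with pos[of x] x show ?thesis
        by (intro that[of "2 * \<alpha> x" "Suc (2 * \<alpha> x)"]) (auto simp: unit_step_def)
    next
      case 3
      with pos[of x] x show ?thesis
        by (intro that[of "Suc (2 * \<alpha> (Suc x))" "2 * \<alpha> (Suc x)"]) (auto simp: unit_step_def)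
    qed
    have "?E\<^sup>*\<^sup>* (x, u) (x, u')" using x u' by (intro fiber) auto
    also have "?E (x, u') (Suc x, v')" using x u' by (simp add: double_adj_def near_def)
    also have "?E\<^sup>*\<^sup>* (Suc x, v') (Suc x, v)" using x u' by (intro fiber) auto
    finally show ?thesis .
  qed
  have "?E\<^sup>*\<^sup>* (1, u) (y, v)" if "half u = \<alpha> 1" "half v = \<alpha> y" "1 \<le> y" "y \<le> m" for u v y
    using that(3,4,2)
  proof (induction y arbitrary: v rule: dec_induct)
    case base
    with that show ?case by (intro fiber) auto
  next
    case (step y)
    have "?E\<^sup>*\<^sup>* (1, u) (y, 2 * \<alpha> y)" using step by (intro step.IH) auto
    also have "?E\<^sup>*\<^sup>* (y, 2 * \<alpha> y) (Suc y, v)" using step by (intro Suc) auto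
    finally show ?case .
  qed
  note from_1 = this[of "2 * \<alpha> 1"]
  have "?E\<^sup>*\<^sup>* (1, 2 * \<alpha> 1) (x, u)" "?E\<^sup>*\<^sup>* (1, 2 * \<alpha> 1) (y, v)" using assms from_1 by auto
  thus ?thesis
    using symp_double_adj symp_rtranclp by (metis rtranclp_trans sympD)
qed

lemma finite_double: "finite {(x, u). x \<in> {1..m} \<and> half u = \<alpha> x}" if "path_epi m n \<alpha>"
proof (rule finite_subset)
  show "{(x, u). x \<in> {1..m} \<and> half u = \<alpha> x} \<subseteq> {1..m} \<times> {1..2*n}"
    using path_epi_in[OF that] half_in_iff by fastforce
qed auto

text \<open>A walk through the whole doubled graph, from a vertex at height 1 to one at height
  \<open>2 * n\<close>. Its first coordinate is onto because every vertex is visited, and its second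
  coordinate never pauses.\<close>

lemma exists_step_walk:
  assumes \<alpha>: "path_epi m n \<alpha>" and "n \<ge> 1"
  shows "\<exists>M \<epsilon> a. path_epi M m \<epsilon> \<and> step_walk M (2*n) a \<and> a 1 = 1 \<and> a M = 2*n \<and>
    (\<forall>i \<in> {1..M}. \<alpha> (\<epsilon> i) = half (a i))"
proof -
  let ?F = "{(x, u). x \<in> {1..m} \<and> half u = \<alpha> x}"
  obtain x y where x: "x \<in> {1..m}" "\<alpha> x = 1" and y: "y \<in> {1..m}" "\<alpha> y = n"
    using \<alpha> \<open>n \<ge> 1\<close> unfolding path_epi_def
    by (metis (no_types, lifting) atLeastAtMost_iff imageE order_refl)
  have "half 1 = 1" by (simp add: half_def)
  with x have x': "(x, 1) \<in> ?F" by simp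
  have "\<exists>xs. xs \<noteq> [] \<and> hd xs = (x, 1) \<and> last xs = (y, 2 * n) \<and>
      successively (double_adj m \<alpha>) xs \<and> ?F \<subseteq> set xs"
  proof (rule exists_covering_walk[OF symp_double_adj finite_double[OF \<alpha>]])
    show "(double_adj m \<alpha>)\<^sup>*\<^sup>* (x, 1) z" if "z \<in> ?F" for z
      using that double_connected[OF \<alpha>, of x 1] x' by auto
    show "(double_adj m \<alpha>)\<^sup>*\<^sup>* (x, 1) (y, 2 * n)"
      using double_connected[OF \<alpha>, of x 1 y "2 * n"] x' y by auto
  qed
  then obtain xs where xs: "xs \<noteq> []" "hd xs = (x, 1)" "last xs = (y, 2 * n)"
      "successively (double_adj m \<alpha>) xs" "?F \<subseteq> set xs"
    by blast
  define M where "M = length xs"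
  define \<epsilon> where "\<epsilon> i = fst (xs ! (i - 1))" for i
  define a where "a i = snd (xs ! (i - 1))" for i
  have a1: "a 1 = 1" and aM: "a M = 2 * n"
    using xs by (auto simp: a_def M_def hd_conv_nth last_conv_nth)
  have M: "M \<ge> 2"
  proof (rule ccontr)
    assume "\<not> M \<ge> 2"
    moreover have "M \<noteq> 0" using xs(1) by (simp add: M_def)
    ultimately have "M = 1" by linarith
    with a1 aM show False by simp
  qed
  have step: "double_adj m \<alpha> (xs ! (i - 1)) (xs ! i)" if "1 \<le> i" "i < M" for i
    using xs that by (cases i) (auto simp: successively_conv_nth M_def)
  have set_xs: "set xs \<subseteq> ?F"
  proof
    fix z assume "z \<in> set xs"
    then obtain j where j: "j < M" "z = xs ! j" by (auto simp: in_set_conv_nth M_def)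
    show "z \<in> ?F"
    proof (cases "Suc j < M")
      case True
      with step[of "Suc j"] j show ?thesis by (cases z) (auto simp: double_adj_def)
    next
      case False
      with M j step[of j] show ?thesis by (cases z) (auto simp: double_adj_def)
    qed
  qed
  have im: "(\<lambda>i. xs ! (i - 1)) ` {1..M} = set xs"
  proof -
    have "{1..M} = Suc ` {..<M}" by (simp add: image_Suc_lessThan)
    moreover have "set xs = (!) xs ` {..<M}" by (auto simp: set_conv_nth M_def)
    ultimately show ?thesis by (simp add: image_image)
  qed
  hence F: "(\<lambda>i. xs ! (i - 1)) ` {1..M} = ?F" using set_xs xs by auto
  have "\<epsilon> ` {1..M} = fst ` ((\<lambda>i. xs ! (i - 1)) ` {1..M})" by (auto simp: \<epsilon>_def image_image)
  also have "\<dots> = {1..m}"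
  proof -
    have "x \<in> fst ` ?F" if "x \<in> {1..m}" for x
      using that by (intro image_eqI[of _ _ "(x, 2 * \<alpha> x)"]) auto
    then show ?thesis unfolding F by auto
  qed
  finally have "\<epsilon> ` {1..M} = {1..m}" .
  moreover have "near (\<epsilon> i) (\<epsilon> (Suc i))" if "1 \<le> i" "i < M" for i
    using step[OF that] by (simp add: \<epsilon>_def double_adj_def)
  ultimately have "path_epi M m \<epsilon>" by (simp add: path_epi_def)
  moreover have in_F: "\<epsilon> i \<in> {1..m} \<and> \<alpha> (\<epsilon> i) = half (a i)" if "i \<in> {1..M}" for i
  proof -
    have "(\<epsilon> i, a i) \<in> ?F"
      unfolding \<epsilon>_def a_def prod.collapse F [symmetric] using that by (rule imageI)
    then show ?thesis by simp
  qed
  moreover have "step_walk M (2*n) a"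
  proof -
    have "a i \<in> {1..2*n}" if "i \<in> {1..M}" for i
      using in_F[OF that] path_epi_in[OF \<alpha>] half_in_iff by metis
    moreover have "unit_step (a i) (a (Suc i))" if "1 \<le> i" "i < M" for i
      using step[OF that] by (simp add: a_def double_adj_def)
    ultimately show ?thesis using M \<open>n \<ge> 1\<close> a1 aM by (auto simp: step_walk_def)
  qed
  ultimately show ?thesis using a1 aM by (intro exI[of _ M] exI[of _ \<epsilon>] exI[of _ a]) simp
qed

text \<open>As \<open>half\<close> carries the flip of \<open>{1..4*n}\<close> to the flip of
  \<open>{1..2*n}\<close>, the pair of flips acts on the doubled graph, and a covering walk can be
  continued by its mirror image once it stands next to it.\<close>

lemma exists_equivariant_step_walk:
  assumes \<alpha>: "path_epi (2*m) (2*n) \<alpha>" "flip_equivariant (2*m) (2*n) \<alpha>" and "n \<ge> 1"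
  shows "\<exists>p \<epsilon> a. path_epi (2*p) (2*m) \<epsilon> \<and> flip_equivariant (2*p) (2*m) \<epsilon> \<and>
    step_walk (2*p) (4*n) a \<and> flip_equivariant (2*p) (4*n) a \<and> a 1 = 1 \<and>
    (\<forall>i \<in> {1..2*p}. \<alpha> (\<epsilon> i) = half (a i))"
proof -
  let ?F = "{(x, u). x \<in> {1..2*m} \<and> half u = \<alpha> x}"
  let ?E = "double_adj (2*m) \<alpha>"
  let ?\<tau> = "\<lambda>(x, u). (flip (2*m) x, flip (4*n) u)"
  obtain x where x: "x \<in> {1..2*m}" "\<alpha> x = 1"
    using \<alpha>(1) \<open>n \<ge> 1\<close> unfolding path_epi_def
    by (metis (no_types, lifting) atLeastAtMost_iff imageE order_refl mult_2 trans_le_add1)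
  have m: "m \<ge> 1" using x by auto
  have F_range: "u \<in> {1..4*n}" if "(x, u) \<in> ?F" for x u
  proof -
    have "half u \<in> {1..2*n}" using that path_epi_in[OF \<alpha>(1)] by auto
    then show ?thesis using half_in_iff[of u "2*n"] by simp
  qed
  have F_iff: "?E y z \<longleftrightarrow> y \<in> ?F \<and> z \<in> ?F \<and> near (fst y) (fst z) \<and> unit_step (snd y) (snd z)" for y z
    by (cases y; cases z) (auto simp: double_adj_def)
  have \<tau>_F: "?\<tau> y \<in> ?F" if "y \<in> ?F" for y
    using that F_range \<alpha>(2) half_flip flip_in[of _ "2*m"]
    by (cases y) (auto simp: flip_equivariant_def)
  have conn: "?E\<^sup>*\<^sup>* y z" if "y \<in> ?F" "z \<in> ?F" for y z
    using double_connected[OF \<alpha>(1)] that by auto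
  have x_F: "(x, 1) \<in> ?F" using x by (simp add: half_def)
  have \<alpha>_m: "\<alpha> (Suc m) = flip (2*n) (\<alpha> m)" "\<alpha> m \<in> {1..2*n}"
    using bspec[OF \<alpha>(2)[unfolded flip_equivariant_def], of m] m path_epi_in[OF \<alpha>(1), of m]
    by (auto simp: flip_def)
  \<comment> \<open>The flip exchanges \<open>m\<close> and \<open>Suc m\<close>, so
    \<open>\<alpha>\<close> sends this middle edge to a vertex and its mirror image that are near,
    that is, to \<open>n\<close> and \<open>Suc n\<close> in some order. Accordingly
    \<open>u\<close> is one of the two middle values of \<open>{1..4*n}\<close>, and the walk can
    turn back here.\<close>
  have "near (\<alpha> m) (\<alpha> (Suc m))" using \<alpha> m by (auto simp: path_epi_def)
  with \<alpha>_m have "\<alpha> m = n \<or> \<alpha> m = Suc n" by (auto simp: near_def flip_def)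
  then obtain u where u: "half u = \<alpha> m" "u = 2 * n \<or> u = Suc (2 * n)" by force
  have w_F: "(m, u) \<in> ?F" using u m by auto
  have center: "?E (m, u) (?\<tau> (m, u))"
    using w_F \<tau>_F[OF w_F] u by (auto simp: F_iff near_def flip_def unit_step_def)
  have "\<exists>p \<omega>. p \<ge> 1 \<and> \<omega> 1 = (x, 1) \<and> \<omega> ` {1..2*p} \<subseteq> ?F \<and> ?F \<subseteq> \<omega> ` {1..2*p} \<and>
    (\<forall>i. 1 \<le> i \<and> i < 2*p \<longrightarrow> ?E (\<omega> i) (\<omega> (Suc i))) \<and>
    (\<forall>i \<in> {1..2*p}. \<omega> (flip (2*p) i) = ?\<tau> (\<omega> i))"
  proof (rule exists_mirror_walk[where w = "(m, u)"])
    show "?\<tau> (?\<tau> y) = y" if "y \<in> ?F" for y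
      using that F_range by (cases y) (auto simp: flip_flip)
    show "?E (?\<tau> y) (?\<tau> z)" if "?E y z" for y z
    proof -
      have "y \<in> ?F" "z \<in> ?F" "near (fst y) (fst z)" "unit_step (snd y) (snd z)"
        using that unfolding F_iff by auto
      with \<tau>_F F_range show ?thesis unfolding F_iff
        by (cases y; cases z) (auto intro: near_flip unit_step_flip)
    qed
    show "?E y z \<Longrightarrow> y \<in> ?F \<and> z \<in> ?F" for y z unfolding F_iff by blast
    show "?E\<^sup>*\<^sup>* (x, 1) y" if "y \<in> ?F" for y by (rule conn[OF x_F that])
    show "?E\<^sup>*\<^sup>* (x, 1) (m, u)" by (rule conn[OF x_F w_F])
  qed (rule symp_double_adj finite_double[OF \<alpha>(1)] center)+
  then obtain p \<omega> where p: "p \<ge> 1" and \<omega>: "\<omega> 1 = (x, 1)" "\<omega> ` {1..2*p} \<subseteq> ?F" "?F \<subseteq> \<omega> ` {1..2*p}"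
    "\<forall>i. 1 \<le> i \<and> i < 2*p \<longrightarrow> ?E (\<omega> i) (\<omega> (Suc i))"
    "\<forall>i \<in> {1..2*p}. \<omega> (flip (2*p) i) = ?\<tau> (\<omega> i)"
    by (elim exE conjE) (rule that)
  have im: "\<omega> ` {1..2*p} = ?F" using \<omega>(2,3) by (rule subset_antisym)
  define \<epsilon> where "\<epsilon> i = fst (\<omega> i)" for i
  define a where "a i = snd (\<omega> i)" for i
  have in_F: "\<epsilon> i \<in> {1..2*m} \<and> half (a i) = \<alpha> (\<epsilon> i) \<and> a i \<in> {1..4*n}" if "i \<in> {1..2*p}" for i
  proof -
    have F: "(\<epsilon> i, a i) \<in> ?F"
      unfolding \<epsilon>_def a_def prod.collapse by (rule subsetD[OF \<omega>(2) imageI[OF that]])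
    from F_range[OF F] F show ?thesis by simp
  qed
  have "\<epsilon> ` {1..2*p} = fst ` ?F" unfolding im [symmetric] by (simp add: \<epsilon>_def image_image)
  also have "\<dots> = {1..2*m}"
  proof -
    have "x \<in> fst ` ?F" if "x \<in> {1..2*m}" for x
      using that by (intro image_eqI[of _ _ "(x, 2 * \<alpha> x)"]) auto
    then show ?thesis by auto
  qed
  finally have epi: "path_epi (2*p) (2*m) \<epsilon>"
    using \<omega>(4) by (auto simp: path_epi_def \<epsilon>_def F_iff)
  have equi: "flip_equivariant (2*p) (2*m) \<epsilon>" "flip_equivariant (2*p) (4*n) a"
    using \<omega>(5) by (auto simp: flip_equivariant_def \<epsilon>_def a_def split_beta)
  have a1: "a 1 = 1" using \<omega>(1) by (simp add: a_def)
  have walk: "step_walk (2*p) (4*n) a"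
  proof -
    have "a (2*p) = flip (4*n) (a 1)"
      using equi(2) p by (force simp: flip_equivariant_def flip_def)
    with a1 have "a (2*p) = 4*n" by (simp add: flip_def)
    with a1 \<omega>(4) p \<open>n \<ge> 1\<close> in_F show ?thesis by (auto simp: step_walk_def a_def F_iff)
  qed
  have "\<forall>i \<in> {1..2*p}. \<alpha> (\<epsilon> i) = half (a i)"
  proof
    fix i assume "i \<in> {1..2*p}"
    from in_F[OF this] show "\<alpha> (\<epsilon> i) = half (a i)" by (elim conjE) (rule sym)
  qed
  with epi equi walk a1 show ?thesis by (intro exI conjI)
qed

subsection \<open>Equivariant amalgamation\<close>

text \<open>The pullback of a walk with its own reflection consists of pairs of indices at mirrored
  heights, on which the swap of coordinates plays the role of the flip. Along a mirror walk the
  first coordinate refines the path, and reversing the walk replaces each height by the mirrored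
  one.\<close>

lemma exists_equivariant_refinement:
  assumes \<alpha>: "path_epi m (2*n) \<alpha>" and "n \<ge> 1"
  shows "\<exists>p \<gamma>. p \<ge> 1 \<and> path_epi (2*p) m \<gamma> \<and> flip_equivariant (2*p) (2*n) (\<alpha> \<circ> \<gamma>)"
proof -
  obtain M \<epsilon> a where \<epsilon>: "path_epi M m \<epsilon>" and a: "step_walk M (4*n) a" and a1: "a 1 = 1"
    and aM: "a M = 4*n" and \<alpha>\<epsilon>: "\<And>i. i \<in> {1..M} \<Longrightarrow> \<alpha> (\<epsilon> i) = half (a i)"
    using exists_step_walk[OF \<alpha>] \<open>n \<ge> 1\<close> by (auto simp: mult.assoc[symmetric])
  have M: "M \<ge> 2" using a by (simp add: step_walk_def)
  define b where "b i = flip (4*n) (a i)" for i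
  have a_in: "a i \<in> {1..4*n}" if "i \<in> {1..M}" for i
    using a that unfolding step_walk_def by blast
  have b: "step_walk M (4*n) b"
  proof -
    have "unit_step (b i) (b (Suc i))" if "1 \<le> i" "i < M" for i
      using that a a_in unfolding b_def by (intro unit_step_flip) (auto simp: step_walk_def)
    moreover have "b ` {1..M} \<subseteq> {1..4*n}" using a_in flip_in unfolding b_def by blast
    moreover have "b 1 = 4*n" "b M = 1" using a1 aM by (auto simp: b_def flip_def)
    ultimately show ?thesis using a by (auto simp: step_walk_def)
  qed
  let ?W = "pullback M a M b"
  have W_iff: "(i, j) \<in> ?W \<longleftrightarrow> i \<in> {1..M} \<and> j \<in> {1..M} \<and> a i + a j = Suc (4*n)" for i j
    using a_in[of i] a_in[of j] by (auto simp: pullback_def b_def flip_def)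
  have "\<exists>p \<omega>. p \<ge> 1 \<and> \<omega> 1 = (1, M) \<and> \<omega> ` {1..2*p} \<subseteq> ?W \<and>
    (\<forall>i. 1 \<le> i \<and> i < 2*p \<longrightarrow> pullback_adj M a M b (\<omega> i) (\<omega> (Suc i))) \<and>
    (\<forall>i \<in> {1..2*p}. \<omega> (flip (2*p) i) = prod.swap (\<omega> i))"
  \<comment> \<open>Among the corners only \<open>(1, M)\<close> and \<open>(M, 1)\<close> lie in
    the pullback, since \<open>a\<close> rises from 1 to \<open>4 * n\<close>; the condition
    \<open>i < j\<close> keeps the first.\<close>
  proof (rule pullback_mirror_walk[OF a b, where S = "\<lambda>(i, j). i < j"])
    show *: "prod.swap x \<in> ?W" if "x \<in> ?W" for x
      using that by (cases x) (auto simp: W_iff)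
    show "pullback_adj M a M b (prod.swap x) (prod.swap y)" if "pullback_adj M a M b x y" for x y
      using that * by (auto simp: pullback_adj_def)
    show "(case prod.swap x of (i, j) \<Rightarrow> i < j) \<longleftrightarrow> \<not> (case x of (i, j) \<Rightarrow> i < j)" if "x \<in> ?W" for x
    proof -
      obtain i j where x: "x = (i, j)" by (cases x)
      have "a i + a j = Suc (4*n)" using that unfolding x W_iff by blast
      \<comment> \<open>On the diagonal twice a height would equal the odd number
        \<open>4 * n + 1\<close>; hence the swap is free.\<close>
      have "i \<noteq> j"
      proof
        assume "i = j"
        with \<open>a i + a j = Suc (4*n)\<close> have "2 * a j = Suc (4*n)" by simp
        thus False by presburger
      qed
      then show ?thesis by (auto simp: x)
    qed
    show "(1, M) \<in> ?W" using M a1 aM by (auto simp: W_iff)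
  qed (use M in auto)
  then obtain p \<omega> where p: "p \<ge> 1" and \<omega>: "\<omega> 1 = (1, M)" "\<And>i. i \<in> {1..2*p} \<Longrightarrow> \<omega> i \<in> ?W"
    "\<And>i. 1 \<le> i \<Longrightarrow> i < 2*p \<Longrightarrow> pullback_adj M a M b (\<omega> i) (\<omega> (Suc i))"
    "\<And>i. i \<in> {1..2*p} \<Longrightarrow> \<omega> (flip (2*p) i) = prod.swap (\<omega> i)"
    by (auto simp only: image_subset_iff)
  have \<omega>_W: "fst (\<omega> i) \<in> {1..M}" "snd (\<omega> i) \<in> {1..M}"
    "a (fst (\<omega> i)) + a (snd (\<omega> i)) = Suc (4*n)" if "i \<in> {1..2*p}" for i
    using \<omega>(2)[OF that] W_iff[of "fst (\<omega> i)" "snd (\<omega> i)"] by auto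
  have "path_epi (2*p) M (fst \<circ> \<omega>)"
  proof (rule path_epiI_ends)
    have "\<omega> (2*p) = prod.swap (1, M)" using \<omega>(4)[of 1] \<omega>(1) p by (simp add: flip_def)
    thus "(fst \<circ> \<omega>) (2*p) = M" by simp
  qed (use \<omega> \<omega>_W p in \<open>auto simp: pullback_adj_def unit_step_near\<close>)
  from path_epi_comp[OF this \<epsilon>] have "path_epi (2*p) m (\<epsilon> \<circ> (fst \<circ> \<omega>))" .
  moreover have "flip_equivariant (2*p) (2*n) (\<alpha> \<circ> (\<epsilon> \<circ> (fst \<circ> \<omega>)))"
    unfolding flip_equivariant_def
  proof
    fix i assume i: "i \<in> {1..2*p}"
    have "(\<alpha> \<circ> (\<epsilon> \<circ> (fst \<circ> \<omega>))) (flip (2*p) i) = half (a (snd (\<omega> i)))"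
      using \<omega>(4)[OF i] \<omega>_W[OF i] by (simp add: \<alpha>\<epsilon>)
    also have "a (snd (\<omega> i)) = flip (4*n) (a (fst (\<omega> i)))"
      using \<omega>_W[OF i] by (simp add: flip_def)
    also have "half \<dots> = flip (2*n) (half (a (fst (\<omega> i))))"
      using \<omega>_W[OF i] a_in half_flip by blast
    finally show "(\<alpha> \<circ> (\<epsilon> \<circ> (fst \<circ> \<omega>))) (flip (2*p) i) = flip (2*n) ((\<alpha> \<circ> (\<epsilon> \<circ> (fst \<circ> \<omega>))) i)"
      using \<omega>_W[OF i] by (simp add: \<alpha>\<epsilon>)
  qed
  ultimately show ?thesis using p by blast
qed

text \<open>On the pullback of two equivariant unit-step walks the flips act simultaneously, and
  freely because the lengths are even. A mirror walk from corner to opposite corner makes both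
  projections onto and equivariant.\<close>

lemma equivariant_amalgamation:
  assumes \<alpha>: "path_epi (2*m) (2*n) \<alpha>" "flip_equivariant (2*m) (2*n) \<alpha>"
    and \<beta>: "path_epi (2*k) (2*n) \<beta>" "flip_equivariant (2*k) (2*n) \<beta>" and "n \<ge> 1"
  shows "\<exists>p \<gamma> \<delta>. p \<ge> 1 \<and> path_epi (2*p) (2*m) \<gamma> \<and> flip_equivariant (2*p) (2*m) \<gamma> \<and>
    path_epi (2*p) (2*k) \<delta> \<and> flip_equivariant (2*p) (2*k) \<delta> \<and>
    (\<forall>i \<in> {1..2*p}. \<alpha> (\<gamma> i) = \<beta> (\<delta> i))"
proof -
  obtain M \<epsilon> a where \<epsilon>: "path_epi (2*M) (2*m) \<epsilon>" "flip_equivariant (2*M) (2*m) \<epsilon>"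
    and a: "step_walk (2*M) (4*n) a" "flip_equivariant (2*M) (4*n) a" and a1: "a 1 = 1"
    and \<alpha>\<epsilon>: "\<And>i. i \<in> {1..2*M} \<Longrightarrow> \<alpha> (\<epsilon> i) = half (a i)"
    using exists_equivariant_step_walk[OF \<alpha> \<open>n \<ge> 1\<close>] by auto
  obtain N \<eta> b where \<eta>: "path_epi (2*N) (2*k) \<eta>" "flip_equivariant (2*N) (2*k) \<eta>"
    and b: "step_walk (2*N) (4*n) b" "flip_equivariant (2*N) (4*n) b" and b1: "b 1 = 1"
    and \<beta>\<eta>: "\<And>i. i \<in> {1..2*N} \<Longrightarrow> \<beta> (\<eta> i) = half (b i)"
    using exists_equivariant_step_walk[OF \<beta> \<open>n \<ge> 1\<close>] by auto
  have M: "M \<ge> 1" and N: "N \<ge> 1" using a b by (auto simp: step_walk_def)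
  have aM: "a (2*M) = 4*n" and bN: "b (2*N) = 4*n"
    using a b a1 b1 M by (auto simp: step_walk_def doubleton_eq_iff)
  let ?W = "pullback (2*M) a (2*N) b"
  let ?\<tau> = "\<lambda>(i, j). (flip (2*M) i, flip (2*N) j)"
  have "\<exists>p \<omega>. p \<ge> 1 \<and> \<omega> 1 = (1, 1) \<and> \<omega> ` {1..2*p} \<subseteq> ?W \<and>
    (\<forall>i. 1 \<le> i \<and> i < 2*p \<longrightarrow> pullback_adj (2*M) a (2*N) b (\<omega> i) (\<omega> (Suc i))) \<and>
    (\<forall>i \<in> {1..2*p}. \<omega> (flip (2*p) i) = ?\<tau> (\<omega> i))"
  \<comment> \<open>Both walks rise from 1 to \<open>4 * n\<close>, so the only corners in the
    pullback are \<open>(1, 1)\<close> and its mirror image; \<open>i \<le> M\<close> keeps the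
    first.\<close>
  proof (rule pullback_mirror_walk[OF a(1) b(1), where S = "\<lambda>(i, j). i \<le> M"])
    show *: "?\<tau> x \<in> ?W" if "x \<in> ?W" for x
      using that a(2) b(2) flip_in[of _ "2*M"] flip_in[of _ "2*N"]
      by (cases x) (auto simp: pullback_def flip_equivariant_def)
    show "pullback_adj (2*M) a (2*N) b (?\<tau> x) (?\<tau> y)" if E: "pullback_adj (2*M) a (2*N) b x y" for x y
    proof -
      have "?\<tau> x \<in> ?W" "?\<tau> y \<in> ?W" using E by (auto simp only: pullback_adj_def intro: *)
      with E show ?thesis
        by (cases x; cases y) (auto simp: pullback_adj_def pullback_def intro: unit_step_flip)
    qed
    show "?\<tau> (?\<tau> x) = x" if "x \<in> ?W" for x
      using that by (cases x) (auto simp: pullback_def flip_flip)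
    show "(1, 1) \<in> ?W" using M N a1 b1 by (auto simp: pullback_def)
    show "(case ?\<tau> x of (i, j) \<Rightarrow> i \<le> M) \<longleftrightarrow> \<not> (case x of (i, j) \<Rightarrow> i \<le> M)" if "x \<in> ?W" for x
      using that by (cases x) (auto simp: pullback_def flip_def)
    show "x = (1, 1)" if "x \<in> ?W" "fst x \<in> {1, 2*M}" "snd x \<in> {1, 2*N}" "case x of (i, j) \<Rightarrow> i \<le> M" for x
      using that a1 b1 aM bN M N \<open>n \<ge> 1\<close> by (cases x) (auto simp: pullback_def)
  qed (use M in auto)
  then obtain p \<omega> where p: "p \<ge> 1" and \<omega>: "\<omega> 1 = (1, 1)" "\<And>i. i \<in> {1..2*p} \<Longrightarrow> \<omega> i \<in> ?W"
    "\<And>i. 1 \<le> i \<Longrightarrow> i < 2*p \<Longrightarrow> pullback_adj (2*M) a (2*N) b (\<omega> i) (\<omega> (Suc i))"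
    "\<And>i. i \<in> {1..2*p} \<Longrightarrow> \<omega> (flip (2*p) i) = ?\<tau> (\<omega> i)"
    by (auto simp only: image_subset_iff)
  have \<omega>_W: "fst (\<omega> i) \<in> {1..2*M}" "snd (\<omega> i) \<in> {1..2*N}"
    "a (fst (\<omega> i)) = b (snd (\<omega> i))" if "i \<in> {1..2*p}" for i
    using \<omega>(2)[OF that] by (auto simp: pullback_def)
  have last: "\<omega> (2*p) = (2*M, 2*N)" using \<omega>(4)[of 1] \<omega>(1) p by (simp add: flip_def)
  have fst: "path_epi (2*p) (2*M) (fst \<circ> \<omega>)" "flip_equivariant (2*p) (2*M) (fst \<circ> \<omega>)"
    using \<omega> \<omega>_W p last
    by (auto intro!: path_epiI_ends simp: pullback_adj_def unit_step_near flip_equivariant_def split_beta)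
  have snd: "path_epi (2*p) (2*N) (snd \<circ> \<omega>)" "flip_equivariant (2*p) (2*N) (snd \<circ> \<omega>)"
    using \<omega> \<omega>_W p last
    by (auto intro!: path_epiI_ends simp: pullback_adj_def unit_step_near flip_equivariant_def split_beta)
  show ?thesis
  proof (intro exI conjI ballI)
    show "p \<ge> 1" by (rule p)
    show "path_epi (2*p) (2*m) (\<epsilon> \<circ> (fst \<circ> \<omega>))" "path_epi (2*p) (2*k) (\<eta> \<circ> (snd \<circ> \<omega>))"
      using path_epi_comp fst snd \<epsilon> \<eta> by blast+
    show "flip_equivariant (2*p) (2*m) (\<epsilon> \<circ> (fst \<circ> \<omega>))"
      using fst \<epsilon> by (intro flip_equivariant_comp[of _ _ "2*M"]) (auto simp: path_epi_def)
    show "flip_equivariant (2*p) (2*k) (\<eta> \<circ> (snd \<circ> \<omega>))"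
      using snd \<eta> by (intro flip_equivariant_comp[of _ _ "2*N"]) (auto simp: path_epi_def)
    fix i assume i: "i \<in> {1..2*p}"
    show "\<alpha> ((\<epsilon> \<circ> (fst \<circ> \<omega>)) i) = \<beta> ((\<eta> \<circ> (snd \<circ> \<omega>)) i)"
      using \<omega>_W[OF i] by (simp add: \<alpha>\<epsilon> \<beta>\<eta>)
  qed
qed

text \<open>In the application \<open>b1\<close> and \<open>b2\<close> give the classes of a point
  and of its image under an involution, whence the symmetry. The walk visits all of the relation, so
  that \<open>a\<close> is onto.\<close>

lemma symmetric_relation_from_flip:
  fixes b1 b2 :: "nat \<Rightarrow> nat"
  assumes "m \<ge> 1"
    and near: "\<And>i. 1 \<le> i \<Longrightarrow> i < m \<Longrightarrow> near (b1 i) (b1 (Suc i)) \<and> near (b2 i) (b2 (Suc i))"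
    and onto: "b1 ` {1..m} = {1..n}"
    and sym: "\<And>i. i \<in> {1..m} \<Longrightarrow> \<exists>j \<in> {1..m}. b1 j = b2 i \<and> b2 j = b1 i"
  shows "\<exists>k a. k \<ge> 1 \<and> path_epi (2*k) n a \<and>
    (\<forall>i \<in> {1..2*k}. \<exists>j \<in> {1..m}. a i = b1 j \<and> a (flip (2*k) i) = b2 j)"
proof -
  define s where "s = (\<lambda>i. (b1 i, b2 i)) ` {1..m}"
  define E where "E x y \<longleftrightarrow> x \<in> s \<and> y \<in> s \<and> near (fst x) (fst y) \<and> near (snd x) (snd y)"
    for x y :: "nat \<times> nat"
  have "symp E" by (auto simp: E_def symp_def near_def)
  have swap: "prod.swap x \<in> s" if "x \<in> s" for x
    using that sym by (force simp: s_def)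
  have from_1: "E\<^sup>*\<^sup>* (b1 1, b2 1) (b1 i, b2 i)" if "1 \<le> i" "i \<le> m" for i
    using that
  proof (induction i rule: dec_induct)
    case (step i)
    hence "E (b1 i, b2 i) (b1 (Suc i), b2 (Suc i))"
      using near by (auto simp: E_def s_def)
    with step show ?case by (auto intro: rtranclp.rtrancl_into_rtrancl)
  qed auto
  have conn: "E\<^sup>*\<^sup>* (b1 1, b2 1) x" if "x \<in> s" for x
    using from_1 that by (auto simp: s_def)
  obtain c where c: "c \<in> {1..m}" "near (b1 c) (b2 c)"
  proof -
    have "\<exists>c \<in> {1..m}. near (b1 c) (b2 c)"
    proof (rule ccontr)
      assume far: "\<not> ?thesis"
      \<comment> \<open>Coordinates that are not near differ by at least two, and one step changes
        their difference by at most two, so its sign persists. Symmetry demands both signs.\<close>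
      have side: "b1 i \<le> b2 i \<longleftrightarrow> b1 1 \<le> b2 1" if "1 \<le> i" "i \<le> m" for i
        using that
      proof (induction i rule: dec_induct)
        case (step i)
        have "\<not> near (b1 i) (b2 i)" "\<not> near (b1 (Suc i)) (b2 (Suc i))"
          using far step by auto
        with step near[of i] show ?case unfolding near_def by linarith
      qed auto
      obtain j where j: "j \<in> {1..m}" "b1 j = b2 1" "b2 j = b1 1" using sym[of 1] \<open>m \<ge> 1\<close> by auto
      have "\<not> near (b1 1) (b2 1)" using far \<open>m \<ge> 1\<close> by auto
      with side[of j] j show False by (auto simp: near_def)
    qed
    then show ?thesis using that by blast
  qed
  have "\<exists>k \<omega>. k \<ge> 1 \<and> \<omega> 1 = (b1 1, b2 1) \<and> \<omega> ` {1..2*k} \<subseteq> s \<and> s \<subseteq> \<omega> ` {1..2*k} \<and>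
    (\<forall>i. 1 \<le> i \<and> i < 2*k \<longrightarrow> E (\<omega> i) (\<omega> (Suc i))) \<and>
    (\<forall>i \<in> {1..2*k}. \<omega> (flip (2*k) i) = prod.swap (\<omega> i))"
  proof (rule exists_mirror_walk[OF \<open>symp E\<close>, where w = "(b1 c, b2 c)"])
    have "(b1 c, b2 c) \<in> s" using c by (auto simp: s_def)
    with swap[OF this] c show "E (b1 c, b2 c) (prod.swap (b1 c, b2 c))"
      by (auto simp: E_def near_def)
    show "E\<^sup>*\<^sup>* (b1 1, b2 1) (b1 c, b2 c)" using c from_1 by auto
    show "finite s" by (simp add: s_def)
  qed (use swap conn in \<open>auto simp: E_def\<close>)
  then obtain k \<omega> where k: "k \<ge> 1" and \<omega>: "\<omega> ` {1..2*k} = s"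
    "\<And>i. 1 \<le> i \<Longrightarrow> i < 2*k \<Longrightarrow> E (\<omega> i) (\<omega> (Suc i))"
    "\<And>i. i \<in> {1..2*k} \<Longrightarrow> \<omega> (flip (2*k) i) = prod.swap (\<omega> i)"
    by (auto simp only: set_eq_subset)
  have "(fst \<circ> \<omega>) ` {1..2*k} = fst ` s" by (simp only: image_comp [symmetric] \<omega>(1))
  also have "\<dots> = {1..n}" using onto by (simp add: s_def image_image)
  finally have "path_epi (2*k) n (fst \<circ> \<omega>)"
    using \<omega>(2) by (auto simp: path_epi_def E_def)
  moreover have "\<exists>j \<in> {1..m}. (fst \<circ> \<omega>) i = b1 j \<and> (fst \<circ> \<omega>) (flip (2*k) i) = b2 j"
    if i: "i \<in> {1..2*k}" for i
  proof -
    have "\<omega> i \<in> s" using \<omega>(1) i by blast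
    then obtain j where "j \<in> {1..m}" "\<omega> i = (b1 j, b2 j)" by (auto simp: s_def)
    with \<omega>(3)[OF i] show ?thesis by (intro bexI[of _ j]) auto
  qed
  ultimately show ?thesis using k by blast
qed

text \<open>Collapsing each half of an even path commutes with the flips; this gives any two generic
  involutions a common start for the back-and-forth.\<close>

lemma path_epi_pair: "p \<ge> 1 \<Longrightarrow> path_epi (2*p) 2 (\<lambda>i. if i \<le> p then 1 else 2)"
  by (rule path_epiI_ends) (auto simp: near_def)

lemma flip_equivariant_pair: "flip_equivariant (2*p) 2 (\<lambda>i. if i \<le> p then 1 else 2)"
  by (auto simp: flip_equivariant_def flip_def)

section \<open>From finite paths to topology: category, epimorphisms and limits\<close>

subsection \<open>Comeager sets\<close>

lemma comeager_inI:
  assumes "countable \<O>" and \<O>: "\<And>W. W \<in> \<O> \<Longrightarrow> openin T W \<and> T closure_of W = topspace T"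
    and S: "S \<subseteq> topspace T" "topspace T \<inter> \<Inter>\<O> \<subseteq> S"
  shows "comeager_in T S"
proof -
  \<comment> \<open>Removing \<open>S\<close> makes the union equal to the complement of
    \<open>S\<close>, as \<open>meager_in\<close> demands, where the complements of the open sets
    would merely cover it.\<close>
  let ?\<N> = "(\<lambda>W. topspace T - W - S) ` \<O>"
  have "nowhere_dense_in T (topspace T - W - S)" if "W \<in> \<O>" for W
  proof -
    have W: "openin T W" "T closure_of W = topspace T" using \<O>[OF that] by auto
    have "T closure_of (topspace T - W - S) \<subseteq> topspace T - W"
      using W(1) by (intro closure_of_minimal) (auto simp: closedin_def openin_subset double_diff)
    hence "T interior_of (T closure_of (topspace T - W - S)) \<subseteq> T interior_of (topspace T - W)"
      by (rule interior_of_mono)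
    also have "\<dots> = {}" using W(2) by (simp add: interior_of_complement)
    finally show ?thesis by (auto simp: nowhere_dense_in_def)
  qed
  moreover have "topspace T - S = \<Union>?\<N>" using S by auto
  ultimately show ?thesis
    using assms(1) S(1) unfolding comeager_in_def meager_in_def
    by (intro conjI exI[of _ ?\<N>]) auto
qed

subsection \<open>Epimorphisms onto paths\<close>

text \<open>If no edge were mapped onto the edge from \<open>c\<close> to \<open>Suc c\<close>, the
  values of \<open>\<alpha>\<close> would stay on one side of it, against surjectivity.\<close>

lemma path_epi_lift:
  assumes \<alpha>: "path_epi m n \<alpha>" and ab: "a \<in> {1..n}" "b \<in> {1..n}" "near a b"
  shows "\<exists>i \<in> {1..m}. \<exists>j \<in> {1..m}. near i j \<and> \<alpha> i = a \<and> \<alpha> j = b"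
proof -
  have step: "\<exists>i \<in> {1..m}. \<exists>j \<in> {1..m}. near i j \<and> \<alpha> i = c \<and> \<alpha> j = Suc c" if c: "1 \<le> c" "Suc c \<le> n" for c
  proof (rule ccontr)
    assume neg: "\<not> ?thesis"
    have side: "\<alpha> i \<le> c \<longleftrightarrow> \<alpha> 1 \<le> c" if "1 \<le> i" "i \<le> m" for i
      using that
    proof (induction i rule: dec_induct)
      case (step i)
      have near: "near (\<alpha> i) (\<alpha> (Suc i))" using \<alpha> step by (simp add: path_epi_def)
      have "near i (Suc i)" "near (Suc i) i" by (auto simp: near_def)
      moreover have "i \<in> {1..m}" "Suc i \<in> {1..m}" using step by auto
      ultimately have "\<not> (\<alpha> i = c \<and> \<alpha> (Suc i) = Suc c)" "\<not> (\<alpha> (Suc i) = c \<and> \<alpha> i = Suc c)"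
        using neg by blast+
      with near have "\<alpha> (Suc i) \<le> c \<longleftrightarrow> \<alpha> i \<le> c" unfolding near_def by linarith
      with step show ?case by simp
    qed simp
    have "c \<in> \<alpha> ` {1..m}" "Suc c \<in> \<alpha> ` {1..m}" using \<alpha> c by (auto simp: path_epi_def)
    then obtain i j where "i \<in> {1..m}" "\<alpha> i = c" "j \<in> {1..m}" "\<alpha> j = Suc c" by auto
    with side[of i] side[of j] show False by auto
  qed
  consider "a = b" | "b = Suc a" | "a = Suc b" using ab(3) unfolding near_def by linarith
  then show ?thesis
  proof cases
    case 1
    have "a \<in> \<alpha> ` {1..m}" using \<alpha> ab by (simp add: path_epi_def)
    then obtain i where "i \<in> {1..m}" "\<alpha> i = a" by auto
    moreover have "near i i" by (simp add: near_def)
    ultimately show ?thesis using 1 by blast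
  next
    case 2
    with step[of a] ab show ?thesis by auto
  next
    case 3
    with step[of b] ab obtain i j where "i \<in> {1..m}" "j \<in> {1..m}" "near i j" "\<alpha> i = b" "\<alpha> j = a"
      by auto
    then show ?thesis using near_sym by blast
  qed
qed

locale path_limit =
  fixes P :: "'a topology" and r :: "('a \<times> 'a) set"
  assumes limit: "projective_Fraisse_limit P r"
begin

abbreviation X :: "'a set" where "X \<equiv> topspace P"

definition epi :: "nat \<Rightarrow> ('a \<Rightarrow> nat) \<Rightarrow> bool" where
  "epi n \<phi> \<longleftrightarrow> n \<ge> 1 \<and> epimorphism P r (path_top n) (path_rel n) \<phi>"

definition clopen :: "'a set \<Rightarrow> bool" where
  "clopen C \<longleftrightarrow> openin P C \<and> closedin P C"

text \<open>Continuity into a finite discrete space, expressed without naming that space.\<close>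

definition locally_const :: "('a \<Rightarrow> nat) \<Rightarrow> bool" where
  "locally_const g \<longleftrightarrow> finite (g ` X) \<and> (\<forall>A. openin P {x \<in> X. g x \<in> A})"

lemma top_structure:
  "compact_space P" "Hausdorff_space P" "P dim_le 0" "second_countable P"
  "closedin (prod_topology P P) r"
  using limit unfolding projective_Fraisse_limit_def topological_structure_def by auto

lemmas limit_conjuncts = conjunct2[OF limit[unfolded projective_Fraisse_limit_def]]

lemma exists_epi: "n \<ge> 1 \<Longrightarrow> \<exists>\<phi>. epi n \<phi>"
  using conjunct1[OF limit_conjuncts] by (simp add: epi_def)

lemma exists_epi_factor_discrete:
  fixes g :: "'a \<Rightarrow> nat"
  assumes "finite Z" "continuous_map P (discrete_topology Z) g"
  shows "\<exists>n \<phi> h. epi n \<phi> \<and> (\<forall>x \<in> X. g x = h (\<phi> x))"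
proof -
  obtain n \<phi> h where "n \<ge> 1" "epimorphism P r (path_top n) (path_rel n) \<phi>" "\<forall>x \<in> X. g x = h (\<phi> x)"
    using conjunct1[OF conjunct2[OF limit_conjuncts], rule_format, OF conjI[OF assms]] by (elim exE conjE)
  then show ?thesis unfolding epi_def by blast
qed

lemma epi_homogeneous:
  assumes "epi n \<phi>1" "epi n \<phi>2"
  shows "\<exists>\<psi>. isomorphism P r P r \<psi> \<and> (\<forall>x \<in> X. \<phi>2 x = \<phi>1 (\<psi> x))"
  using conjunct2[OF conjunct2[OF limit_conjuncts], rule_format, of n \<phi>1 \<phi>2] assms
  by (simp add: epi_def)

lemma rel_in: "(x, y) \<in> r \<Longrightarrow> x \<in> X \<and> y \<in> X"
  using closedin_subset[OF top_structure(5)] by auto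

lemma path_rel_iff: "(a, b) \<in> path_rel n \<longleftrightarrow> a \<in> {1..n} \<and> b \<in> {1..n} \<and> near a b"
  by (auto simp: path_rel_def near_def)

lemma epi_iff:
  "epi n \<phi> \<longleftrightarrow> n \<ge> 1 \<and> locally_const \<phi> \<and> \<phi> ` X = {1..n} \<and>
     (\<forall>x y. (x, y) \<in> r \<longrightarrow> near (\<phi> x) (\<phi> y)) \<and>
     (\<forall>a \<in> {1..n}. \<forall>b \<in> {1..n}. near a b \<longrightarrow> (\<exists>x y. (x, y) \<in> r \<and> \<phi> x = a \<and> \<phi> y = b))"
    (is "_ \<longleftrightarrow> ?R")
proof
  assume \<phi>: "epi n \<phi>"
  hence cont: "continuous_map P (discrete_topology {1..n}) \<phi>" and im: "\<phi> ` X = {1..n}"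
    and rel: "\<And>a b. a \<in> {1..n} \<Longrightarrow> b \<in> {1..n} \<Longrightarrow> (a, b) \<in> path_rel n \<longleftrightarrow>
      (\<exists>x\<in>X. \<exists>y\<in>X. \<phi> x = a \<and> \<phi> y = b \<and> (x, y) \<in> r)"
    by (auto simp: epi_def epimorphism_def path_top_def)
  have "openin P {x \<in> X. \<phi> x \<in> A}" for A
  proof -
    have "openin P {x \<in> X. \<phi> x \<in> A \<inter> {1..n}}"
      by (rule openin_continuous_map_preimage[OF cont]) auto
    moreover have "{x \<in> X. \<phi> x \<in> A \<inter> {1..n}} = {x \<in> X. \<phi> x \<in> A}" using im by auto
    ultimately show ?thesis by simp
  qed
  moreover have "near (\<phi> x) (\<phi> y)" if "(x, y) \<in> r" for x y
  proof -
    have "x \<in> X" "y \<in> X" using rel_in that by auto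
    hence "\<phi> x \<in> {1..n}" "\<phi> y \<in> {1..n}" using im by blast+
    with rel[of "\<phi> x" "\<phi> y"] that \<open>x \<in> X\<close> \<open>y \<in> X\<close> have "(\<phi> x, \<phi> y) \<in> path_rel n" by blast
    thus ?thesis by (simp add: path_rel_iff)
  qed
  moreover have "\<exists>x y. (x, y) \<in> r \<and> \<phi> x = a \<and> \<phi> y = b" if "a \<in> {1..n}" "b \<in> {1..n}" "near a b" for a b
    using rel[of a b] that unfolding path_rel_iff by blast
  moreover have "n \<ge> 1" "finite (\<phi> ` X)" using \<phi> im by (auto simp: epi_def)
  ultimately show ?R using im unfolding locally_const_def by blast
next
  assume R: ?R
  hence near: "\<And>x y. (x, y) \<in> r \<Longrightarrow> near (\<phi> x) (\<phi> y)"
    and lift: "\<And>a b. a \<in> {1..n} \<Longrightarrow> b \<in> {1..n} \<Longrightarrow> near a b \<Longrightarrow>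
      \<exists>x y. (x, y) \<in> r \<and> \<phi> x = a \<and> \<phi> y = b" by blast+
  have "continuous_map P (discrete_topology {1..n}) \<phi>"
    using R unfolding continuous_map_def locally_const_def by auto
  moreover have "(a, b) \<in> path_rel n \<longleftrightarrow> (\<exists>x\<in>X. \<exists>y\<in>X. \<phi> x = a \<and> \<phi> y = b \<and> (x, y) \<in> r)"
    if ab: "a \<in> {1..n}" "b \<in> {1..n}" for a b
  proof
    assume "(a, b) \<in> path_rel n"
    hence "near a b" by (simp add: path_rel_iff)
    then obtain x y where "(x, y) \<in> r" "\<phi> x = a" "\<phi> y = b" using lift[OF ab] by blast
    with rel_in show "\<exists>x\<in>X. \<exists>y\<in>X. \<phi> x = a \<and> \<phi> y = b \<and> (x, y) \<in> r" by blast
  next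
    assume "\<exists>x\<in>X. \<exists>y\<in>X. \<phi> x = a \<and> \<phi> y = b \<and> (x, y) \<in> r"
    with near that show "(a, b) \<in> path_rel n" unfolding path_rel_iff by blast
  qed
  ultimately show "epi n \<phi>" using R by (simp add: epi_def epimorphism_def path_top_def)
qed

lemma epi_pos: "epi n \<phi> \<Longrightarrow> n \<ge> 1"
  by (simp add: epi_def)

lemma epi_locally_const: "epi n \<phi> \<Longrightarrow> locally_const \<phi>"
  by (simp add: epi_iff)

lemma epi_image: "epi n \<phi> \<Longrightarrow> \<phi> ` X = {1..n}"
  by (simp add: epi_iff)

lemma epi_in: "epi n \<phi> \<Longrightarrow> x \<in> X \<Longrightarrow> \<phi> x \<in> {1..n}"
  using epi_image by blast

lemma epi_near: "epi n \<phi> \<Longrightarrow> (x, y) \<in> r \<Longrightarrow> near (\<phi> x) (\<phi> y)"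
  by (auto simp: epi_iff)

lemma epi_lift:
  assumes "epi n \<phi>" "a \<in> {1..n}" "b \<in> {1..n}" "near a b"
  obtains x y where "(x, y) \<in> r" "\<phi> x = a" "\<phi> y = b"
  using assms unfolding epi_iff by blast

lemma openin_fibre:
  assumes "locally_const g"
  shows "openin P {x \<in> X. g x = a}"
proof -
  have "openin P {x \<in> X. g x \<in> {a}}" using assms unfolding locally_const_def by blast
  then show ?thesis by simp
qed

lemma locally_const_comp:
  assumes "locally_const g"
  shows "locally_const (h \<circ> g)"
proof -
  have "openin P {x \<in> X. (h \<circ> g) x \<in> A}" for A
  proof -
    have "openin P {x \<in> X. g x \<in> h -` A}" using assms unfolding locally_const_def by blast
    then show ?thesis by simp
  qed
  moreover have "finite ((h \<circ> g) ` X)"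
    using assms by (simp only: locally_const_def image_comp [symmetric] finite_imageI)
  ultimately show ?thesis by (simp add: locally_const_def)
qed

lemma epi_cong:
  assumes \<phi>: "epi n \<phi>" and eq: "\<And>x. x \<in> X \<Longrightarrow> \<phi> x = \<phi>' x"
  shows "epi n \<phi>'"
proof -
  have "{x \<in> X. \<phi> x \<in> A} = {x \<in> X. \<phi>' x \<in> A}" for A using eq by auto
  moreover have im: "\<phi> ` X = \<phi>' ` X" using eq by (rule image_cong[OF refl])
  ultimately have "locally_const \<phi>'"
    using epi_locally_const[OF \<phi>] by (simp add: locally_const_def)
  moreover have "near (\<phi>' x) (\<phi>' y)" if "(x, y) \<in> r" for x y
    using epi_near[OF \<phi> that] rel_in[OF that] by (simp add: eq)
  moreover have "\<exists>x y. (x, y) \<in> r \<and> \<phi>' x = a \<and> \<phi>' y = b"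
    if ab: "a \<in> {1..n}" "b \<in> {1..n}" "near a b" for a b
  proof -
    obtain x y where "(x, y) \<in> r" "\<phi> x = a" "\<phi> y = b" using epi_lift[OF \<phi> ab] .
    then show ?thesis using rel_in[of x y] eq by auto
  qed
  ultimately show ?thesis using epi_pos[OF \<phi>] epi_image[OF \<phi>] im unfolding epi_iff by blast
qed

lemma epi_comp:
  assumes \<xi>: "epi m \<xi>" and \<alpha>: "path_epi m n \<alpha>"
  shows "epi n (\<alpha> \<circ> \<xi>)"
proof -
  have "\<exists>x y. (x, y) \<in> r \<and> (\<alpha> \<circ> \<xi>) x = a \<and> (\<alpha> \<circ> \<xi>) y = b" if ab: "a \<in> {1..n}" "b \<in> {1..n}" "near a b" for a b
  proof -
    have "\<exists>i \<in> {1..m}. \<exists>j \<in> {1..m}. near i j \<and> \<alpha> i = a \<and> \<alpha> j = b"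
      using path_epi_lift[OF \<alpha> ab] .
    then obtain i j where ij: "i \<in> {1..m}" "j \<in> {1..m}" "near i j" "\<alpha> i = a" "\<alpha> j = b" by blast
    obtain x y where "(x, y) \<in> r" "\<xi> x = i" "\<xi> y = j" using epi_lift[OF \<xi> ij(1-3)] .
    with ij show ?thesis by auto
  qed
  moreover have "near ((\<alpha> \<circ> \<xi>) x) ((\<alpha> \<circ> \<xi>) y)" if "(x, y) \<in> r" for x y
    using path_epi_near[OF \<alpha>] epi_in[OF \<xi>] epi_near[OF \<xi> that] rel_in[OF that] by simp
  moreover have "(\<alpha> \<circ> \<xi>) ` X = {1..n}"
    using \<alpha> epi_image[OF \<xi>] by (simp only: image_comp [symmetric] path_epi_def)
  moreover have "n \<ge> 1" using \<alpha> epi_pos[OF \<xi>] path_epi_in[of m n \<alpha> 1] by simp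
  ultimately show ?thesis
    using locally_const_comp[OF epi_locally_const[OF \<xi>]] unfolding epi_iff by blast
qed

text \<open>Consecutive vertices of the finer path lift along \<open>\<xi>\<close> to a related
  pair, which \<open>\<phi>\<close> maps to near values.\<close>

lemma epi_factor:
  assumes \<xi>: "epi m \<xi>" and \<phi>: "epi n \<phi>" and eq: "\<And>x. x \<in> X \<Longrightarrow> \<phi> x = \<alpha> (\<xi> x)"
  shows "path_epi m n \<alpha>"
proof -
  have "\<alpha> ` {1..m} = (\<lambda>x. \<alpha> (\<xi> x)) ` X" by (simp only: epi_image[OF \<xi>, symmetric] image_image)
  also have "\<dots> = \<phi> ` X" using eq by simp
  finally have "\<alpha> ` {1..m} = \<phi> ` X" .
  moreover have "near (\<alpha> i) (\<alpha> (Suc i))" if i: "1 \<le> i" "i < m" for i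
  proof -
    from i have "i \<in> {1..m}" "Suc i \<in> {1..m}" "near i (Suc i)" by (auto simp: near_def)
    then obtain x y where xy: "(x, y) \<in> r" "\<xi> x = i" "\<xi> y = Suc i" by (rule epi_lift[OF \<xi>])
    with eq rel_in[OF xy(1)] epi_near[OF \<phi> xy(1)] show ?thesis by simp
  qed
  ultimately show ?thesis using epi_image[OF \<phi>] by (simp add: path_epi_def)
qed

lemma exists_epi_factor:
  assumes g: "locally_const g"
  shows "\<exists>n \<phi> h. epi n \<phi> \<and> (\<forall>x \<in> X. g x = h (\<phi> x))"
proof -
  have "continuous_map P (discrete_topology (g ` X)) g"
    using g by (auto simp: continuous_map_def locally_const_def)
  moreover have "finite (g ` X)" using g by (simp add: locally_const_def)
  ultimately show ?thesis using exists_epi_factor_discrete by blast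
qed

text \<open>Condition (L2) is stated for maps into sets of natural numbers, hence the coding of
  pairs. Applied to such a pair, it refines two maps at once.\<close>

lemma locally_const_pair:
  assumes "locally_const g1" "locally_const g2"
  shows "locally_const (\<lambda>x. prod_encode (g1 x, g2 x))"
proof -
  have "openin P {x \<in> X. prod_encode (g1 x, g2 x) \<in> A}" for A
  proof -
    have "{x \<in> X. prod_encode (g1 x, g2 x) \<in> A} =
        (\<Union>(a, b) \<in> prod_encode -` A. {x \<in> X. g1 x = a} \<inter> {x \<in> X. g2 x = b})" by auto
    moreover have "openin P \<dots>"
      using openin_fibre[OF assms(1)] openin_fibre[OF assms(2)]
      by (intro openin_Union) (auto intro!: openin_Int)
    ultimately show ?thesis by simp
  qed
  moreover have "finite ((\<lambda>x. prod_encode (g1 x, g2 x)) ` X)"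
  proof (rule finite_subset)
    show "(\<lambda>x. prod_encode (g1 x, g2 x)) ` X \<subseteq> prod_encode ` (g1 ` X \<times> g2 ` X)" by auto
  qed (use assms in \<open>auto simp: locally_const_def\<close>)
  ultimately show ?thesis by (simp add: locally_const_def)
qed

lemma exists_common_refinement:
  assumes "locally_const g1" "locally_const g2"
  obtains n \<phi> h1 h2 where "epi n \<phi>" "\<And>x. x \<in> X \<Longrightarrow> g1 x = h1 (\<phi> x)" "\<And>x. x \<in> X \<Longrightarrow> g2 x = h2 (\<phi> x)"
proof -
  obtain n \<phi> h where "epi n \<phi>" and h: "\<And>x. x \<in> X \<Longrightarrow> prod_encode (g1 x, g2 x) = h (\<phi> x)"
    using exists_epi_factor[OF locally_const_pair[OF assms]] by blast
  moreover have "g1 x = fst (prod_decode (h (\<phi> x)))" "g2 x = snd (prod_decode (h (\<phi> x)))"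
    if "x \<in> X" for x using h[OF that, symmetric] by simp_all
  ultimately show ?thesis
    by (intro that[of n \<phi> "fst \<circ> prod_decode \<circ> h" "snd \<circ> prod_decode \<circ> h"]) auto
qed

lemma epi_precomp:
  assumes \<phi>: "epi n \<phi>" and cont: "continuous_map P P \<psi>" and onto: "\<psi> ` X = X"
    and hom: "\<And>x y. (x, y) \<in> r \<Longrightarrow> (\<psi> x, \<psi> y) \<in> r"
    and lift: "\<And>u v. (u, v) \<in> r \<Longrightarrow> \<exists>x y. (x, y) \<in> r \<and> \<psi> x = u \<and> \<psi> y = v"
  shows "epi n (\<phi> \<circ> \<psi>)"
proof -
  have "openin P {x \<in> X. (\<phi> \<circ> \<psi>) x \<in> A}" for A
  proof -
    have "openin P {x \<in> X. \<psi> x \<in> {y \<in> X. \<phi> y \<in> A}}"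
      using \<phi> by (intro openin_continuous_map_preimage[OF cont]) (auto simp: epi_iff locally_const_def)
    moreover have "{x \<in> X. \<psi> x \<in> {y \<in> X. \<phi> y \<in> A}} = {x \<in> X. (\<phi> \<circ> \<psi>) x \<in> A}" using onto by auto
    ultimately show ?thesis by simp
  qed
  moreover have "(\<phi> \<circ> \<psi>) ` X = {1..n}"
    by (simp only: image_comp [symmetric] onto epi_image[OF \<phi>])
  moreover have "\<exists>x y. (x, y) \<in> r \<and> (\<phi> \<circ> \<psi>) x = a \<and> (\<phi> \<circ> \<psi>) y = b"
    if ab: "a \<in> {1..n}" "b \<in> {1..n}" "near a b" for a b
  proof -
    obtain u v where uv: "(u, v) \<in> r" "\<phi> u = a" "\<phi> v = b" using epi_lift[OF \<phi> ab] .
    with lift[OF uv(1)] show ?thesis by auto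
  qed
  moreover have "near ((\<phi> \<circ> \<psi>) x) ((\<phi> \<circ> \<psi>) y)" if "(x, y) \<in> r" for x y
    using epi_near[OF \<phi> hom[OF that]] by simp
  ultimately show ?thesis
    using epi_pos[OF \<phi>] unfolding epi_iff locally_const_def
    by (intro conjI ballI allI impI) simp_all
qed

text \<open>By (L1) there is some \<open>\<theta>0\<close> onto the longer path. Both
  \<open>\<alpha> \<circ> \<theta>0\<close> and \<open>\<phi>\<close> are epimorphisms onto the
  shorter one, so (L3) gives an isomorphism that turns the first into the second; it turns
  \<open>\<theta>0\<close> into the required map.\<close>

lemma epi_extension:
  assumes \<phi>: "epi n \<phi>" and \<alpha>: "path_epi m n \<alpha>"
  obtains \<theta> where "epi m \<theta>" "\<And>x. x \<in> X \<Longrightarrow> \<phi> x = \<alpha> (\<theta> x)"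
proof -
  have "m \<ge> 1" using \<alpha> epi_pos[OF \<phi>] by (cases "m = 0") (auto simp: path_epi_def)
  then obtain \<theta>0 where \<theta>0: "epi m \<theta>0" using exists_epi by blast
  have "epi n (\<alpha> \<circ> \<theta>0)" by (rule epi_comp[OF \<theta>0 \<alpha>])
  from epi_homogeneous[OF this \<phi>] obtain \<psi> where \<psi>: "isomorphism P r P r \<psi>" "\<And>x. x \<in> X \<Longrightarrow> \<phi> x = \<alpha> (\<theta>0 (\<psi> x))"
    by auto
  have cont: "continuous_map P P \<psi>" and onto: "\<psi> ` X = X"
    and rel: "\<And>u v. u \<in> X \<Longrightarrow> v \<in> X \<Longrightarrow> (u, v) \<in> r \<longleftrightarrow> (\<exists>x\<in>X. \<exists>y\<in>X. \<psi> x = u \<and> \<psi> y = v \<and> (x, y) \<in> r)"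
    using \<psi>(1) unfolding isomorphism_def epimorphism_def by auto
  have "epi m (\<theta>0 \<circ> \<psi>)"
  proof (rule epi_precomp[OF \<theta>0 cont onto])
    show "(\<psi> x, \<psi> y) \<in> r" if "(x, y) \<in> r" for x y
    proof -
      have "x \<in> X" "y \<in> X" using rel_in[OF that] by auto
      moreover from this have "\<psi> x \<in> X" "\<psi> y \<in> X" using onto by blast+
      ultimately show ?thesis using rel that by blast
    qed
    show "\<exists>x y. (x, y) \<in> r \<and> \<psi> x = u \<and> \<psi> y = v" if "(u, v) \<in> r" for u v
      using rel rel_in[OF that] that by blast
  qed
  then show ?thesis by (rule that) (simp add: \<psi>(2))
qed

subsection \<open>Clopen sets\<close>

lemma clopen_nbhd:
  assumes "openin P U" "x \<in> U"
  obtains C where "clopen C" "x \<in> C" "C \<subseteq> U"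
proof -
  have "neighbourhood_base_of (\<lambda>U. closedin P U \<and> openin P U) P"
    using top_structure(3) by (simp add: dimension_le_0_neighbourhood_base_of_clopen)
  hence "\<exists>C. (closedin P C \<and> openin P C) \<and> x \<in> C \<and> C \<subseteq> U"
    using assms by (simp add: open_neighbourhood_base_of)
  then show ?thesis using that unfolding clopen_def by blast
qed

lemma clopen_between:
  assumes K: "compactin P K" and U: "openin P U" "K \<subseteq> U"
  obtains C where "clopen C" "K \<subseteq> C" "C \<subseteq> U"
proof -
  let ?\<U> = "{C. clopen C \<and> C \<subseteq> U}"
  have "K \<subseteq> \<Union>?\<U>"
  proof
    fix x assume "x \<in> K"
    with U obtain C where "clopen C" "x \<in> C" "C \<subseteq> U" by (meson clopen_nbhd subsetD)
    then show "x \<in> \<Union>?\<U>" by blast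
  qed
  moreover have "\<forall>C \<in> ?\<U>. openin P C" by (simp add: clopen_def)
  ultimately obtain \<F> where \<F>: "finite \<F>" "\<F> \<subseteq> ?\<U>" "K \<subseteq> \<Union>\<F>"
    using K unfolding compactin_def by meson
  have "clopen (\<Union>\<F>)"
    using \<F>(1,2) unfolding clopen_def by (intro conjI openin_Union closedin_Union) auto
  moreover have "\<Union>\<F> \<subseteq> U" using \<F>(2) by blast
  ultimately show ?thesis using that[of "\<Union>\<F>"] \<F>(3) by blast
qed

lemma clopen_separation:
  assumes "x \<in> X" "y \<in> X" "x \<noteq> y"
  obtains C where "clopen C" "x \<in> C" "y \<notin> C"
proof -
  obtain U V where U: "openin P U" "x \<in> U" and V: "y \<in> V" "disjnt U V"
    using top_structure(2)[unfolded Hausdorff_space_def, rule_format, OF conjI[OF assms(1) conjI[OF assms(2,3)]]]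
    by (elim exE conjE)
  obtain C where C: "clopen C" "x \<in> C" "C \<subseteq> U" using clopen_nbhd[OF U] .
  have "y \<notin> C" using V C(3) by (auto simp: disjnt_iff)
  with C(1,2) show ?thesis by (rule that)
qed

text \<open>A clopen set is compact, hence a finite union of members of a countable base.\<close>

lemma countable_clopen: "countable {C. clopen C}"
proof -
  obtain \<B> where \<B>: "countable \<B>" "\<forall>V \<in> \<B>. openin P V"
    "\<forall>U x. openin P U \<and> x \<in> U \<longrightarrow> (\<exists>V \<in> \<B>. x \<in> V \<and> V \<subseteq> U)"
    using top_structure(4)[unfolded second_countable_def] by (elim exE conjE)
  have "{C. clopen C} \<subseteq> Union ` {\<F>. finite \<F> \<and> \<F> \<subseteq> \<B>}"
  proof
    fix C assume "C \<in> {C. clopen C}"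
    hence C: "openin P C" "compactin P C"
      using closedin_compact_space[OF top_structure(1)] by (auto simp: clopen_def)
    have "C \<subseteq> \<Union>{V \<in> \<B>. V \<subseteq> C}" using \<B>(3) C(1) by blast
    moreover have "\<forall>V \<in> {V \<in> \<B>. V \<subseteq> C}. openin P V" using \<B>(2) by blast
    ultimately obtain \<F> where \<F>: "finite \<F>" "\<F> \<subseteq> {V \<in> \<B>. V \<subseteq> C}" "C \<subseteq> \<Union>\<F>"
      using C(2) unfolding compactin_def by meson
    then show "C \<in> Union ` {\<F>. finite \<F> \<and> \<F> \<subseteq> \<B>}" by (intro image_eqI[of _ _ \<F>]) auto
  qed
  then show ?thesis
    using countable_Collect_finite_subset[OF \<B>(1)] by (meson countable_image countable_subset)
qed

definition nth_clopen :: "nat \<Rightarrow> 'a set" where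
  "nth_clopen = from_nat_into {C. clopen C}"

lemma clopen_nth: "clopen (nth_clopen i)"
proof -
  have "clopen {}" by (simp add: clopen_def)
  then show ?thesis using from_nat_into[of "{C. clopen C}" i] by (auto simp: nth_clopen_def)
qed

lemma clopen_eq_nth:
  assumes "clopen C"
  obtains i where "C = nth_clopen i"
  using from_nat_into_surj[OF countable_clopen, of C] assms that by (auto simp: nth_clopen_def)

lemma locally_const_indicator:
  assumes "clopen C"
  shows "locally_const (\<lambda>x. of_bool (x \<in> C))"
proof -
  have C: "openin P C" "openin P (X - C)" "C \<subseteq> X"
    using assms closedin_subset by (auto simp: clopen_def)
  have "openin P {x \<in> X. of_bool (x \<in> C) \<in> A}" for A :: "nat set"
  proof -
    have "{x \<in> X. of_bool (x \<in> C) \<in> A} =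
        (if 1 \<in> A then C else {}) \<union> (if 0 \<in> A then X - C else {})"
      using C(3) by auto
    moreover have "openin P \<dots>" using C(1,2) by (intro openin_Un) simp_all
    ultimately show ?thesis by (simp only:)
  qed
  moreover have "finite ((\<lambda>x. of_bool (x \<in> C) :: nat) ` X)"
    by (rule finite_subset[of _ "{0, 1}"]) auto
  ultimately show ?thesis unfolding locally_const_def by blast
qed

text \<open>Within \<open>X\<close>, the set \<open>C\<close> is a union of fibres of
  \<open>\<theta>\<close>. A sequence of maps that together resolve all clopen sets separates
  points.\<close>

definition resolves :: "('a \<Rightarrow> nat) \<Rightarrow> 'a set \<Rightarrow> bool" where
  "resolves \<theta> C \<longleftrightarrow> (\<forall>x \<in> X. \<forall>y \<in> X. \<theta> x = \<theta> y \<longrightarrow> (x \<in> C \<longleftrightarrow> y \<in> C))"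

lemma epi_resolving:
  assumes "epi n \<phi>" "clopen C"
  obtains m \<xi> \<alpha> where "epi m \<xi>" "path_epi m n \<alpha>" "\<And>x. x \<in> X \<Longrightarrow> \<phi> x = \<alpha> (\<xi> x)" "resolves \<xi> C"
proof -
  obtain m \<xi> \<alpha> h where \<xi>: "epi m \<xi>" and \<alpha>: "\<And>x. x \<in> X \<Longrightarrow> \<phi> x = \<alpha> (\<xi> x)"
    and h: "\<And>x. x \<in> X \<Longrightarrow> of_bool (x \<in> C) = (h (\<xi> x) :: nat)"
    by (rule exists_common_refinement[OF epi_locally_const[OF assms(1)] locally_const_indicator[OF assms(2)]])
      (rule that)
  have "resolves \<xi> C" unfolding resolves_def
  proof (intro ballI impI)
    fix x y assume "x \<in> X" "y \<in> X" "\<xi> x = \<xi> y"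
    with h[of x] h[of y] have "(of_bool (x \<in> C) :: nat) = of_bool (y \<in> C)" by simp
    then show "x \<in> C \<longleftrightarrow> y \<in> C" by (simp only: of_bool_eq_iff)
  qed
  with \<xi> epi_factor[OF \<xi> assms(1) \<alpha>] \<alpha> show ?thesis by (rule that)
qed

lemma resolves_factor:
  assumes "resolves \<theta> C" "\<And>x. x \<in> X \<Longrightarrow> \<theta> x = \<beta> (\<eta> x)"
  shows "resolves \<eta> C"
  unfolding resolves_def
proof (intro ballI impI)
  fix x y assume xy: "x \<in> X" "y \<in> X" "\<eta> x = \<eta> y"
  hence "\<theta> x = \<theta> y" using assms(2)[of x] assms(2)[of y] by simp
  with assms(1) xy(1,2) show "x \<in> C \<longleftrightarrow> y \<in> C" unfolding resolves_def by blast
qed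


subsection \<open>Automorphisms as limits\<close>

text \<open>The value \<open>k x\<close> is taken from the intersection of the fibres of all
  \<open>\<theta>' i\<close> over \<open>\<theta> i x\<close>. These are nested because the bonding
  maps \<open>\<beta> i\<close> are shared, so compactness makes the intersection nonempty.
  Continuity holds since membership of \<open>k x\<close> in a clopen set is decided at a finite
  stage.\<close>

lemma exists_limit_map:
  fixes \<theta> \<theta>' :: "nat \<Rightarrow> 'a \<Rightarrow> nat"
  assumes epi: "\<And>i. epi (N i) (\<theta> i)" "\<And>i. epi (N i) (\<theta>' i)"
    and \<beta>: "\<And>i x. x \<in> X \<Longrightarrow> \<theta> i x = \<beta> i (\<theta> (Suc i) x)" "\<And>i x. x \<in> X \<Longrightarrow> \<theta>' i x = \<beta> i (\<theta>' (Suc i) x)"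
    and res: "\<And>C. clopen C \<Longrightarrow> \<exists>i. resolves (\<theta>' i) C"
  obtains k where "continuous_map P P k" "\<And>x y. (x, y) \<in> r \<Longrightarrow> (k x, k y) \<in> r"
    "\<And>i x. x \<in> X \<Longrightarrow> \<theta>' i (k x) = \<theta> i x"
proof -
  have \<theta>'_mono: "\<theta>' i x = \<theta>' i y" if "i \<le> j" "\<theta>' j x = \<theta>' j y" "x \<in> X" "y \<in> X" for i j x y
    using that(1,2)
  proof (induction j rule: dec_induct)
    case (step j)
    have "\<theta>' j x = \<theta>' j y"
      using \<beta>(2)[OF that(3), of j] \<beta>(2)[OF that(4), of j] step.prems by simp
    then show ?case by (rule step.IH)
  qed
  have "\<exists>y \<in> X. \<forall>i. \<theta>' i y = \<theta> i x" if x: "x \<in> X" for x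
  proof -
    define F where "F i = {y \<in> X. \<theta>' i y = \<theta> i x}" for i
    have "(\<Inter>i. F i) \<noteq> {}"
    proof (rule compact_space_imp_nest[OF top_structure(1)])
      fix i
      have "openin P {y \<in> X. \<theta>' i y \<in> - {\<theta> i x}}"
        using epi(2) unfolding epi_iff locally_const_def by blast
      moreover have "X - F i = {y \<in> X. \<theta>' i y \<in> - {\<theta> i x}}" by (auto simp: F_def)
      ultimately show "closedin P (F i)" by (auto simp: closedin_def F_def)
      have "\<theta> i x \<in> \<theta>' i ` X" using epi_in[OF epi(1) x] epi_image[OF epi(2)] by simp
      then show "F i \<noteq> {}" by (auto simp: F_def)
    next
      show "decseq F"
      proof (rule decseq_SucI)
        fix i
        have "\<theta>' i y = \<theta> i x" if "y \<in> X" "\<theta>' (Suc i) y = \<theta> (Suc i) x" for y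
          using \<beta>(1)[OF x, of i] \<beta>(2)[OF that(1), of i] that(2) by simp
        then show "F (Suc i) \<subseteq> F i" by (auto simp: F_def)
      qed
    qed
    then show ?thesis by (auto simp: F_def)
  qed
  hence "\<exists>k. \<forall>x \<in> X. k x \<in> X \<and> (\<forall>i. \<theta>' i (k x) = \<theta> i x)" by (intro bchoice) blast
  then obtain k where "\<forall>x \<in> X. k x \<in> X \<and> (\<forall>i. \<theta>' i (k x) = \<theta> i x)" by (elim exE)
  hence k: "\<And>x. x \<in> X \<Longrightarrow> k x \<in> X" "\<And>i x. x \<in> X \<Longrightarrow> \<theta>' i (k x) = \<theta> i x" by blast+
  have nbhd: "openin P {y \<in> X. \<theta> i y = \<theta> i x}" for i x
    by (rule openin_fibre[OF epi_locally_const[OF epi(1)]])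
  have "continuous_map P P k"
    unfolding continuous_map_def
  proof (intro conjI allI impI)
    fix U assume U: "openin P U"
    show "openin P {x \<in> X. k x \<in> U}"
    proof (subst openin_subopen, safe)
      fix x assume x: "x \<in> X" "k x \<in> U"
      obtain C where C: "clopen C" "k x \<in> C" "C \<subseteq> U" using clopen_nbhd[OF U x(2)] .
      obtain i where i: "resolves (\<theta>' i) C" using res C by blast
      have "{y \<in> X. \<theta> i y = \<theta> i x} \<subseteq> {x \<in> X. k x \<in> U}"
      proof safe
        fix y assume y: "y \<in> X" "\<theta> i y = \<theta> i x"
        hence "\<theta>' i (k x) = \<theta>' i (k y)" using k(2) x(1) by simp
        hence "k y \<in> C" using i C(2) k(1)[OF x(1)] k(1)[OF y(1)] unfolding resolves_def by blast
        thus "k y \<in> U" using C(3) by blast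
      qed
      with nbhd x show "\<exists>T. openin P T \<and> x \<in> T \<and> T \<subseteq> {x \<in> X. k x \<in> U}" by blast
    qed
  qed (use k in auto)
  moreover have "(k x, k y) \<in> r" if xy: "(x, y) \<in> r" for x y
  proof (rule ccontr)
    assume neg: "(k x, k y) \<notin> r"
    have X: "x \<in> X" "y \<in> X" using rel_in[OF xy] by auto
    have o: "openin (prod_topology P P) (X \<times> X - r)"
      using top_structure(5) by (simp add: closedin_def)
    have "(k x, k y) \<in> X \<times> X - r" using neg k(1)[OF X(1)] k(1)[OF X(2)] by blast
    then obtain U V where UV: "openin P U" "openin P V" "k x \<in> U" "k y \<in> V" "U \<times> V \<subseteq> X \<times> X - r"
      using o[unfolded openin_prod_topology_alt, rule_format] by metis
    obtain C where C: "clopen C" "k x \<in> C" "C \<subseteq> U" using clopen_nbhd[OF UV(1,3)] .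
    obtain D where D: "clopen D" "k y \<in> D" "D \<subseteq> V" using clopen_nbhd[OF UV(2,4)] .
    obtain i j where ij: "resolves (\<theta>' i) C" "resolves (\<theta>' j) D"
      using res[OF C(1)] res[OF D(1)] by blast
    \<comment> \<open>At stage \<open>M\<close> both sets are resolved. The edge between
      \<open>\<theta> M x\<close> and \<open>\<theta> M y\<close> lifts through
      \<open>\<theta>' M\<close> to a pair in \<open>r\<close>, which falls into the rectangle
      \<open>C \<times> D\<close> although that rectangle avoids \<open>r\<close>.\<close>
    define M where "M = max i j"
    have "near (\<theta> M x) (\<theta> M y)" using epi_near[OF epi(1) xy] .
    then obtain u v where uv: "(u, v) \<in> r" "\<theta>' M u = \<theta> M x" "\<theta>' M v = \<theta> M y"
      by (rule epi_lift[OF epi(2) epi_in[OF epi(1) X(1)] epi_in[OF epi(1) X(2)]])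
    have uvX: "u \<in> X" "v \<in> X" using rel_in[OF uv(1)] by auto
    have "\<theta>' i u = \<theta>' i (k x)" "\<theta>' j v = \<theta>' j (k y)"
      using \<theta>'_mono[of i M u "k x"] \<theta>'_mono[of j M v "k y"] uv(2,3) k(2)[OF X(1), of M]
        k(2)[OF X(2), of M] k(1)[OF X(1)] k(1)[OF X(2)] uvX unfolding M_def by simp_all
    hence "u \<in> C" "v \<in> D" using ij C(2) D(2) k(1)[OF X(1)] k(1)[OF X(2)] uvX
      unfolding resolves_def by blast+
    with C(3) D(3) UV(5) uv(1) show False by blast
  qed
  ultimately show ?thesis using k(2) by (rule that)
qed

lemma resolving_separates:
  assumes "\<And>C. clopen C \<Longrightarrow> \<exists>i. resolves (\<theta> i) C" "x \<in> X" "y \<in> X" "\<And>i. \<theta> i x = \<theta> i y"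
  shows "x = y"
proof (rule ccontr)
  assume "x \<noteq> y"
  then obtain C where C: "clopen C" "x \<in> C" "y \<notin> C" by (rule clopen_separation[OF assms(2,3)])
  with assms(1)[OF C(1)] assms(2-4) show False unfolding resolves_def by blast
qed

text \<open>The two sequences play symmetric roles, so there are limit maps in both directions. They
  are inverse to each other because each sequence separates points.\<close>

lemma exists_limit_automorphism:
  fixes \<theta> \<theta>' :: "nat \<Rightarrow> 'a \<Rightarrow> nat"
  assumes epi: "\<And>i. epi (N i) (\<theta> i)" "\<And>i. epi (N i) (\<theta>' i)"
    and \<beta>: "\<And>i x. x \<in> X \<Longrightarrow> \<theta> i x = \<beta> i (\<theta> (Suc i) x)" "\<And>i x. x \<in> X \<Longrightarrow> \<theta>' i x = \<beta> i (\<theta>' (Suc i) x)"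
    and res: "\<And>C. clopen C \<Longrightarrow> \<exists>i. resolves (\<theta> i) C" "\<And>C. clopen C \<Longrightarrow> \<exists>i. resolves (\<theta>' i) C"
  obtains k where "k \<in> Aut P r" "\<And>i x. x \<in> X \<Longrightarrow> \<theta>' i (k x) = \<theta> i x"
proof -
  obtain k where k: "continuous_map P P k" "\<And>x y. (x, y) \<in> r \<Longrightarrow> (k x, k y) \<in> r"
    "\<And>i x. x \<in> X \<Longrightarrow> \<theta>' i (k x) = \<theta> i x"
    by (rule exists_limit_map[OF epi \<beta> res(2)]) (assumption | rule that)+
  obtain l where l: "continuous_map P P l" "\<And>x y. (x, y) \<in> r \<Longrightarrow> (l x, l y) \<in> r"
    "\<And>i x. x \<in> X \<Longrightarrow> \<theta> i (l x) = \<theta>' i x"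
    by (rule exists_limit_map[OF epi(2,1) \<beta>(2,1) res(1)]) (assumption | rule that)+
  have X: "k x \<in> X" "l x \<in> X" if "x \<in> X" for x
    using continuous_map_image_subset_topspace[OF k(1)] continuous_map_image_subset_topspace[OF l(1)] that
    by auto
  have inv: "l (k x) = x" "k (l x) = x" if x: "x \<in> X" for x
  proof -
    have "\<theta> i (l (k x)) = \<theta> i x" for i
      using l(3)[OF X(1)[OF x], of i] k(3)[OF x, of i] by simp
    then show "l (k x) = x"
      by (intro resolving_separates[of \<theta> "l (k x)" x]) (assumption | rule res(1) X x)+
    have "\<theta>' i (k (l x)) = \<theta>' i x" for i
      using k(3)[OF X(2)[OF x], of i] l(3)[OF x, of i] by simp
    then show "k (l x) = x"
      by (intro resolving_separates[of \<theta>' "k (l x)" x]) (assumption | rule res(2) X x)+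
  qed
  \<comment> \<open>Members of \<open>Aut P r\<close> are extensional.\<close>
  let ?k = "restrict k X"
  have "homeomorphic_maps P P k l" unfolding homeomorphic_maps_def using k l inv by blast
  hence "homeomorphic_map P P k" by (auto simp: homeomorphic_map_maps)
  hence "homeomorphic_map P P ?k" by (rule homeomorphic_map_eq) auto
  moreover have "(x, y) \<in> r \<longleftrightarrow> (?k x, ?k y) \<in> r" if "x \<in> X" "y \<in> X" for x y
    using k(2)[of x y] l(2)[of "k x" "k y"] inv(1)[OF that(1)] inv(1)[OF that(2)] that
    by auto
  ultimately have "?k \<in> Aut P r" by (auto simp: Aut_def homeos_def)
  then show ?thesis by (rule that) (simp add: k(3))
qed


section \<open>The automorphism group and the space of involutions\<close>

subsection \<open>Automorphisms and involutions\<close>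

lemma Aut_homeo: "f \<in> Aut P r \<Longrightarrow> f \<in> homeos P"
  by (simp add: Aut_def)

lemma homeos_continuous: "f \<in> homeos P \<Longrightarrow> continuous_map P P f"
  by (simp add: homeos_def homeomorphic_imp_continuous_map)

lemma homeos_image: "f \<in> homeos P \<Longrightarrow> f ` X = X"
  by (simp add: homeos_def homeomorphic_imp_surjective_map)

lemma homeos_in: "f \<in> homeos P \<Longrightarrow> x \<in> X \<Longrightarrow> f x \<in> X"
  using homeos_image by blast

lemma homeos_inj: "f \<in> homeos P \<Longrightarrow> inj_on f X"
  using homeomorphic_imp_injective_map unfolding homeos_def by blast

lemma homeos_Bij: "f \<in> homeos P \<Longrightarrow> f \<in> Bij X"
  using homeos_image homeos_inj by (auto simp: Bij_def homeos_def bij_betw_def)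

lemma Aut_in: "f \<in> Aut P r \<Longrightarrow> x \<in> X \<Longrightarrow> f x \<in> X"
  using homeos_in Aut_homeo by blast

lemma Aut_rel: "f \<in> Aut P r \<Longrightarrow> x \<in> X \<Longrightarrow> y \<in> X \<Longrightarrow> (f x, f y) \<in> r \<longleftrightarrow> (x, y) \<in> r"
  by (simp add: Aut_def)

lemma mult_Aut:
  "f \<in> Aut P r \<Longrightarrow> g \<in> Aut P r \<Longrightarrow> f \<otimes>\<^bsub>Aut_group P r\<^esub> g = compose X f g"
  using homeos_Bij Aut_homeo by (simp add: Aut_group_def BijGroup_def)

lemma one_Aut: "\<one>\<^bsub>Aut_group P r\<^esub> = (\<lambda>x \<in> X. x)"
  by (simp add: Aut_group_def BijGroup_def)

lemma Aut_subgroup: "subgroup (Aut P r) (BijGroup X)"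
proof (rule group.subgroupI[OF group_BijGroup])
  show "Aut P r \<subseteq> carrier (BijGroup X)"
    using homeos_Bij Aut_homeo by (auto simp: BijGroup_def)
  have "homeomorphic_map P P (\<lambda>x \<in> X. x)"
    by (rule homeomorphic_map_eq[of P P id]) auto
  hence "(\<lambda>x \<in> X. x) \<in> Aut P r" by (auto simp: Aut_def homeos_def)
  thus "Aut P r \<noteq> {}" by blast
next
  fix f assume f: "f \<in> Aut P r"
  let ?g = "\<lambda>x \<in> X. inv_into X f x"
  have inv: "inv_into X f x \<in> X" "f (inv_into X f x) = x" if "x \<in> X" for x
    using that homeos_image[OF Aut_homeo[OF f]] by (auto simp: inv_into_into f_inv_into_f)
  obtain g where g: "homeomorphic_maps P P f g"
    using f by (auto simp: Aut_def homeos_def homeomorphic_map_maps)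
  have "g x = inv_into X f x" if "x \<in> X" for x
  proof -
    have "g (f (inv_into X f x)) = inv_into X f x"
      using g inv(1)[OF that] unfolding homeomorphic_maps_def by blast
    thus ?thesis using inv(2)[OF that] by simp
  qed
  moreover have "homeomorphic_map P P g"
    using g homeomorphic_maps_sym homeomorphic_map_maps by blast
  ultimately have "homeomorphic_map P P ?g" by (elim homeomorphic_map_eq) simp
  moreover have "(x, y) \<in> r \<longleftrightarrow> (?g x, ?g y) \<in> r" if "x \<in> X" "y \<in> X" for x y
    using Aut_rel[OF f inv(1)[OF that(1)] inv(1)[OF that(2)]] inv(2)[OF that(1)] inv(2)[OF that(2)] that
    by simp
  ultimately have "?g \<in> Aut P r" by (auto simp: Aut_def homeos_def)
  thus "inv\<^bsub>BijGroup X\<^esub> f \<in> Aut P r"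
    using inv_BijGroup[OF homeos_Bij[OF Aut_homeo[OF f]]] by simp
next
  fix f g assume f: "f \<in> Aut P r" and g: "g \<in> Aut P r"
  have "homeomorphic_map P P (f \<circ> g)"
    using f g by (intro homeomorphic_map_compose[of P P]) (auto simp: Aut_def homeos_def)
  hence "homeomorphic_map P P (compose X f g)"
    by (rule homeomorphic_map_eq) (simp add: compose_eq)
  moreover have "(x, y) \<in> r \<longleftrightarrow> (compose X f g x, compose X f g y) \<in> r" if "x \<in> X" "y \<in> X" for x y
    using that Aut_rel[OF g that] Aut_rel[OF f Aut_in[OF g that(1)] Aut_in[OF g that(2)]]
    by (simp add: compose_eq)
  ultimately have "compose X f g \<in> Aut P r"
    by (auto simp: Aut_def homeos_def)
  thus "f \<otimes>\<^bsub>BijGroup X\<^esub> g \<in> Aut P r"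
    using f g homeos_Bij Aut_homeo by (simp add: BijGroup_def)
qed

lemma group_Aut: "group (Aut_group P r)"
  unfolding Aut_group_def by (rule subgroup.subgroup_is_group[OF Aut_subgroup group_BijGroup])

lemma carrier_Aut: "carrier (Aut_group P r) = Aut P r"
  by (simp add: Aut_group_def)

lemma involutions_iff: "f \<in> involutions P r \<longleftrightarrow> f \<in> Aut P r \<and> (\<forall>x \<in> X. f (f x) = x)"
proof -
  have "compose X f f = (\<lambda>x \<in> X. x) \<longleftrightarrow> (\<forall>x \<in> X. f (f x) = x)"
  proof
    assume *: "compose X f f = (\<lambda>x \<in> X. x)"
    show "\<forall>x \<in> X. f (f x) = x"
    proof
      fix x assume "x \<in> X"
      with fun_cong[OF *, of x] show "f (f x) = x" by (simp add: compose_eq)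
    qed
  next
    assume "\<forall>x \<in> X. f (f x) = x"
    thus "compose X f f = (\<lambda>x \<in> X. x)" by (auto simp: compose_def intro: restrict_ext)
  qed
  then show ?thesis by (auto simp: involutions_def mult_Aut one_Aut)
qed

lemma involution_Aut: "f \<in> involutions P r \<Longrightarrow> f \<in> Aut P r"
  by (simp add: involutions_iff)

lemma involution_in: "f \<in> involutions P r \<Longrightarrow> x \<in> X \<Longrightarrow> f x \<in> X"
  using Aut_in involution_Aut by blast

lemma involution_twice: "f \<in> involutions P r \<Longrightarrow> x \<in> X \<Longrightarrow> f (f x) = x"
  by (simp add: involutions_iff)

lemma epi_Aut:
  assumes \<phi>: "epi n \<phi>" and f: "f \<in> Aut P r"
  shows "epi n (\<phi> \<circ> f)"
proof (rule epi_precomp[OF \<phi>])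
  show "continuous_map P P f" by (rule homeos_continuous[OF Aut_homeo[OF f]])
  show im: "f ` X = X" by (rule homeos_image[OF Aut_homeo[OF f]])
  show "(f x, f y) \<in> r" if "(x, y) \<in> r" for x y
    using rel_in[OF that] Aut_rel[OF f, of x y] that by simp
  show "\<exists>x y. (x, y) \<in> r \<and> f x = u \<and> f y = v" if uv: "(u, v) \<in> r" for u v
  proof -
    have "u \<in> f ` X" "v \<in> f ` X" using rel_in[OF uv] im by auto
    then obtain x y where "x \<in> X" "y \<in> X" "f x = u" "f y = v" by blast
    then show ?thesis using Aut_rel[OF f, of x y] uv by blast
  qed
qed

definition equivariant :: "nat \<Rightarrow> ('a \<Rightarrow> nat) \<Rightarrow> ('a \<Rightarrow> 'a) \<Rightarrow> bool" where
  "equivariant n \<theta> f \<longleftrightarrow> (\<forall>x \<in> X. \<theta> (f x) = flip n (\<theta> x))"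

lemma equivariantD: "equivariant n \<theta> f \<Longrightarrow> x \<in> X \<Longrightarrow> \<theta> (f x) = flip n (\<theta> x)"
  by (simp add: equivariant_def)

lemma path_epi_flip: "path_epi n n (flip n)"
proof -
  have "flip n ` {1..n} = {1..n}"
  proof
    show "{1..n} \<subseteq> flip n ` {1..n}"
    proof
      fix i assume "i \<in> {1..n}"
      then show "i \<in> flip n ` {1..n}"
        by (intro image_eqI[of _ _ "flip n i"]) (simp_all only: flip_flip flip_in)
    qed
  qed (use flip_in in blast)
  moreover have "near (flip n i) (flip n (Suc i))" for i
    by (rule near_flip) (simp add: near_def)
  ultimately show ?thesis by (simp add: path_epi_def)
qed

text \<open>The involution is the limit of flips along a sequence of epimorphisms onto paths of even
  length whose bonding maps commute with the flips.\<close>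

lemma exists_involution:
  assumes \<theta>0: "epi (2 * n) \<theta>0"
  obtains f where "f \<in> involutions P r" "equivariant (2 * n) \<theta>0 f"
proof -
  \<comment> \<open>A stage is half the number of vertices of a path with an epimorphism onto that
    path; stage \<open>Suc i\<close> resolves the clopen set with number \<open>i\<close>.\<close>
  define Q where "Q i s t \<longleftrightarrow> (\<exists>\<beta>. flip_equivariant (2 * fst t) (2 * fst s) \<beta> \<and>
    (\<forall>x \<in> X. snd s x = \<beta> (snd t x)) \<and> resolves (snd t) (nth_clopen i))"
    for i and s t :: "nat \<times> ('a \<Rightarrow> nat)"
  have "\<exists>s. \<forall>i. (epi (2 * fst (s i)) (snd (s i)) \<and> (i = 0 \<longrightarrow> s i = (n, \<theta>0))) \<and> Q i (s i) (s (Suc i))"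
  proof (rule dependent_nat_choice)
    show "\<exists>s. epi (2 * fst s) (snd s) \<and> ((0::nat) = 0 \<longrightarrow> s = (n, \<theta>0))"
      by (rule exI[of _ "(n, \<theta>0)"]) (simp add: \<theta>0)
  next
    fix s :: "nat \<times> ('a \<Rightarrow> nat)" and i :: nat
    assume "epi (2 * fst s) (snd s) \<and> (i = 0 \<longrightarrow> s = (n, \<theta>0))"
    hence s: "epi (2 * fst s) (snd s)" by blast
    obtain m \<xi> \<alpha> where \<xi>: "epi m \<xi>" and \<alpha>: "path_epi m (2 * fst s) \<alpha>"
      and s\<xi>: "\<And>x. x \<in> X \<Longrightarrow> snd s x = \<alpha> (\<xi> x)" and res: "resolves \<xi> (nth_clopen i)"
      by (rule epi_resolving[OF s clopen_nth[of i]]) (rule that)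
    have "fst s \<ge> 1" using epi_pos[OF s] by simp
    \<comment> \<open>The map \<open>\<alpha>\<close> need not commute with flips, and its source
      may even have odd length; \<open>\<alpha> \<circ> \<gamma>\<close> is the equivariant bonding
      map.\<close>
    then obtain p \<gamma> where \<gamma>: "path_epi (2*p) m \<gamma>" "flip_equivariant (2*p) (2 * fst s) (\<alpha> \<circ> \<gamma>)"
      using exists_equivariant_refinement[OF \<alpha>] by blast
    obtain \<eta> where \<eta>: "epi (2*p) \<eta>" "\<And>x. x \<in> X \<Longrightarrow> \<xi> x = \<gamma> (\<eta> x)"
      by (rule epi_extension[OF \<xi> \<gamma>(1)]) (rule that)
    have "Q i s (p, \<eta>)" unfolding Q_def
    proof (intro exI conjI ballI)
      show "flip_equivariant (2 * fst (p, \<eta>)) (2 * fst s) (\<alpha> \<circ> \<gamma>)" using \<gamma>(2) by simp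
      show "snd s x = (\<alpha> \<circ> \<gamma>) (snd (p, \<eta>) x)" if "x \<in> X" for x
        using s\<xi>[OF that] \<eta>(2)[OF that] by simp
      show "resolves (snd (p, \<eta>)) (nth_clopen i)"
        using resolves_factor[of \<xi> _ \<gamma> \<eta>] res \<eta>(2) by simp
    qed
    with \<eta>(1) show "\<exists>t. (epi (2 * fst t) (snd t) \<and> (Suc i = 0 \<longrightarrow> t = (n, \<theta>0))) \<and> Q i s t"
      by (intro exI[of _ "(p, \<eta>)"]) simp
  qed
  then obtain s where epi: "\<And>i. epi (2 * fst (s i)) (snd (s i))" and s0: "s 0 = (n, \<theta>0)"
    and Q: "\<And>i. Q i (s i) (s (Suc i))"
    by blast
  define N where "N i = 2 * fst (s i)" for i
  define \<theta> where "\<theta> i = snd (s i)" for i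
  have "\<forall>i. \<exists>\<beta>. flip_equivariant (N (Suc i)) (N i) \<beta> \<and>
    (\<forall>x \<in> X. \<theta> i x = \<beta> (\<theta> (Suc i) x)) \<and> resolves (\<theta> (Suc i)) (nth_clopen i)"
    using Q unfolding Q_def N_def \<theta>_def by blast
  then obtain \<beta> where "\<forall>i. flip_equivariant (N (Suc i)) (N i) (\<beta> i) \<and>
    (\<forall>x \<in> X. \<theta> i x = \<beta> i (\<theta> (Suc i) x)) \<and> resolves (\<theta> (Suc i)) (nth_clopen i)"
    by (elim choice[THEN exE])
  hence flip: "\<And>i. flip_equivariant (N (Suc i)) (N i) (\<beta> i)"
    and \<theta>\<beta>: "\<And>i x. x \<in> X \<Longrightarrow> \<theta> i x = \<beta> i (\<theta> (Suc i) x)"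
    and res: "\<And>i. resolves (\<theta> (Suc i)) (nth_clopen i)"
    by blast+
  have epi\<theta>: "epi (N i) (\<theta> i)" for i using epi by (simp add: N_def \<theta>_def)
  \<comment> \<open>Reversing every level gives a second sequence with the same bonding maps, since
    these commute with the flips. The automorphism carrying one sequence to the other induces the
    flip on each level.\<close>
  define \<theta>' where "\<theta>' i = flip (N i) \<circ> \<theta> i" for i
  have epi\<theta>': "epi (N i) (\<theta>' i)" for i
    unfolding \<theta>'_def by (rule epi_comp[OF epi\<theta> path_epi_flip])
  have \<theta>\<theta>': "\<theta> i x = flip (N i) (\<theta>' i x)" if "x \<in> X" for i x
    using epi_in[OF epi\<theta> that] by (simp add: \<theta>'_def flip_flip)
  have \<theta>'\<beta>: "\<theta>' i x = \<beta> i (\<theta>' (Suc i) x)" if "x \<in> X" for i x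
    using \<theta>\<beta>[OF that, of i] flip[of i] epi_in[OF epi\<theta> that, of "Suc i"]
    by (simp add: \<theta>'_def flip_equivariant_def)
  have res\<theta>: "\<exists>i. resolves (\<theta> i) C" if "clopen C" for C
    using res clopen_eq_nth[OF that] by metis
  have res\<theta>': "\<exists>i. resolves (\<theta>' i) C" if C: "clopen C" for C
  proof -
    obtain i where "resolves (\<theta> i) C" using res\<theta>[OF C] by blast
    then have "resolves (\<theta>' i) C"
      using resolves_factor[of "\<theta> i" C "flip (N i)" "\<theta>' i"] \<theta>\<theta>' by blast
    then show ?thesis by blast
  qed
  obtain f where f: "f \<in> Aut P r" and \<theta>f: "\<And>i x. x \<in> X \<Longrightarrow> \<theta>' i (f x) = \<theta> i x"
    by (rule exists_limit_automorphism[of N \<theta> \<theta>' \<beta>, OF epi\<theta> epi\<theta>'])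
      (assumption | rule \<theta>\<beta> \<theta>'\<beta> res\<theta> res\<theta>' that)+
  have \<theta>f: "\<theta> i (f x) = flip (N i) (\<theta> i x)" if "x \<in> X" for i x
    using \<theta>\<theta>'[OF Aut_in[OF f that], of i] \<theta>f[OF that, of i] by simp
  have "f (f x) = x" if x: "x \<in> X" for x
  proof (rule resolving_separates[of \<theta>])
    show "f (f x) \<in> X" using Aut_in f x by simp
    show "\<theta> i (f (f x)) = \<theta> i x" for i
      using \<theta>f[OF Aut_in[OF f x], of i] \<theta>f[OF x, of i] epi_in[OF epi\<theta>[of i] x] by (simp add: flip_flip)
  qed (fact res\<theta> x)+
  hence "f \<in> involutions P r" using f by (simp add: involutions_iff)
  moreover have "equivariant (2 * n) \<theta>0 f"
    using \<theta>f[of _ 0] by (simp add: equivariant_def N_def \<theta>_def s0)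
  ultimately show ?thesis by (rule that)
qed


subsection \<open>Neighbourhoods of an involution\<close>

abbreviation CO :: "('a \<Rightarrow> 'a) topology" where "CO \<equiv> compact_open_topology P"

abbreviation Inv :: "('a \<Rightarrow> 'a) topology" where "Inv \<equiv> involutions_topology P r"

lemma openin_CO_basis:
  assumes "compactin P K" "openin P U"
  shows "openin CO {f \<in> homeos P. f ` K \<subseteq> U}"
  using assms unfolding compact_open_topology_def
  by (intro topology_generated_by_Basis) blast

lemma openin_Inv_iff: "openin Inv U \<longleftrightarrow> (\<exists>V. openin CO V \<and> U = V \<inter> involutions P r)"
proof -
  have "Aut P r \<inter> involutions P r = involutions P r" by (auto simp: involution_Aut)
  then show ?thesis
    by (simp add: involutions_topology_def Aut_topology_def subtopology_subtopology openin_subtopology)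
qed

lemma topspace_Inv: "topspace Inv = involutions P r"
proof -
  \<comment> \<open>The empty compact set imposes no condition, so all of \<open>homeos P\<close> is
    open.\<close>
  have "openin CO {f \<in> homeos P. f ` {} \<subseteq> X}" by (rule openin_CO_basis) auto
  hence "openin Inv ({f \<in> homeos P. f ` {} \<subseteq> X} \<inter> involutions P r)"
    unfolding openin_Inv_iff by blast
  moreover have "{f \<in> homeos P. f ` {} \<subseteq> X} \<inter> involutions P r = involutions P r"
    using Aut_homeo involution_Aut by auto
  ultimately have "involutions P r \<subseteq> topspace Inv" by (metis openin_subset)
  moreover have "topspace Inv \<subseteq> involutions P r"
    using openin_topspace[of Inv] unfolding openin_Inv_iff by blast
  ultimately show ?thesis by blast
qed

lemma compactin_fibre:
  assumes "epi n \<theta>"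
  shows "compactin P {x \<in> X. \<theta> x = a}"
proof (rule closedin_compact_space[OF top_structure(1)])
  have "openin P {x \<in> X. \<theta> x \<in> - {a}}"
    using epi_locally_const[OF assms] unfolding locally_const_def by blast
  moreover have "X - {x \<in> X. \<theta> x = a} = {x \<in> X. \<theta> x \<in> - {a}}" by auto
  ultimately show "closedin P {x \<in> X. \<theta> x = a}" by (auto simp: closedin_def)
qed

text \<open>Fibres of \<open>\<theta>\<close> are compact and open, so this is a finite intersection
  of subbasic sets, one for each value.\<close>

lemma openin_CO_intertwining:
  assumes \<theta>: "epi n \<theta>"
  shows "openin CO {g \<in> homeos P. \<forall>x \<in> X. \<theta> (g x) = h (\<theta> x)}"
proof -
  let ?B = "\<lambda>a. {g \<in> homeos P. g ` {x \<in> X. \<theta> x = a} \<subseteq> {x \<in> X. \<theta> x = h a}}"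
  have "openin CO (\<Inter>a \<in> {1..n}. ?B a)"
  proof (rule openin_Inter)
    show "openin CO S" if "S \<in> ?B ` {1..n}" for S
      using that openin_CO_basis[OF compactin_fibre[OF \<theta>] openin_fibre[OF epi_locally_const[OF \<theta>]]]
      by blast
  qed (use epi_pos[OF \<theta>] in auto)
  moreover have "(\<Inter>a \<in> {1..n}. ?B a) = {g \<in> homeos P. \<forall>x \<in> X. \<theta> (g x) = h (\<theta> x)}"
  proof (intro equalityI subsetI)
    fix g assume g: "g \<in> (\<Inter>a \<in> {1..n}. ?B a)"
    have "1 \<in> {1..n}" using epi_pos[OF \<theta>] by simp
    hence "g \<in> homeos P" using g by blast
    moreover have "\<theta> (g x) = h (\<theta> x)" if x: "x \<in> X" for x
    proof -
      have "g \<in> ?B (\<theta> x)" using g epi_in[OF \<theta> x] by blast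
      then show ?thesis using x by blast
    qed
    ultimately show "g \<in> {g \<in> homeos P. \<forall>x \<in> X. \<theta> (g x) = h (\<theta> x)}" by blast
  next
    fix g assume "g \<in> {g \<in> homeos P. \<forall>x \<in> X. \<theta> (g x) = h (\<theta> x)}"
    then show "g \<in> (\<Inter>a \<in> {1..n}. ?B a)" using homeos_in by auto
  qed
  ultimately show ?thesis by simp
qed

text \<open>A failure at a single point is a subbasic condition whose compact set is that
  point.\<close>

lemma openin_CO_not_intertwining:
  assumes \<theta>: "epi n \<theta>"
  shows "openin CO {g \<in> homeos P. \<exists>x \<in> X. \<theta> (g x) \<noteq> h (\<theta> x)}"
proof -
  let ?B = "\<lambda>x. {g \<in> homeos P. g ` {x} \<subseteq> {y \<in> X. \<theta> y \<in> - {h (\<theta> x)}}}"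
  have "openin CO (\<Union>x \<in> X. ?B x)"
  proof (rule openin_Union)
    show "openin CO S" if "S \<in> ?B ` X" for S
    proof -
      obtain x where x: "x \<in> X" "S = ?B x" using \<open>S \<in> ?B ` X\<close> by blast
      show ?thesis unfolding x(2)
      proof (rule openin_CO_basis)
        show "compactin P {x}" using x(1) by simp
        show "openin P {y \<in> X. \<theta> y \<in> - {h (\<theta> x)}}"
          using epi_locally_const[OF \<theta>] unfolding locally_const_def by blast
      qed
    qed
  qed
  moreover have "(\<Union>x \<in> X. ?B x) = {g \<in> homeos P. \<exists>x \<in> X. \<theta> (g x) \<noteq> h (\<theta> x)}"
    using homeos_in by auto
  ultimately show ?thesis by simp
qed

text \<open>The complement matters as well: on it the lifting requirement for generic involutions
  holds vacuously.\<close>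

lemma openin_equivariant:
  assumes "epi n \<theta>"
  shows "openin Inv {f \<in> involutions P r. equivariant n \<theta> f}"
    and "openin Inv {f \<in> involutions P r. \<not> equivariant n \<theta> f}"
proof -
  have eq: "{f \<in> involutions P r. equivariant n \<theta> f} =
      {g \<in> homeos P. \<forall>x \<in> X. \<theta> (g x) = flip n (\<theta> x)} \<inter> involutions P r"
    "{f \<in> involutions P r. \<not> equivariant n \<theta> f} =
      {g \<in> homeos P. \<exists>x \<in> X. \<theta> (g x) \<noteq> flip n (\<theta> x)} \<inter> involutions P r"
    using Aut_homeo involution_Aut by (auto simp: equivariant_def)
  show "openin Inv {f \<in> involutions P r. equivariant n \<theta> f}"
    unfolding openin_Inv_iff eq using openin_CO_intertwining[OF assms] by blast
  show "openin Inv {f \<in> involutions P r. \<not> equivariant n \<theta> f}"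
    unfolding openin_Inv_iff eq using openin_CO_not_intertwining[OF assms] by blast
qed

text \<open>For a subbasic set, a clopen set fits between the compact image of \<open>K\<close> and
  the open set \<open>V\<close>, and some epimorphism resolves it. Intersections are treated by
  common refinement.\<close>

lemma homeos_nbhd:
  assumes "openin CO U" "f \<in> U" "f \<in> homeos P"
  shows "\<exists>n \<phi>. epi n \<phi> \<and> (\<forall>g \<in> homeos P. (\<forall>x \<in> X. \<phi> (g x) = \<phi> (f x)) \<longrightarrow> g \<in> U)"
proof -
  have "generate_topology_on {{f \<in> homeos P. f ` K \<subseteq> U} | K U. compactin P K \<and> openin P U} U"
    using assms(1) unfolding compact_open_topology_def by (simp add: openin_topology_generated_by_iff)
  then show ?thesis using assms(2)
  proof (induction rule: generate_topology_on.induct)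
    case Empty
    then show ?case by simp
  next
    case (Int A B)
    obtain m \<phi> where \<phi>: "epi m \<phi>" "\<forall>g \<in> homeos P. (\<forall>x \<in> X. \<phi> (g x) = \<phi> (f x)) \<longrightarrow> g \<in> A"
      using Int by blast
    obtain n \<psi> where \<psi>: "epi n \<psi>" "\<forall>g \<in> homeos P. (\<forall>x \<in> X. \<psi> (g x) = \<psi> (f x)) \<longrightarrow> g \<in> B"
      using Int by blast
    obtain k \<xi> h1 h2 where \<xi>: "epi k \<xi>" and h: "\<And>x. x \<in> X \<Longrightarrow> \<phi> x = h1 (\<xi> x)" "\<And>x. x \<in> X \<Longrightarrow> \<psi> x = h2 (\<xi> x)"
      by (rule exists_common_refinement[OF epi_locally_const[OF \<phi>(1)] epi_locally_const[OF \<psi>(1)]])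
        (rule that)
    have "g \<in> A \<inter> B" if g: "g \<in> homeos P" "\<forall>x \<in> X. \<xi> (g x) = \<xi> (f x)" for g
    proof -
      have "\<phi> (g x) = \<phi> (f x) \<and> \<psi> (g x) = \<psi> (f x)" if x: "x \<in> X" for x
        using h(1)[OF homeos_in[OF g(1) x]] h(1)[OF homeos_in[OF assms(3) x]]
          h(2)[OF homeos_in[OF g(1) x]] h(2)[OF homeos_in[OF assms(3) x]] g(2) x by simp
      with \<phi>(2) \<psi>(2) g(1) show ?thesis by blast
    qed
    with \<xi> show ?case by blast
  next
    case (UN K)
    then obtain A where A: "A \<in> K" "f \<in> A" by blast
    from UN.IH[OF this] show ?case using A by blast
  next
    case (Basis B)
    then obtain K V where B: "B = {f \<in> homeos P. f ` K \<subseteq> V}" "compactin P K" "openin P V" by blast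
    have "compactin P (f ` K)"
      by (rule image_compactin[OF B(2) homeos_continuous[OF assms(3)]])
    moreover have "f ` K \<subseteq> V" using Basis B by blast
    ultimately obtain C where C: "clopen C" "f ` K \<subseteq> C" "C \<subseteq> V"
      using clopen_between B(3) by metis
    obtain \<phi>0 :: "'a \<Rightarrow> nat" where "epi 1 \<phi>0" using exists_epi by blast
    from epi_resolving[OF this C(1)] obtain n \<phi> where \<phi>: "epi n \<phi>" "resolves \<phi> C" by metis
    have KX: "K \<subseteq> X" using B(2) by (simp add: compactin_def)
    have "g \<in> B" if g: "g \<in> homeos P" "\<forall>x \<in> X. \<phi> (g x) = \<phi> (f x)" for g
    proof -
      have "g x \<in> V" if x: "x \<in> K" for x
      proof -
        have "x \<in> X" using x KX by blast
        moreover from this have "g x \<in> X" "f x \<in> X" using g(1) assms(3) homeos_in by blast+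
        moreover have "f x \<in> C" using C(2) x by blast
        ultimately have "g x \<in> C" using \<phi>(2) g(2) unfolding resolves_def by metis
        thus ?thesis using C(3) by blast
      qed
      thus ?thesis using g(1) B(1) by blast
    qed
    with \<phi>(1) show ?case by blast
  qed
qed

text \<open>Given \<open>f\<close>, refine so that the class of \<open>f x\<close> is determined by that of \<open>x\<close>. The relation
  \<open>{(\<phi> x, \<phi> (f x))}\<close> is then the image of a flip of an even path, which lifts to \<open>P\<close>.\<close>

lemma equivariant_nbhd_base:
  assumes f: "f \<in> involutions P r" and U: "openin Inv U" "f \<in> U" and g: "locally_const g"
  obtains k \<theta> h where "epi (2 * k) \<theta>" "\<And>x. x \<in> X \<Longrightarrow> g x = h (\<theta> x)"
    "{f' \<in> involutions P r. equivariant (2 * k) \<theta> f'} \<subseteq> U"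
proof -
  note fA = involution_Aut[OF f] and fH = Aut_homeo[OF involution_Aut[OF f]]
  obtain V where V: "openin CO V" "U = V \<inter> involutions P r" using U(1) unfolding openin_Inv_iff by blast
  have "f \<in> V" using U(2) V(2) by blast
  from homeos_nbhd[OF V(1) this fH] obtain n0 \<phi>0 where \<phi>0: "epi n0 \<phi>0"
    and nbhd: "\<forall>g \<in> homeos P. (\<forall>x \<in> X. \<phi>0 (g x) = \<phi>0 (f x)) \<longrightarrow> g \<in> V"
    by (elim exE conjE)
  \<comment> \<open>The class of \<open>x\<close> under \<open>\<phi>1\<close> determines the
    classes of both \<open>x\<close> and \<open>f x\<close> under \<open>\<phi>0\<close>; the
    comparison of \<open>f'\<close> with \<open>f\<close> below relies on both.\<close>
  obtain n1 \<phi>1 e1 e2 where \<phi>1: "epi n1 \<phi>1" and e: "\<And>x. x \<in> X \<Longrightarrow> \<phi>0 x = e1 (\<phi>1 x)"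
    "\<And>x. x \<in> X \<Longrightarrow> (\<phi>0 \<circ> f) x = e2 (\<phi>1 x)"
    by (rule exists_common_refinement[OF epi_locally_const[OF \<phi>0] epi_locally_const[OF epi_Aut[OF \<phi>0 fA]]])
      (rule that)
  obtain n \<phi> d1 d2 where \<phi>: "epi n \<phi>" and d: "\<And>x. x \<in> X \<Longrightarrow> \<phi>1 x = d1 (\<phi> x)"
    "\<And>x. x \<in> X \<Longrightarrow> g x = d2 (\<phi> x)"
    by (rule exists_common_refinement[OF epi_locally_const[OF \<phi>1] g]) (rule that)
  obtain m \<xi> b1 b2 where \<xi>: "epi m \<xi>" and b: "\<And>x. x \<in> X \<Longrightarrow> \<phi> x = b1 (\<xi> x)"
    "\<And>x. x \<in> X \<Longrightarrow> (\<phi> \<circ> f) x = b2 (\<xi> x)"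
    by (rule exists_common_refinement[OF epi_locally_const[OF \<phi>] epi_locally_const[OF epi_Aut[OF \<phi> fA]]])
      (rule that)
  have pb: "path_epi m n b1" "path_epi m n b2"
    by (rule epi_factor[OF \<xi> \<phi> b(1)], assumption) (rule epi_factor[OF \<xi> epi_Aut[OF \<phi> fA] b(2)], assumption)
  have "\<exists>k a. k \<ge> 1 \<and> path_epi (2*k) n a \<and>
    (\<forall>i \<in> {1..2*k}. \<exists>j \<in> {1..m}. a i = b1 j \<and> a (flip (2*k) i) = b2 j)"
  proof (rule symmetric_relation_from_flip)
    show "m \<ge> 1" by (rule epi_pos[OF \<xi>])
    show "near (b1 i) (b1 (Suc i)) \<and> near (b2 i) (b2 (Suc i))" if "1 \<le> i" "i < m" for i
      using pb that by (simp add: path_epi_def)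
    show "b1 ` {1..m} = {1..n}" using pb by (simp add: path_epi_def)
    \<comment> \<open>Passing from \<open>x\<close> to \<open>f x\<close> exchanges the coordinates,
      because \<open>f\<close> is an involution.\<close>
    show "\<exists>j \<in> {1..m}. b1 j = b2 i \<and> b2 j = b1 i" if "i \<in> {1..m}" for i
    proof -
      have "i \<in> \<xi> ` X" using that epi_image[OF \<xi>] by simp
      then obtain x where x: "x \<in> X" "i = \<xi> x" by blast
      have fx: "f x \<in> X" using involution_in[OF f x(1)] .
      have "b1 (\<xi> (f x)) = b2 i" "b2 (\<xi> (f x)) = b1 i"
        using b(1)[OF fx] b(2)[OF fx] b(1)[OF x(1)] b(2)[OF x(1)] involution_twice[OF f x(1)] x(2)
        by simp_all
      then show ?thesis using epi_in[OF \<xi> fx] by blast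
    qed
  qed
  then obtain k a where a: "path_epi (2*k) n a"
    and rel: "\<forall>i \<in> {1..2*k}. \<exists>j \<in> {1..m}. a i = b1 j \<and> a (flip (2*k) i) = b2 j"
    by (elim exE conjE)
  obtain \<theta> where \<theta>: "epi (2*k) \<theta>" and a\<theta>: "\<And>x. x \<in> X \<Longrightarrow> \<phi> x = a (\<theta> x)"
    by (rule epi_extension[OF \<phi> a]) (rule that)
  show ?thesis
  proof (rule that[OF \<theta>])
    show "g x = (d2 \<circ> a) (\<theta> x)" if "x \<in> X" for x using d(2)[OF that] a\<theta>[OF that] by simp
    show "{f' \<in> involutions P r. equivariant (2 * k) \<theta> f'} \<subseteq> U"
    proof
      fix f' assume "f' \<in> {f' \<in> involutions P r. equivariant (2 * k) \<theta> f'}"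
      hence f': "f' \<in> involutions P r" "equivariant (2 * k) \<theta> f'" by auto
      have "\<phi>0 (f' x) = \<phi>0 (f x)" if x: "x \<in> X" for x
      proof -
        have f'x: "f' x \<in> X" by (rule involution_in[OF f'(1) x])
        obtain j where j: "j \<in> {1..m}" "a (\<theta> x) = b1 j" "a (flip (2*k) (\<theta> x)) = b2 j"
          using rel epi_in[OF \<theta> x] by blast
        \<comment> \<open>The point \<open>y\<close> is chosen so that \<open>\<phi>\<close> takes
          the same values at \<open>y\<close> and \<open>f y\<close> as at \<open>x\<close> and
          \<open>f' x\<close>. Thus \<open>f y\<close> links \<open>f' x\<close> with
          \<open>f x\<close>.\<close>
        have "j \<in> \<xi> ` X" using j(1) epi_image[OF \<xi>] by simp
        then obtain y where y: "y \<in> X" "j = \<xi> y" by blast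
        have fy: "f y \<in> X" by (rule involution_in[OF f y(1)])
        have "\<phi> x = \<phi> y" using j(2) a\<theta>[OF x] b(1)[OF y(1)] y(2) by simp
        hence "\<phi>1 x = \<phi>1 y" using d(1)[OF x] d(1)[OF y(1)] by simp
        hence xy: "\<phi>0 (f x) = \<phi>0 (f y)" using e(2)[OF x] e(2)[OF y(1)] by simp
        have "\<phi> (f' x) = \<phi> (f y)"
          using a\<theta>[OF f'x] equivariantD[OF f'(2) x] j(3) b(2)[OF y(1)] y(2) by simp
        hence "\<phi>1 (f' x) = \<phi>1 (f y)" using d(1)[OF f'x] d(1)[OF fy] by simp
        hence "\<phi>0 (f' x) = \<phi>0 (f y)" using e(1)[OF f'x] e(1)[OF fy] by simp
        with xy show ?thesis by simp
      qed
      hence "f' \<in> V" using nbhd Aut_homeo[OF involution_Aut[OF f'(1)]] by blast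
      thus "f' \<in> U" using V(2) f'(1) by blast
    qed
  qed
qed


section \<open>Genericity, conjugacy and the comeager orbit\<close>

subsection \<open>Generic involutions\<close>

lemma flip_equivariant_factor:
  assumes f: "f \<in> involutions P r" and \<eta>: "epi m \<eta>" "equivariant m \<eta> f"
    and \<theta>: "epi n \<theta>" "equivariant n \<theta> f" and \<beta>: "\<And>x. x \<in> X \<Longrightarrow> \<theta> x = \<beta> (\<eta> x)"
  shows "flip_equivariant m n \<beta>"
  unfolding flip_equivariant_def
proof
  fix i assume "i \<in> {1..m}"
  hence "i \<in> \<eta> ` X" using epi_image[OF \<eta>(1)] by simp
  then obtain x where x: "x \<in> X" "i = \<eta> x" by blast
  show "\<beta> (flip m i) = flip n (\<beta> i)"
    using equivariantD[OF \<eta>(2) x(1)] equivariantD[OF \<theta>(2) x(1)] \<beta>[OF x(1)]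
      \<beta>[OF involution_in[OF f x(1)]] x(2) by simp
qed

text \<open>Cofinality of the even paths on which \<open>f\<close> acts as the flip; it lets the
  back-and-forth resolve clopen sets.\<close>

definition refines_epi :: "('a \<Rightarrow> nat) \<Rightarrow> ('a \<Rightarrow> 'a) \<Rightarrow> bool" where
  "refines_epi \<psi> f \<longleftrightarrow> (\<exists>k \<theta> h. epi (2 * k) \<theta> \<and> equivariant (2 * k) \<theta> f \<and> (\<forall>x \<in> X. \<psi> x = h (\<theta> x)))"

text \<open>The equivariant counterpart of \<open>epi_extension\<close>. As an implication it is a
  condition on all involutions, so the sets that it defines can be dense.\<close>

definition lifts_epi :: "nat \<Rightarrow> ('a \<Rightarrow> nat) \<Rightarrow> nat \<Rightarrow> (nat \<Rightarrow> nat) \<Rightarrow> ('a \<Rightarrow> 'a) \<Rightarrow> bool" where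
  "lifts_epi n \<phi> m \<alpha> f \<longleftrightarrow> equivariant (2 * n) \<phi> f \<longrightarrow>
     (\<exists>\<theta>. epi (2 * m) \<theta> \<and> equivariant (2 * m) \<theta> f \<and> (\<forall>x \<in> X. \<phi> x = \<alpha> (\<theta> x)))"

definition generic :: "('a \<Rightarrow> 'a) \<Rightarrow> bool" where
  "generic f \<longleftrightarrow> f \<in> involutions P r \<and> (\<forall>n \<psi>. epi n \<psi> \<longrightarrow> refines_epi \<psi> f) \<and>
     (\<forall>n \<phi> m \<alpha>. epi (2 * n) \<phi> \<and> path_epi (2 * m) (2 * n) \<alpha> \<and> flip_equivariant (2 * m) (2 * n) \<alpha>
        \<longrightarrow> lifts_epi n \<phi> m \<alpha> f)"

text \<open>One witness \<open>\<theta>\<close> serves all involutions equivariant for it, which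
  form an open set. For density, a given open set contains all involutions equivariant for some
  \<open>\<theta>\<close> that refines \<open>\<psi>\<close>, and there is such an
  involution.\<close>

lemma refines_epi_open_dense:
  assumes \<psi>: "epi n \<psi>"
  shows "openin Inv {f \<in> involutions P r. refines_epi \<psi> f}"
    and "Inv closure_of {f \<in> involutions P r. refines_epi \<psi> f} = topspace Inv"
proof -
  let ?O = "{f \<in> involutions P r. refines_epi \<psi> f}"
  show "openin Inv ?O"
  proof (subst openin_subopen, intro ballI)
    fix f assume f: "f \<in> ?O"
    then obtain k \<theta> h where \<theta>: "epi (2 * k) \<theta>" "equivariant (2 * k) \<theta> f" "\<forall>x \<in> X. \<psi> x = h (\<theta> x)"
      unfolding refines_epi_def by blast
    have "{f \<in> involutions P r. equivariant (2 * k) \<theta> f} \<subseteq> ?O"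
      using \<theta>(1,3) unfolding refines_epi_def by blast
    with openin_equivariant(1)[OF \<theta>(1)] \<theta>(2) f
    show "\<exists>T. openin Inv T \<and> f \<in> T \<and> T \<subseteq> ?O" by blast
  qed
  show "Inv closure_of ?O = topspace Inv"
    unfolding dense_intersects_open
  proof (intro allI impI)
    fix U assume U: "openin Inv U \<and> U \<noteq> {}"
    then obtain f where f: "f \<in> U" by blast
    have "f \<in> involutions P r" using f U openin_subset topspace_Inv by blast
    then obtain k \<theta> h where \<theta>: "epi (2 * k) \<theta>" and h: "\<And>x. x \<in> X \<Longrightarrow> \<psi> x = h (\<theta> x)"
      and sub: "{f' \<in> involutions P r. equivariant (2 * k) \<theta> f'} \<subseteq> U"
      by (rule equivariant_nbhd_base[OF _ conjunct1[OF U] f epi_locally_const[OF \<psi>]]) (rule that)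
    obtain f' where f': "f' \<in> involutions P r" "equivariant (2 * k) \<theta> f'"
      by (rule exists_involution[OF \<theta>])
    have "f' \<in> ?O" using f' \<theta> h unfolding refines_epi_def by blast
    with sub f' show "?O \<inter> U \<noteq> {}" by blast
  qed
qed

text \<open>Density is where amalgamation enters: the map \<open>\<alpha>\<close> to be lifted is
  amalgamated with the map \<open>\<beta>\<close> through which \<open>\<phi>\<close> factors on a
  small open set.\<close>

lemma lifts_epi_open_dense:
  assumes \<phi>: "epi (2 * n) \<phi>" and \<alpha>: "path_epi (2 * m) (2 * n) \<alpha>" "flip_equivariant (2 * m) (2 * n) \<alpha>"
  shows "openin Inv {f \<in> involutions P r. lifts_epi n \<phi> m \<alpha> f}"
    and "Inv closure_of {f \<in> involutions P r. lifts_epi n \<phi> m \<alpha> f} = topspace Inv"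
proof -
  let ?O = "{f \<in> involutions P r. lifts_epi n \<phi> m \<alpha> f}"
  have not_equi: "{f \<in> involutions P r. \<not> equivariant (2 * n) \<phi> f} \<subseteq> ?O"
    unfolding lifts_epi_def by blast
  show "openin Inv ?O"
  proof (subst openin_subopen, intro ballI)
    fix f assume f: "f \<in> ?O"
    show "\<exists>T. openin Inv T \<and> f \<in> T \<and> T \<subseteq> ?O"
    proof (cases "equivariant (2 * n) \<phi> f")
      case True
      with f obtain \<theta> where \<theta>: "epi (2 * m) \<theta>" "equivariant (2 * m) \<theta> f" "\<forall>x \<in> X. \<phi> x = \<alpha> (\<theta> x)"
        unfolding lifts_epi_def by blast
      have "{f \<in> involutions P r. equivariant (2 * m) \<theta> f} \<subseteq> ?O"
        using \<theta>(1,3) unfolding lifts_epi_def by blast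
      with openin_equivariant(1)[OF \<theta>(1)] \<theta>(2) f show ?thesis by blast
    next
      case False
      with openin_equivariant(2)[OF \<phi>] not_equi f show ?thesis by blast
    qed
  qed
  show "Inv closure_of ?O = topspace Inv"
    unfolding dense_intersects_open
  proof (intro allI impI)
    fix U assume U: "openin Inv U \<and> U \<noteq> {}"
    then obtain f where f: "f \<in> U" by blast
    have f_inv: "f \<in> involutions P r" using f U openin_subset topspace_Inv by blast
    show "?O \<inter> U \<noteq> {}"
    proof (cases "equivariant (2 * n) \<phi> f")
      case False
      with f f_inv not_equi show ?thesis by blast
    next
      case True
      let ?U = "U \<inter> {f \<in> involutions P r. equivariant (2 * n) \<phi> f}"
      have U': "openin Inv ?U" using U openin_equivariant(1)[OF \<phi>] by blast
      have fU: "f \<in> ?U" using f f_inv True by blast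
      obtain k \<theta> \<beta> where \<theta>: "epi (2 * k) \<theta>" and \<beta>: "\<And>x. x \<in> X \<Longrightarrow> \<phi> x = \<beta> (\<theta> x)"
        and sub: "{f' \<in> involutions P r. equivariant (2 * k) \<theta> f'} \<subseteq> ?U"
        by (rule equivariant_nbhd_base[OF f_inv U' fU epi_locally_const[OF \<phi>]]) (rule that)
      \<comment> \<open>The original \<open>f\<close> need not be equivariant for
        \<open>\<theta>\<close>. An involution that is lies in \<open>?U\<close> and is therefore
        equivariant for \<open>\<phi>\<close> too; this forces \<open>\<beta>\<close> to commute
        with the flips.\<close>
      obtain f1 where f1: "f1 \<in> involutions P r" "equivariant (2 * k) \<theta> f1"
        by (rule exists_involution[OF \<theta>])
      have f1\<phi>: "equivariant (2 * n) \<phi> f1" using sub f1 by blast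
      have \<beta>_epi: "path_epi (2 * k) (2 * n) \<beta>" by (rule epi_factor[OF \<theta> \<phi> \<beta>])
      have \<beta>_flip: "flip_equivariant (2 * k) (2 * n) \<beta>"
        by (rule flip_equivariant_factor[OF f1(1) \<theta> f1(2) \<phi> f1\<phi> \<beta>])
      have "n \<ge> 1" using epi_pos[OF \<phi>] by simp
      from equivariant_amalgamation[OF \<alpha> \<beta>_epi \<beta>_flip this] obtain p \<gamma> \<delta> where \<gamma>: "path_epi (2*p) (2*m) \<gamma>" "flip_equivariant (2*p) (2*m) \<gamma>"
        and \<delta>: "path_epi (2*p) (2*k) \<delta>" "flip_equivariant (2*p) (2*k) \<delta>"
        and \<gamma>\<delta>: "\<forall>i \<in> {1..2*p}. \<alpha> (\<gamma> i) = \<beta> (\<delta> i)"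
        by (elim exE conjE)
      \<comment> \<open>An epimorphism onto the amalgam. An involution equivariant for
        \<open>\<eta>\<close> is so for \<open>\<theta>\<close>, hence lies in \<open>U\<close>, and
        \<open>\<gamma> \<circ> \<eta>\<close> is the lift.\<close>
      obtain \<eta> where \<eta>: "epi (2*p) \<eta>" and \<delta>\<eta>: "\<And>x. x \<in> X \<Longrightarrow> \<theta> x = \<delta> (\<eta> x)"
        by (rule epi_extension[OF \<theta> \<delta>(1)]) (rule that)
      obtain f2 where f2: "f2 \<in> involutions P r" "equivariant (2*p) \<eta> f2"
        by (rule exists_involution[OF \<eta>])
      have "equivariant (2*k) \<theta> f2"
        unfolding equivariant_def
      proof
        fix x assume x: "x \<in> X"
        show "\<theta> (f2 x) = flip (2*k) (\<theta> x)"
          using \<delta>\<eta>[OF x] \<delta>\<eta>[OF involution_in[OF f2(1) x]] equivariantD[OF f2(2) x] \<delta>(2)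
            epi_in[OF \<eta> x] by (simp add: flip_equivariant_def)
      qed
      hence f2U: "f2 \<in> U" using sub f2(1) by blast
      have "lifts_epi n \<phi> m \<alpha> f2" unfolding lifts_epi_def
      proof (intro impI exI conjI ballI)
        show "epi (2 * m) (\<gamma> \<circ> \<eta>)" by (rule epi_comp[OF \<eta> \<gamma>(1)])
        show "equivariant (2 * m) (\<gamma> \<circ> \<eta>) f2"
          using equivariantD[OF f2(2)] \<gamma>(2) epi_in[OF \<eta>]
          by (simp add: equivariant_def flip_equivariant_def)
        show "\<phi> x = \<alpha> ((\<gamma> \<circ> \<eta>) x)" if x: "x \<in> X" for x
          using \<beta>[OF x] \<delta>\<eta>[OF x] \<gamma>\<delta> epi_in[OF \<eta> x] by simp
      qed
      with f2 f2U show ?thesis by blast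
    qed
  qed
qed

text \<open>An epimorphism is determined on \<open>X\<close> by the finite set of its values, each
  paired with its clopen fibre.\<close>

lemma countable_epi: "countable {\<phi> \<in> extensional X. \<exists>n. epi n \<phi>}"
proof -
  define F where "F \<phi> = (\<lambda>a. (a, {x \<in> X. \<phi> x = a})) ` (\<phi> ` X)" for \<phi> :: "'a \<Rightarrow> nat"
  have "countable {S. finite S \<and> S \<subseteq> (UNIV :: nat set) \<times> {C. clopen C}}"
    by (intro countable_Collect_finite_subset countable_SIGMA countable_clopen) auto
  moreover have "F ` {\<phi> \<in> extensional X. \<exists>n. epi n \<phi>} \<subseteq> {S. finite S \<and> S \<subseteq> (UNIV :: nat set) \<times> {C. clopen C}}"
  proof
    fix S assume "S \<in> F ` {\<phi> \<in> extensional X. \<exists>n. epi n \<phi>}"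
    then obtain n \<phi> where \<phi>: "epi n \<phi>" "S = F \<phi>" by blast
    have "clopen {x \<in> X. \<phi> x = a}" for a
      using openin_fibre[OF epi_locally_const[OF \<phi>(1)]] compactin_fibre[OF \<phi>(1)] top_structure(2)
      by (simp add: clopen_def compactin_imp_closedin)
    then show "S \<in> {S. finite S \<and> S \<subseteq> UNIV \<times> {C. clopen C}}"
      using epi_image[OF \<phi>(1)] \<phi>(2) by (auto simp: F_def)
  qed
  moreover have "inj_on F {\<phi> \<in> extensional X. \<exists>n. epi n \<phi>}"
  proof (rule inj_onI)
    fix \<phi> \<psi> assume \<phi>: "\<phi> \<in> {\<phi> \<in> extensional X. \<exists>n. epi n \<phi>}"
      and \<psi>: "\<psi> \<in> {\<phi> \<in> extensional X. \<exists>n. epi n \<phi>}" and eq: "F \<phi> = F \<psi>"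
    show "\<phi> = \<psi>"
    proof (rule extensionalityI[of _ X])
      fix x assume x: "x \<in> X"
      hence "(\<phi> x, {y \<in> X. \<phi> y = \<phi> x}) \<in> F \<phi>" unfolding F_def by (intro imageI)
      hence "(\<phi> x, {y \<in> X. \<phi> y = \<phi> x}) \<in> F \<psi>" by (simp only: eq)
      then obtain a where a: "\<phi> x = a" "{y \<in> X. \<phi> y = \<phi> x} = {y \<in> X. \<psi> y = a}"
        unfolding F_def by (elim imageE Pair_inject) (rule that)
      have "x \<in> {y \<in> X. \<phi> y = \<phi> x}" using x by simp
      hence "x \<in> {y \<in> X. \<psi> y = a}" unfolding a(2) .
      with a(1) show "\<phi> x = \<psi> x" by simp
    qed (use \<phi> \<psi> in auto)
  qed
  ultimately show ?thesis
    by (intro countable_image_inj_on[of F]) (rule countable_subset)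
qed

lemma exists_generic_family:
  "\<exists>\<O>. countable \<O> \<and> (\<forall>W \<in> \<O>. openin Inv W \<and> Inv closure_of W = topspace Inv) \<and>
     topspace Inv \<inter> \<Inter>\<O> \<subseteq> Collect generic"
proof -
  let ?E = "{\<phi> \<in> extensional X. \<exists>n. epi n \<phi>}"
  let ?A = "\<lambda>n m. {\<alpha> \<in> {1..2*m} \<rightarrow>\<^sub>E {1..2*n}. path_epi (2*m) (2*n) \<alpha> \<and> flip_equivariant (2*m) (2*n) \<alpha>}"
  define \<O>1 where "\<O>1 = (\<lambda>\<psi>. {f \<in> involutions P r. refines_epi \<psi> f}) ` ?E"
  define \<O>2 where "\<O>2 = (\<Union>n. \<Union>m. \<Union>\<phi> \<in> {\<phi> \<in> ?E. epi (2*n) \<phi>}.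
    (\<lambda>\<alpha>. {f \<in> involutions P r. lifts_epi n \<phi> m \<alpha> f}) ` ?A n m)"
  have fin: "finite (?A n m)" for n m
    by (rule finite_subset[of _ "{1..2*m} \<rightarrow>\<^sub>E {1..2*n}"]) (auto intro: finite_PiE)
  have sub: "countable {\<phi> \<in> ?E. epi (2*n) \<phi>}" for n
    by (rule countable_subset[OF _ countable_epi]) auto
  have "countable \<O>1" unfolding \<O>1_def by (intro countable_image countable_epi)
  moreover have "countable \<O>2" unfolding \<O>2_def
    by (intro countable_UN countable_image) (rule countableI_type sub countable_finite[OF fin])+
  ultimately have "countable (\<O>1 \<union> \<O>2)" by (rule countable_Un)
  moreover have "\<forall>W \<in> \<O>1 \<union> \<O>2. openin Inv W \<and> Inv closure_of W = topspace Inv"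
  proof
    fix W assume "W \<in> \<O>1 \<union> \<O>2"
    then consider "W \<in> \<O>1" | "W \<in> \<O>2" by blast
    then show "openin Inv W \<and> Inv closure_of W = topspace Inv"
    proof cases
      case 1
      then obtain n \<psi> where \<psi>: "epi n \<psi>" "W = {f \<in> involutions P r. refines_epi \<psi> f}"
        unfolding \<O>1_def by blast
      show ?thesis unfolding \<psi>(2) using refines_epi_open_dense[OF \<psi>(1)] by (rule conjI)
    next
      case 2
      then obtain n m \<phi> \<alpha> where "\<phi> \<in> {\<phi> \<in> ?E. epi (2*n) \<phi>}" and \<alpha>: "\<alpha> \<in> ?A n m"
        and W: "W = {f \<in> involutions P r. lifts_epi n \<phi> m \<alpha> f}"
        unfolding \<O>2_def by (elim UN_E imageE) (rule that)
      then have \<phi>: "epi (2*n) \<phi>" by blast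
      have "path_epi (2*m) (2*n) \<alpha>" "flip_equivariant (2*m) (2*n) \<alpha>" using \<alpha> by blast+
      from lifts_epi_open_dense[OF \<phi> this] show ?thesis unfolding W by (rule conjI)
    qed
  qed
  moreover have "topspace Inv \<inter> \<Inter>(\<O>1 \<union> \<O>2) \<subseteq> Collect generic"
  proof
    fix f assume f: "f \<in> topspace Inv \<inter> \<Inter>(\<O>1 \<union> \<O>2)"
    hence f_inv: "f \<in> involutions P r" using topspace_Inv by blast
    \<comment> \<open>Functions that agree on \<open>X\<close>, or on \<open>{1..2*m}\<close>,
      impose the same condition, so restrictions reduce genericity to countably many
      conditions.\<close>
    have restr: "epi n (restrict \<phi> X)" if "epi n \<phi>" for n \<phi>
      by (rule epi_cong[OF that]) simp
    have "refines_epi \<psi> f" if \<psi>: "epi n \<psi>" for n \<psi>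
    proof -
      have "restrict \<psi> X \<in> ?E" using restr[OF \<psi>] by auto
      hence "{f \<in> involutions P r. refines_epi (restrict \<psi> X) f} \<in> \<O>1 \<union> \<O>2"
        unfolding \<O>1_def by blast
      hence "refines_epi (restrict \<psi> X) f" using f by blast
      then show ?thesis by (simp add: refines_epi_def)
    qed
    moreover have "lifts_epi n \<phi> m \<alpha> f"
      if \<phi>: "epi (2 * n) \<phi>" and \<alpha>: "path_epi (2 * m) (2 * n) \<alpha>" "flip_equivariant (2 * m) (2 * n) \<alpha>"
      for n \<phi> m \<alpha>
    proof -
      let ?\<phi> = "restrict \<phi> X" and ?\<alpha> = "restrict \<alpha> {1..2*m}"
      have \<phi>': "?\<phi> \<in> {\<phi> \<in> ?E. epi (2*n) \<phi>}" using restr[OF \<phi>] by auto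
      have \<alpha>': "?\<alpha> \<in> ?A n m"
        using \<alpha> path_epi_in[OF \<alpha>(1)] flip_in[of _ "2*m"]
        by (auto simp: path_epi_def flip_equivariant_def)
      have "{f \<in> involutions P r. lifts_epi n ?\<phi> m ?\<alpha> f} \<in> \<O>1 \<union> \<O>2"
        unfolding \<O>2_def
        by (rule UnI2, rule UN_I[OF UNIV_I], rule UN_I[OF UNIV_I], rule UN_I[OF \<phi>'],
            rule image_eqI[OF refl \<alpha>'])
      hence lift: "lifts_epi n ?\<phi> m ?\<alpha> f" using f by blast
      show ?thesis unfolding lifts_epi_def
      proof
        assume "equivariant (2 * n) \<phi> f"
        hence "equivariant (2 * n) ?\<phi> f"
          using involution_in[OF f_inv] by (simp add: equivariant_def)
        then obtain \<theta> where \<theta>: "epi (2 * m) \<theta>" "equivariant (2 * m) \<theta> f" "\<forall>x \<in> X. ?\<phi> x = ?\<alpha> (\<theta> x)"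
          using lift unfolding lifts_epi_def by blast
        have "\<phi> x = \<alpha> (\<theta> x)" if "x \<in> X" for x
          using \<theta>(3) epi_in[OF \<theta>(1) that] that by simp
        with \<theta> show "\<exists>\<theta>. epi (2 * m) \<theta> \<and> equivariant (2 * m) \<theta> f \<and> (\<forall>x \<in> X. \<phi> x = \<alpha> (\<theta> x))" by blast
      qed
    qed
    ultimately show "f \<in> Collect generic" using f_inv unfolding generic_def by blast
  qed
  ultimately show ?thesis by blast
qed


subsection \<open>Back and forth\<close>

lemma generic_involution: "generic f \<Longrightarrow> f \<in> involutions P r"
  by (simp add: generic_def)

text \<open>Cofinality for \<open>f\<close> gives a refinement \<open>\<eta>\<close> of
  \<open>\<theta>\<close> that resolves \<open>C\<close>. The bonding map that it induces commutes
  with the flips, so the lifting property of \<open>g\<close> copies it above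
  \<open>\<theta>'\<close>.\<close>

lemma back_and_forth_half:
  assumes f: "generic f" and g: "generic g"
    and \<theta>: "epi (2*p) \<theta>" "equivariant (2*p) \<theta> f" and \<theta>': "epi (2*p) \<theta>'" "equivariant (2*p) \<theta>' g"
    and C: "clopen C"
  obtains q \<beta> \<eta> \<eta>' where "epi (2*q) \<eta>" "equivariant (2*q) \<eta> f" "epi (2*q) \<eta>'" "equivariant (2*q) \<eta>' g"
    "\<And>x. x \<in> X \<Longrightarrow> \<theta> x = \<beta> (\<eta> x)" "\<And>x. x \<in> X \<Longrightarrow> \<theta>' x = \<beta> (\<eta>' x)" "resolves \<eta> C"
proof -
  obtain m \<xi> \<alpha> where \<xi>: "epi m \<xi>" and \<theta>\<xi>: "\<And>x. x \<in> X \<Longrightarrow> \<theta> x = \<alpha> (\<xi> x)" and res: "resolves \<xi> C"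
    by (rule epi_resolving[OF \<theta>(1) C]) (rule that)
  have "refines_epi \<xi> f" using f \<xi> unfolding generic_def by blast
  then obtain q \<eta> h where \<eta>: "epi (2*q) \<eta>" "equivariant (2*q) \<eta> f" and h: "\<forall>x \<in> X. \<xi> x = h (\<eta> x)"
    unfolding refines_epi_def by (elim exE conjE)
  have \<theta>\<eta>: "\<theta> x = (\<alpha> \<circ> h) (\<eta> x)" if "x \<in> X" for x
    using \<theta>\<xi>[OF that] h that by simp
  have \<beta>: "path_epi (2*q) (2*p) (\<alpha> \<circ> h)" by (rule epi_factor[OF \<eta>(1) \<theta>(1) \<theta>\<eta>])
  have \<beta>_flip: "flip_equivariant (2*q) (2*p) (\<alpha> \<circ> h)"
    by (rule flip_equivariant_factor[OF generic_involution[OF f] \<eta> \<theta> \<theta>\<eta>])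
  have "lifts_epi p \<theta>' q (\<alpha> \<circ> h) g" using g \<theta>'(1) \<beta> \<beta>_flip unfolding generic_def by blast
  then obtain \<eta>' where \<eta>': "epi (2*q) \<eta>'" "equivariant (2*q) \<eta>' g" "\<forall>x \<in> X. \<theta>' x = (\<alpha> \<circ> h) (\<eta>' x)"
    using \<theta>'(2) unfolding lifts_epi_def by blast
  have "resolves \<eta> C" using resolves_factor[OF res, of h \<eta>] h by blast
  moreover have "\<theta>' x = (\<alpha> \<circ> h) (\<eta>' x)" if "x \<in> X" for x using \<eta>'(3) that by blast
  ultimately show ?thesis using that[OF \<eta> \<eta>'(1,2) \<theta>\<eta>] by blast
qed

text \<open>Two half steps with the roles of \<open>f\<close> and \<open>g\<close> exchanged; what
  the first one resolves stays resolved after refinement.\<close>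

lemma back_and_forth_step:
  assumes f: "generic f" and g: "generic g"
    and \<theta>: "epi (2*p) \<theta>" "equivariant (2*p) \<theta> f" and \<theta>': "epi (2*p) \<theta>'" "equivariant (2*p) \<theta>' g"
    and C: "clopen C"
  obtains q \<beta> \<eta> \<eta>' where "epi (2*q) \<eta>" "equivariant (2*q) \<eta> f" "epi (2*q) \<eta>'" "equivariant (2*q) \<eta>' g"
    "\<And>x. x \<in> X \<Longrightarrow> \<theta> x = \<beta> (\<eta> x)" "\<And>x. x \<in> X \<Longrightarrow> \<theta>' x = \<beta> (\<eta>' x)" "resolves \<eta> C" "resolves \<eta>' C"
proof -
  obtain m \<beta> \<xi> \<xi>' where \<xi>: "epi (2*m) \<xi>" "equivariant (2*m) \<xi> f" and \<xi>': "epi (2*m) \<xi>'" "equivariant (2*m) \<xi>' g"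
    and \<beta>: "\<And>x. x \<in> X \<Longrightarrow> \<theta> x = \<beta> (\<xi> x)" "\<And>x. x \<in> X \<Longrightarrow> \<theta>' x = \<beta> (\<xi>' x)" and res: "resolves \<xi> C"
    by (rule back_and_forth_half[OF f g \<theta> \<theta>' C]) (rule that)
  obtain q \<gamma> \<eta>' \<eta> where \<eta>': "epi (2*q) \<eta>'" "equivariant (2*q) \<eta>' g" and \<eta>: "epi (2*q) \<eta>" "equivariant (2*q) \<eta> f"
    and \<gamma>: "\<And>x. x \<in> X \<Longrightarrow> \<xi>' x = \<gamma> (\<eta>' x)" "\<And>x. x \<in> X \<Longrightarrow> \<xi> x = \<gamma> (\<eta> x)" and res': "resolves \<eta>' C"
    by (rule back_and_forth_half[OF g f \<xi>' \<xi> C]) (rule that)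
  show ?thesis
  proof (rule that[OF \<eta> \<eta>'])
    show "\<theta> x = (\<beta> \<circ> \<gamma>) (\<eta> x)" if "x \<in> X" for x using \<beta>(1)[OF that] \<gamma>(2)[OF that] by simp
    show "\<theta>' x = (\<beta> \<circ> \<gamma>) (\<eta>' x)" if "x \<in> X" for x using \<beta>(2)[OF that] \<gamma>(1)[OF that] by simp
    show "resolves \<eta> C" using resolves_factor[OF res, of \<gamma> \<eta>] \<gamma>(2) by blast
    show "resolves \<eta>' C" by (rule res')
  qed
qed

text \<open>The back-and-forth must start on a path common to both involutions. Cofinality yields an
  even path of unknown length, which collapses to two vertices.\<close>

lemma generic_equivariant_pair:
  assumes f: "generic f"
  obtains \<theta> where "epi (2*1) \<theta>" "equivariant (2*1) \<theta> f"
proof -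
  obtain \<psi> where "epi 1 \<psi>" using exists_epi[of 1] by blast
  hence "refines_epi \<psi> f" using f unfolding generic_def by blast
  then obtain k \<eta> where \<eta>: "epi (2*k) \<eta>" "equivariant (2*k) \<eta> f" unfolding refines_epi_def by blast
  have k: "k \<ge> 1" using epi_pos[OF \<eta>(1)] by simp
  let ?\<alpha> = "\<lambda>i. if i \<le> k then 1 else 2 :: nat"
  have "epi (2*1) (?\<alpha> \<circ> \<eta>)"
    using epi_comp[OF \<eta>(1) path_epi_pair[OF k]] by simp
  moreover have "equivariant (2*1) (?\<alpha> \<circ> \<eta>) f"
    unfolding equivariant_def
  proof
    fix x assume x: "x \<in> X"
    have "?\<alpha> (flip (2*k) (\<eta> x)) = flip 2 (?\<alpha> (\<eta> x))"
      using flip_equivariant_pair[of k] epi_in[OF \<eta>(1) x] unfolding flip_equivariant_def by blast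
    then show "(?\<alpha> \<circ> \<eta>) (f x) = flip (2*1) ((?\<alpha> \<circ> \<eta>) x)"
      using equivariantD[OF \<eta>(2) x] by simp
  qed
  ultimately show ?thesis by (rule that)
qed

text \<open>The two sequences share their bonding maps, so an automorphism \<open>k\<close> carries
  one to the other; on each level it matches the flip induced by \<open>f\<close> with the flip
  induced by \<open>g\<close>.\<close>

lemma generic_conjugate:
  assumes f: "generic f" and g: "generic g"
  obtains k where "k \<in> Aut P r" "\<And>x. x \<in> X \<Longrightarrow> k (f x) = g (k x)"
proof -
  define S where "S s \<longleftrightarrow> (case s of (p, \<theta>, \<theta>') \<Rightarrow> epi (2*p) \<theta> \<and> equivariant (2*p) \<theta> f \<and>
      epi (2*p) \<theta>' \<and> equivariant (2*p) \<theta>' g)" for s :: "nat \<times> ('a \<Rightarrow> nat) \<times> ('a \<Rightarrow> nat)"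
  define Q where "Q i s t \<longleftrightarrow> (\<exists>\<beta>. (\<forall>x \<in> X. fst (snd s) x = \<beta> (fst (snd t) x)) \<and>
      (\<forall>x \<in> X. snd (snd s) x = \<beta> (snd (snd t) x)) \<and>
      resolves (fst (snd t)) (nth_clopen i) \<and> resolves (snd (snd t)) (nth_clopen i))"
    for i and s t :: "nat \<times> ('a \<Rightarrow> nat) \<times> ('a \<Rightarrow> nat)"
  have "\<exists>s. \<forall>i. S (s i) \<and> Q i (s i) (s (Suc i))"
  proof (rule dependent_nat_choice)
    obtain \<theta> \<theta>' where "epi (2*1) \<theta>" "equivariant (2*1) \<theta> f" "epi (2*1) \<theta>'" "equivariant (2*1) \<theta>' g"
      using generic_equivariant_pair[OF f] generic_equivariant_pair[OF g] by metis
    hence "S (1, \<theta>, \<theta>')" by (simp add: S_def)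
    then show "\<exists>s. S s" by blast
  next
    fix s and i :: nat assume s: "S s"
    obtain p \<theta> \<theta>' where s_eq: "s = (p, \<theta>, \<theta>')" by (cases s)
    have \<theta>: "epi (2*p) \<theta>" "equivariant (2*p) \<theta> f" and \<theta>': "epi (2*p) \<theta>'" "equivariant (2*p) \<theta>' g"
      using s by (simp_all add: S_def s_eq)
    obtain q \<beta> \<eta> \<eta>' where \<eta>: "epi (2*q) \<eta>" "equivariant (2*q) \<eta> f" "epi (2*q) \<eta>'" "equivariant (2*q) \<eta>' g"
      and \<beta>: "\<And>x. x \<in> X \<Longrightarrow> \<theta> x = \<beta> (\<eta> x)" "\<And>x. x \<in> X \<Longrightarrow> \<theta>' x = \<beta> (\<eta>' x)"
      and res: "resolves \<eta> (nth_clopen i)" "resolves \<eta>' (nth_clopen i)"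
      by (rule back_and_forth_step[OF f g \<theta> \<theta>' clopen_nth[of i]]) (rule that)
    have "S (q, \<eta>, \<eta>')" using \<eta> by (simp add: S_def)
    moreover have "Q i s (q, \<eta>, \<eta>')"
      unfolding Q_def s_eq fst_conv snd_conv using \<beta> res by blast
    ultimately show "\<exists>t. S t \<and> Q i s t" by blast
  qed
  then obtain s where "\<forall>i. S (s i) \<and> Q i (s i) (s (Suc i))" by (elim exE)
  hence S: "\<And>i. S (s i)" and Q: "\<And>i. Q i (s i) (s (Suc i))" by blast+
  define N where "N i = 2 * fst (s i)" for i
  define \<theta> where "\<theta> i = fst (snd (s i))" for i
  define \<theta>' where "\<theta>' i = snd (snd (s i))" for i
  have epi: "epi (N i) (\<theta> i)" "epi (N i) (\<theta>' i)"
    and equi: "equivariant (N i) (\<theta> i) f" "equivariant (N i) (\<theta>' i) g" for i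
    using S[of i] by (simp_all add: S_def N_def \<theta>_def \<theta>'_def split_beta)
  have "\<forall>i. \<exists>\<beta>. (\<forall>x \<in> X. \<theta> i x = \<beta> (\<theta> (Suc i) x)) \<and> (\<forall>x \<in> X. \<theta>' i x = \<beta> (\<theta>' (Suc i) x)) \<and>
      resolves (\<theta> (Suc i)) (nth_clopen i) \<and> resolves (\<theta>' (Suc i)) (nth_clopen i)"
    using Q unfolding Q_def \<theta>_def \<theta>'_def by blast
  then obtain \<beta> where "\<forall>i. (\<forall>x \<in> X. \<theta> i x = \<beta> i (\<theta> (Suc i) x)) \<and> (\<forall>x \<in> X. \<theta>' i x = \<beta> i (\<theta>' (Suc i) x)) \<and>
      resolves (\<theta> (Suc i)) (nth_clopen i) \<and> resolves (\<theta>' (Suc i)) (nth_clopen i)"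
    by (elim choice[THEN exE])
  hence \<beta>: "\<And>i x. x \<in> X \<Longrightarrow> \<theta> i x = \<beta> i (\<theta> (Suc i) x)" "\<And>i x. x \<in> X \<Longrightarrow> \<theta>' i x = \<beta> i (\<theta>' (Suc i) x)"
    and res0: "\<And>i. resolves (\<theta> (Suc i)) (nth_clopen i)" "\<And>i. resolves (\<theta>' (Suc i)) (nth_clopen i)"
    by blast+
  have res: "\<exists>i. resolves (\<theta> i) C" "\<exists>i. resolves (\<theta>' i) C" if "clopen C" for C
    using res0 clopen_eq_nth[OF that] by metis+
  obtain k where k: "k \<in> Aut P r" and \<theta>k: "\<And>i x. x \<in> X \<Longrightarrow> \<theta>' i (k x) = \<theta> i x"
    by (rule exists_limit_automorphism[of N \<theta> \<theta>' \<beta>, OF epi])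
      (assumption | rule \<beta> res that)+
  have f_in: "f x \<in> X" and g_in: "g x \<in> X" and k_in: "k x \<in> X" if "x \<in> X" for x
    using involution_in[OF generic_involution[OF f] that] involution_in[OF generic_involution[OF g] that]
      Aut_in[OF k that] by auto
  have "k (f x) = g (k x)" if x: "x \<in> X" for x
  proof (rule resolving_separates[of \<theta>'])
    show "k (f x) \<in> X" "g (k x) \<in> X" using x f_in g_in k_in by blast+
    \<comment> \<open>Both sides equal the flip of \<open>\<theta> i x\<close>.\<close>
    show "\<theta>' i (k (f x)) = \<theta>' i (g (k x))" for i
      using \<theta>k[OF f_in[OF x], of i] equivariantD[OF equi(1) x, of i] equivariantD[OF equi(2) k_in[OF x], of i]
        \<theta>k[OF x, of i] by simp
  qed (rule res(2))
  with k show ?thesis by (rule that)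
qed

lemma orbit_subset:
  assumes h: "h \<in> involutions P r"
  shows "orbit (Aut_group P r) (conj_action P r) h \<subseteq> involutions P r"
proof
  interpret G: group "Aut_group P r" by (rule group_Aut)
  fix u assume "u \<in> orbit (Aut_group P r) (conj_action P r) h"
  then obtain k where k: "k \<in> carrier (Aut_group P r)"
    and u: "u = k \<otimes>\<^bsub>Aut_group P r\<^esub> h \<otimes>\<^bsub>Aut_group P r\<^esub> inv\<^bsub>Aut_group P r\<^esub> k"
    using h by (auto simp: orbit_def conj_action_def)
  have hG: "h \<in> carrier (Aut_group P r)" using involution_Aut[OF h] by (simp add: carrier_Aut)
  have hh: "h \<otimes>\<^bsub>Aut_group P r\<^esub> h = \<one>\<^bsub>Aut_group P r\<^esub>" using h by (simp add: involutions_def)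
  have "u \<otimes>\<^bsub>Aut_group P r\<^esub> u =
      k \<otimes>\<^bsub>Aut_group P r\<^esub> (h \<otimes>\<^bsub>Aut_group P r\<^esub> (inv\<^bsub>Aut_group P r\<^esub> k \<otimes>\<^bsub>Aut_group P r\<^esub> k) \<otimes>\<^bsub>Aut_group P r\<^esub> h)
        \<otimes>\<^bsub>Aut_group P r\<^esub> inv\<^bsub>Aut_group P r\<^esub> k"
    unfolding u using k hG by (simp only: G.m_assoc G.m_closed G.inv_closed)
  also have "\<dots> = \<one>\<^bsub>Aut_group P r\<^esub>" using k hG hh by simp
  finally have "u \<otimes>\<^bsub>Aut_group P r\<^esub> u = \<one>\<^bsub>Aut_group P r\<^esub>" .
  moreover have "u \<in> Aut P r" unfolding u carrier_Aut [symmetric] using k hG by simp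
  ultimately show "u \<in> involutions P r" by (simp add: involutions_def)
qed

lemma generic_in_orbit:
  assumes h: "generic h" and g: "generic g"
  shows "g \<in> orbit (Aut_group P r) (conj_action P r) h"
proof -
  interpret G: group "Aut_group P r" by (rule group_Aut)
  obtain k where k: "k \<in> Aut P r" and kh: "\<And>x. x \<in> X \<Longrightarrow> k (h x) = g (k x)"
    by (rule generic_conjugate[OF h g]) (rule that)
  have hA: "h \<in> Aut P r" and gA: "g \<in> Aut P r"
    using involution_Aut[OF generic_involution] h g by blast+
  have "k \<otimes>\<^bsub>Aut_group P r\<^esub> h = g \<otimes>\<^bsub>Aut_group P r\<^esub> k"
    unfolding mult_Aut[OF k hA] mult_Aut[OF gA k] compose_def
    by (rule restrict_ext) (rule kh)
  hence "g = k \<otimes>\<^bsub>Aut_group P r\<^esub> h \<otimes>\<^bsub>Aut_group P r\<^esub> inv\<^bsub>Aut_group P r\<^esub> k"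
    using G.inv_solve_right[of g "g \<otimes>\<^bsub>Aut_group P r\<^esub> k" k] k gA
      G.m_closed[of g k] by (simp add: carrier_Aut)
  hence "g = conj_action P r k h"
    using generic_involution[OF h] by (simp add: conj_action_def)
  then show ?thesis using k by (auto simp: orbit_def carrier_Aut)
qed

lemma identity_involution: "(\<lambda>x \<in> X. x) \<in> involutions P r"
proof -
  interpret G: group "Aut_group P r" by (rule group_Aut)
  have "(\<lambda>x \<in> X. x) \<in> Aut P r" using G.one_closed by (simp add: one_Aut carrier_Aut)
  then show ?thesis by (simp add: involutions_iff)
qed

text \<open>No Baire category argument is needed to find a generic involution: if there were none, then
  the space of involutions would be meager in itself and every orbit comeager.\<close>

lemma exists_comeager_orbit:
  "\<exists>h \<in> involutions P r. comeager_in Inv (orbit (Aut_group P r) (conj_action P r) h)"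
proof -
  obtain \<O> where \<O>: "countable \<O>" "\<forall>W \<in> \<O>. openin Inv W \<and> Inv closure_of W = topspace Inv"
    "topspace Inv \<inter> \<Inter>\<O> \<subseteq> Collect generic"
    using exists_generic_family by (elim exE conjE)
  \<comment> \<open>A generic involution if there is one; otherwise the identity, for which the
    implication is vacuous.\<close>
  obtain h where h: "h \<in> involutions P r" "\<And>g. generic g \<Longrightarrow> generic h"
    using generic_involution identity_involution by metis
  have "comeager_in Inv (orbit (Aut_group P r) (conj_action P r) h)"
  proof (rule comeager_inI[OF \<O>(1)])
    show "openin Inv W \<and> Inv closure_of W = topspace Inv" if "W \<in> \<O>" for W using \<O>(2) that by blast
    show "orbit (Aut_group P r) (conj_action P r) h \<subseteq> topspace Inv"
      unfolding topspace_Inv by (rule orbit_subset[OF h(1)])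
    show "topspace Inv \<inter> \<Inter>\<O> \<subseteq> orbit (Aut_group P r) (conj_action P r) h"
      using \<O>(3) generic_in_orbit h(2) by blast
  qed
  with h(1) show ?thesis by blast
qed

end

theorem theorem1p7:
  fixes P :: "'a topology" and r :: "('a \<times> 'a) set"
  assumes "projective_Fraisse_limit P r"
  shows "\<exists>h \<in> involutions P r.
           comeager_in (involutions_topology P r) (orbit (Aut_group P r) (conj_action P r) h)"
proof -
  interpret path_limit P r by standard (rule assms)
  show ?thesis by (rule exists_comeager_orbit)
qed

end
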